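(* Let $k$ be a field of characteristic $p > 0$, let $K$ be a field containing $k$, and let $L/K$ be a field extension of type $(n, \mathbf{e})$, where $n \geqslant 1$, $\mathbf{e} = (e_1, \dots, e_r)$, $r \geqslant 1$ and $e_1 \geqslant \dots \geqslant e_r \geqslant 1$. Then \[ \frac{\operatorname{ed}(L/K)}{[L:K]} \leqslant \frac{r}{p^r} \leqslant \frac{1}{p} . \] In particular, $\operatorname{ed}(L/K) \leqslant \frac{1}{2}[L:K]$ for any inseparable field extension $L/K$ of finite degree with $k \subset K$.
   Context: Essential dimension of a field extension. A field extension $L/K$ of finite degree, with $k \subset K$, descends to a subfield $K_0 \subset K$ if there exists a subfield $K_0 \subset L_0 \subset L$ such that $L_0$ and $K$ generate $L$ and $[L_0:K_0] = [L:K]$ (equivalently, $L \simeq L_0 \otimes_{K_0} K$ over $K$). The essential dimension of $L/K$ (over $k$) is $\operatorname{ed}(L/K) = \min\{\operatorname{trdeg}(K_0/k) \mid k \subset K_0 \subset K \text{ and } L/K \text{ descends to } K_0\}$. Type. Let $L/S$ be a purely inseparable extension of finite degree. For $x \in L$ the exponent $e(x,S)$ is the smallest integer $e \geqslant 0$ with $x^{p^e} \in S$. An element $x \in L$ is normal in $L/S$ if $e(x,S) = \max\{e(y,S) \mid y \in L\}$. For a sequence $x_1,\dots,x_r \in L$ put $L_0 = S$ and $L_i = S(x_1,\dots,x_i)$. The sequence is a normal generating sequence of $L/S$ if $L = L_r$ and, for every $i = 1,\dots,r$, $x_i \notin L_{i-1}$ and $x_i$ is normal in $L/L_{i-1}$.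 Its type is $(e_1,\dots,e_r)$ with $e_i = e(x_i, L_{i-1})$; then $e_1 \geqslant \dots \geqslant e_r \geqslant 1$. Normal generating sequences exist, and (by a theorem of Pickert) the type does not depend on the choice of sequence; it is called the type of $L/S$. If $L/K$ is an inseparable field extension of finite degree and $S$ is the separable closure of $K$ in $L$, then $L/K$ is of type $(n,\mathbf{e})$ if $[S:K] = n$ and $L/S$ is of type $\mathbf{e}$. *)

theory Defs
  imports "HOL-Algebra.Algebra" "HOL-Algebra.Indexed_Polynomials" "HOL-Library.Extended_Real"
begin

text \<open>
  All fields live inside one ambient field \<open>R\<close> (the top field \<open>L\<close> of an extension \<open>L/K\<close>);
  its subfields are subsets of its carrier. Univariate polynomials over a subfield are the
  coefficient lists of HOL-Algebra, leading coefficient first.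
\<close>

context ring
begin

text \<open>The additive order of \<open>\<one>\<close>; \<^const>\<open>group.ord\<close> is \<open>0\<close> for elements of infinite order.\<close>

definition characteristic :: nat
  where "characteristic = group.ord (add_monoid R) \<one>"


subsection \<open>Transcendence degree\<close>

text \<open>
  The indeterminates of \<open>P\<close> are indexed by the very ring elements that get substituted for them.
\<close>

definition indexed_value :: "('a multiset \<Rightarrow> 'a) \<Rightarrow> 'a"
  where "indexed_value P =
    (\<Oplus>m \<in> {m. P m \<noteq> \<zero>}. P m \<otimes> (\<Otimes>x \<in> set_mset m. x [^] count m x))"

definition alg_independent :: "'a set \<Rightarrow> 'a set \<Rightarrow> bool"
  where "alg_independent k B \<longleftrightarrow> B \<subseteq> carrier R \<and>
    (\<forall>P \<in> indexed_pset B k. indexed_value P = \<zero> \<longrightarrow> P = indexed_const \<zero>)"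

text \<open>
  Greatest cardinality of an algebraically independent subset. It suffices to look at finite
  subsets: an infinite one contains finite ones of every size, and the supremum is \<open>\<infinity>\<close>.
\<close>

definition trdeg :: "'a set \<Rightarrow> 'a set \<Rightarrow> enat"
  where "trdeg k E = (SUP B \<in> {B. B \<subseteq> E \<and> finite B \<and> alg_independent k B}. enat (card B))"


subsection \<open>Essential dimension of the extension \<open>carrier R / K\<close> over \<open>k\<close>\<close>

definition descends_to :: "'a set \<Rightarrow> 'a set \<Rightarrow> bool"
  where "descends_to K K0 \<longleftrightarrow>
    (\<exists>L0. subfield L0 R \<and> K0 \<subseteq> L0 \<and> generate_field R (L0 \<union> K) = carrier R \<and>
          (\<exists>d. dimension d K0 L0 \<and> dimension d K (carrier R)))"

text \<open>
  For an extension of finite degree the set below is nonempty (it contains \<open>trdeg k K\<close>),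
  so that the infimum in \<^typ>\<open>enat\<close> is a minimum.
\<close>

definition ess_dim :: "'a set \<Rightarrow> 'a set \<Rightarrow> enat"
  where "ess_dim k K =
    Inf {trdeg k K0 | K0. subfield K0 R \<and> k \<subseteq> K0 \<and> K0 \<subseteq> K \<and> descends_to K K0}"


subsection \<open>Separable closure\<close>

definition poly_deriv :: "'a list \<Rightarrow> 'a list"
  where "poly_deriv f = normalize (map (\<lambda>i. [i] \<cdot> coeff f i) (rev [1..<length f]))"

definition separable_poly :: "'a set \<Rightarrow> 'a list \<Rightarrow> bool"
  where "separable_poly K f \<longleftrightarrow> \<one>\<^bsub>K[X]\<^esub> gcdof\<^bsub>K[X]\<^esub> f (poly_deriv f)"

definition separable_elem :: "'a set \<Rightarrow> 'a \<Rightarrow> bool"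
  where "separable_elem K x \<longleftrightarrow> (algebraic over K) x \<and> separable_poly K (Irr K x)"

definition separable_closure :: "'a set \<Rightarrow> 'a set"
  where "separable_closure K = {x \<in> carrier R. separable_elem K x}"


subsection \<open>Type of an inseparable extension\<close>

definition purely_inseparable :: "'a set \<Rightarrow> bool"
  where "purely_inseparable S \<longleftrightarrow>
    (\<forall>x \<in> carrier R. \<exists>e::nat. x [^] (characteristic ^ e) \<in> S)"

definition insep_exponent :: "'a \<Rightarrow> 'a set \<Rightarrow> nat"
  where "insep_exponent x S = (LEAST e. x [^] (characteristic ^ e) \<in> S)"

definition normal_elem :: "'a set \<Rightarrow> 'a \<Rightarrow> bool"
  where "normal_elem S x \<longleftrightarrow> x \<in> carrier R \<and>
    (\<forall>y \<in> carrier R. insep_exponent y S \<le> insep_exponent x S)"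

definition adjoin :: "'a set \<Rightarrow> 'a list \<Rightarrow> 'a set"
  where "adjoin S xs = generate_field R (S \<union> set xs)"

definition normal_generating_seq :: "'a set \<Rightarrow> 'a list \<Rightarrow> bool"
  where "normal_generating_seq S xs \<longleftrightarrow> adjoin S xs = carrier R \<and>
    (\<forall>i < length xs. xs ! i \<notin> adjoin S (take i xs) \<and> normal_elem (adjoin S (take i xs)) (xs ! i))"

definition seq_type :: "'a set \<Rightarrow> 'a list \<Rightarrow> nat list"
  where "seq_type S xs = map (\<lambda>i. insep_exponent (xs ! i) (adjoin S (take i xs))) [0..<length xs]"

definition purely_insep_of_type :: "'a set \<Rightarrow> nat list \<Rightarrow> bool"
  where "purely_insep_of_type S es \<longleftrightarrow>
    purely_inseparable S \<and> finite_dimension S (carrier R) \<and>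
    (\<exists>xs. set xs \<subseteq> carrier R \<and> normal_generating_seq S xs \<and> seq_type S xs = es)"

definition inseparable :: "'a set \<Rightarrow> bool"
  where "inseparable K \<longleftrightarrow> (\<exists>x \<in> carrier R. \<not> separable_elem K x)"

definition of_type :: "'a set \<Rightarrow> nat \<Rightarrow> nat list \<Rightarrow> bool"
  where "of_type K n es \<longleftrightarrow>
    finite_dimension K (carrier R) \<and> inseparable K \<and>
    dimension n K (separable_closure K) \<and> purely_insep_of_type (separable_closure K) es"

end

end

theory Submission
  imports Defs
begin

text \<open>
  Let \<open>M = K(L\<^sup>p)\<close> and \<open>[L:M] = p\<^sup>s\<close>. The elements of a normal generating sequence are \<open>p\<close>-independent
  over \<open>M\<close>, so that \<open>r \<le> s\<close>, and it suffices to show that \<open>ed(L/K) \<le> s [M:K]\<close> when \<open>s \<ge> 1\<close>.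
  Choose a \<open>p\<close>-basis \<open>y\<^sub>1, \<dots>, y\<^sub>s\<close> of \<open>L/M\<close>. Adding to \<open>y\<^sub>1\<close> a suitable element of \<open>M\<close> makes a high
  Frobenius power of \<open>y\<^sub>1\<close> a primitive element of the maximal separable subextension, and then
  \<open>M = K(y\<^sub>1\<^sup>p, \<dots>, y\<^sub>s\<^sup>p)\<close>. The successive minimal polynomials of the \<open>y\<^sub>i\<^sup>p\<close> involve at most \<open>s [M:K]\<close>
  elements of \<open>K\<close>; these elements generate a field over \<open>k\<close> to which \<open>M\<close>, and with it
  \<open>L = M(y\<^sub>1, \<dots>, y\<^sub>s)\<close>, descends. If \<open>s = 0\<close>, then Frobenius preserves linear independence
  over \<open>K\<close> and \<open>L/K\<close> is separable.
\<close>

subsection \<open>Frobenius and linear algebra over subfields\<close>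

text \<open>With d = [M:K] one has [L:K] = d p^s, so that ed(L/K) \<le> s d bounds the quotient by
  s/p^s; since n/p^n does not increase from n = 1 on, r \<le> s turns this into r/p^r. The shift of
  y_1 draws on infinitely many parameters in K. For finite K the field L is finite, Frobenius is
  onto and M = L, so this case falls under s = 0. The separable part is reached as the stable term
  of the decreasing chain of fields K(L^(p^n)): there Frobenius preserves linear independence over
  K, which forces minimal polynomials to have a nonzero derivative. Climbing the chain back from the
  stable term to M turns one primitive element into the generators y_i^p. The equality [L0:K0] =
  [L:K] required for descent is squeezed rather than computed: the tower over K0 has degree at most
  d p^s by construction, and a K0-basis of L0 spans L over K, which is the other inequality. That a
  field generated over k by a set C has transcendence degree at most |C| is obtained by comparing
  numbers of monomials, directly from the definition by polynomials.\<close>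

lemma (in cring) binomial_expansion:
  assumes x: "x \<in> carrier R" and y: "y \<in> carrier R"
  shows "(x \<oplus> y) [^] (n::nat) = (\<Oplus>k\<in>{..n}. [(n choose k)] \<cdot> (x [^] k \<otimes> y [^] (n - k)))"
proof (induction n)
  case 0
  then show ?case by simp
next
  case (Suc n)
  define t where "t k = [(n choose k)] \<cdot> (x [^] k \<otimes> y [^] (n - k))" for k
  define g where "g k = [(n choose k)] \<cdot> (x [^] k \<otimes> y [^] (Suc n - k))" for k
  define h where "h k = [(Suc n choose k)] \<cdot> (x [^] k \<otimes> y [^] (Suc n - k))" for k
  have tc: "t k \<in> carrier R" and gc: "g k \<in> carrier R" and hc: "h k \<in> carrier R" for k
    using x y by (auto simp: t_def g_def h_def)
  have tx: "h (Suc k) = t k \<otimes> x \<oplus> g (Suc k)" for k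
  proof -
    have "t k \<otimes> x = [(n choose k)] \<cdot> ((x [^] k \<otimes> y [^] (n - k)) \<otimes> x)"
      unfolding t_def by (rule add_pow_ldistr) (use x y in auto)
    also have "(x [^] k \<otimes> y [^] (n - k)) \<otimes> x = x [^] Suc k \<otimes> y [^] (n - k)"
      using x y by (simp add: m_ac)
    finally have "t k \<otimes> x = [(n choose k)] \<cdot> (x [^] Suc k \<otimes> y [^] (n - k))" .
    then show ?thesis unfolding h_def g_def
      using x y by (simp add: add.nat_pow_mult del: nat_pow_Suc)
  qed
  have ty: "g k = t k \<otimes> y" if "k \<le> n" for k
  proof -
    have "t k \<otimes> y = [(n choose k)] \<cdot> ((x [^] k \<otimes> y [^] (n - k)) \<otimes> y)"
      unfolding t_def by (rule add_pow_ldistr) (use x y in auto)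
    also have "(x [^] k \<otimes> y [^] (n - k)) \<otimes> y = x [^] k \<otimes> y [^] (Suc n - k)"
      using x y that by (simp add: m_assoc Suc_diff_le)
    finally show ?thesis by (simp add: g_def)
  qed
  have "(\<Oplus>k\<in>{..Suc n}. h k) = (\<Oplus>k\<in>{..n}. h (Suc k)) \<oplus> h 0"
    by (rule finsum_Suc2) (use hc in auto)
  also have "(\<Oplus>k\<in>{..n}. h (Suc k)) = (\<Oplus>k\<in>{..n}. t k \<otimes> x) \<oplus> (\<Oplus>k\<in>{..n}. g (Suc k))"
    unfolding tx using tc gc x by (intro finsum_addf) auto
  also have "h 0 = g 0" by (simp add: h_def g_def)
  also have "(\<Oplus>k\<in>{..n}. t k \<otimes> x) \<oplus> (\<Oplus>k\<in>{..n}. g (Suc k)) \<oplus> g 0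
     = (\<Oplus>k\<in>{..n}. t k \<otimes> x) \<oplus> ((\<Oplus>k\<in>{..n}. g (Suc k)) \<oplus> g 0)"
    using tc gc x by (intro a_assoc) auto
  also have "(\<Oplus>k\<in>{..n}. g (Suc k)) \<oplus> g 0 = (\<Oplus>k\<in>{..Suc n}. g k)"
    by (rule finsum_Suc2[symmetric]) (use gc in auto)
  also have "\<dots> = g (Suc n) \<oplus> (\<Oplus>k\<in>{..n}. g k)"
    by (rule finsum_Suc) (use gc in auto)
  also have "g (Suc n) = \<zero>" by (simp add: g_def binomial_eq_0)
  also have "(\<Oplus>k\<in>{..n}. g k) = (\<Oplus>k\<in>{..n}. t k \<otimes> y)"
    by (rule finsum_cong') (use gc tc y ty in auto)
  also have "(\<Oplus>k\<in>{..n}. t k \<otimes> x) = (\<Oplus>k\<in>{..n}. t k) \<otimes> x"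
    by (rule finsum_ldistr[symmetric]) (use tc x in auto)
  also have "(\<Oplus>k\<in>{..n}. t k \<otimes> y) = (\<Oplus>k\<in>{..n}. t k) \<otimes> y"
    by (rule finsum_ldistr[symmetric]) (use tc y in auto)
  finally have "(\<Oplus>k\<in>{..Suc n}. h k) = (\<Oplus>k\<in>{..n}. t k) \<otimes> x \<oplus> (\<Oplus>k\<in>{..n}. t k) \<otimes> y"
    using tc x y by simp
  moreover have "(x \<oplus> y) [^] Suc n = (\<Oplus>k\<in>{..n}. t k) \<otimes> x \<oplus> (\<Oplus>k\<in>{..n}. t k) \<otimes> y"
    using Suc.IH tc x y by (simp add: t_def[symmetric] r_distr)
  ultimately show ?case by (simp add: h_def)
qed

lemma (in cring) add_pow_char_multiple:
  assumes "[p] \<cdot> \<one> = \<zero>" "(p::nat) dvd n" "x \<in> carrier R"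
  shows "[n] \<cdot> x = \<zero>"
proof -
  obtain j where j: "n = p * j" using assms(2) by auto
  have "[p] \<cdot> x = ([p] \<cdot> \<one>) \<otimes> x"
    using assms(3) add_pow_ldistr[of \<one> x p] by simp
  then have "[p] \<cdot> x = \<zero>" using assms(1,3) by simp
  then show ?thesis using assms(3) unfolding j by (simp add: add.nat_pow_pow[symmetric])
qed

text \<open>The inner binomial coefficients are divisible by \<open>p\<close>. The setting is a
  commutative ring because the fact is applied both to the field and to its polynomial ring.\<close>

lemma (in cring) frobenius_add:
  assumes p: "Factorial_Ring.prime (p::nat)" and ch: "[p] \<cdot> \<one> = \<zero>"
    and x: "x \<in> carrier R" and y: "y \<in> carrier R"
  shows "(x \<oplus> y) [^] p = x [^] p \<oplus> y [^] p"
proof -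
  define f where "f k = [(p choose k)] \<cdot> (x [^] k \<otimes> y [^] (p - k))" for k
  have fc: "f k \<in> carrier R" for k using x y by (simp add: f_def)
  have p0: "p > 0" using p prime_gt_0_nat by blast
  have "(x \<oplus> y) [^] p = (\<Oplus>k\<in>{..p}. f k)"
    unfolding f_def by (rule binomial_expansion[OF x y])
  also have "\<dots> = (\<Oplus>k\<in>{0,p}. f k)"
  proof (rule add.finprod_mono_neutral_cong_right)
    fix k assume "k \<in> {..p} - {0, p}"
    then have "p dvd (p choose k)" using p by (intro dvd_choose_prime) auto
    then show "f k = \<zero>" unfolding f_def
      using add_pow_char_multiple[OF ch] x y by simp
  qed (use fc in auto)
  also have "\<dots> = f 0 \<oplus> f p" using fc p0 by simp
  also have "\<dots> = x [^] p \<oplus> y [^] p" using x y by (simp add: f_def a_comm)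
  finally show ?thesis .
qed

lemma (in ring) subring_nat_pow_closed:
  assumes "subring E R" "x \<in> E"
  shows "x [^] (n::nat) \<in> E"
  using subringE[OF assms(1)] assms(2) by (induction n) auto

locale field_prime_char = field R for R (structure) +
  fixes p :: nat
  assumes p_prime: "Factorial_Ring.prime p" and p_one: "[p] \<cdot> \<one> = \<zero>"
begin

lemma p_gt_1: "p > 1" and p_pos: "p > 0"
  using p_prime prime_gt_1_nat prime_gt_0_nat by auto

lemma frob_add:
  assumes "x \<in> carrier R" "y \<in> carrier R"
  shows "(x \<oplus> y) [^] (p ^ n) = x [^] (p ^ n) \<oplus> y [^] (p ^ n)"
proof (induction n)
  case 0
  then show ?case using assms by simp
next
  case (Suc n)
  have "(x \<oplus> y) [^] (p ^ Suc n) = ((x \<oplus> y) [^] (p ^ n)) [^] p"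
    using assms by (simp add: nat_pow_pow mult.commute)
  also have "\<dots> = x [^] (p ^ Suc n) \<oplus> y [^] (p ^ Suc n)"
    unfolding Suc using assms by (simp add: frobenius_add[OF p_prime p_one] nat_pow_pow mult.commute)
  finally show ?case .
qed

lemma frob_mult:
  assumes "x \<in> carrier R" "y \<in> carrier R"
  shows "(x \<otimes> y) [^] (p ^ n) = x [^] (p ^ n) \<otimes> y [^] (p ^ n)"
  using assms by (rule nat_pow_distrib)

lemma frob_zero: "\<zero> [^] (p ^ n) = \<zero>"
  using p_pos by (simp add: nat_pow_zero)

lemma frob_minus:
  assumes "x \<in> carrier R"
  shows "(\<ominus> x) [^] (p ^ n) = \<ominus> (x [^] (p ^ n))"
proof -
  have "x [^] (p ^ n) \<oplus> (\<ominus> x) [^] (p ^ n) = (x \<oplus> \<ominus> x) [^] (p ^ n)"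
    using assms by (simp add: frob_add)
  also have "\<dots> = \<zero>" using assms by (simp add: r_neg frob_zero)
  finally show ?thesis using assms
    by (metis a_inv_closed add.nat_pow_closed minus_equality nat_pow_closed a_comm)
qed

end

lemma (in field) nat_pow_zero_iff:
  assumes "x \<in> carrier R"
  shows "x [^] (n::nat) = \<zero> \<longleftrightarrow> x = \<zero> \<and> n > 0"
proof (induction n)
  case (Suc n)
  then show ?case using assms integral_iff by auto
qed simp

context field_prime_char
begin

lemma frob_inj:
  assumes "x \<in> carrier R" "y \<in> carrier R" "x [^] (p ^ n) = y [^] (p ^ n)"
  shows "x = y"
proof -
  have "(x \<oplus> \<ominus> y) [^] (p ^ n) = \<zero>"
    using assms by (simp add: frob_add frob_minus r_neg)
  then have "x \<oplus> \<ominus> y = \<zero>" using assms nat_pow_zero_iff by simp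
  then show ?thesis using assms
    by (metis a_inv_closed add.inv_equality minus_minus)
qed

lemma frob_preimage_subfield:
  assumes "subfield E R"
  shows "subfield {x \<in> carrier R. x [^] (p ^ n) \<in> E} R"
proof (rule subfieldI')
  note E = subringE[OF subfieldE(1)[OF assms]]
  show "subring {x \<in> carrier R. x [^] (p ^ n) \<in> E} R"
    by (rule subringI) (use E in \<open>auto simp: frob_add frob_mult frob_minus\<close>)
  fix k assume k: "k \<in> {x \<in> carrier R. x [^] (p ^ n) \<in> E} - {\<zero>}"
  then have kc: "k \<in> carrier R" "k \<noteq> \<zero>" "k [^] (p ^ n) \<in> E" by auto
  then have u: "k \<in> Units R" by (simp add: field_Units)
  have "inv k [^] (p ^ n) \<otimes> k [^] (p ^ n) = \<one>"
    using u kc by (simp add: frob_mult[symmetric])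
  then have "inv k [^] (p ^ n) = inv (k [^] (p ^ n))"
    using u kc by (metis Units_inv_closed inv_char m_comm nat_pow_closed)
  moreover have "inv (k [^] (p ^ n)) \<in> E"
    using subfield_m_inv(1)[OF assms, of "k [^] (p ^ n)"] kc nat_pow_zero_iff by auto
  ultimately show "inv k \<in> {x \<in> carrier R. x [^] (p ^ n) \<in> E}" using u by simp
qed

text \<open>Frobenius is a ring homomorphism, so the elements whose power lies in \<open>E\<close>
  form a subfield, and only the generators have to be checked.\<close>

lemma generate_field_frob:
  assumes "H \<subseteq> carrier R" "subfield E R" "\<And>h. h \<in> H \<Longrightarrow> h [^] (p ^ n) \<in> E"
    and "x \<in> generate_field R H"
  shows "x [^] (p ^ n) \<in> E"
  using generate_field_min_subfield1[OF assms(1) frob_preimage_subfield[OF assms(2)], of n] assms by blast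

end

section \<open>Subrings and spans that are fields\<close>

lemma (in field) subring_is_subfield:
  assumes K: "subfield K R" and F: "subring F R" and "K \<subseteq> F"
    and alg: "\<And>x. x \<in> F \<Longrightarrow> (algebraic over K) x"
  shows "subfield F R"
proof (rule subfieldI'[OF F])
  fix z assume z: "z \<in> F - {\<zero>}"
  then have zc: "z \<in> carrier R" using subringE(1)[OF F] by auto
  have "subfield (simple_extension K z) R"
    using simple_extension_is_subfield[OF K zc] alg z by auto
  moreover have "z \<in> simple_extension K z - {\<zero>}"
    using simple_extension_mem[OF subfieldE(1)[OF K] zc] z by auto
  \<comment> \<open>As \<open>z\<close> is algebraic, K[z] is already a field, and every subring
    containing \<open>K\<close> and \<open>z\<close> contains it.\<close>
  ultimately have "inv z \<in> simple_extension K z" using subfield_m_inv(1) by auto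
  then show "inv z \<in> F" using simple_extension_subring_incl[OF F \<open>K \<subseteq> F\<close>] z by auto
qed

lemma (in field) finite_dimension_subring_is_subfield:
  assumes "subfield K R" "subring F R" "K \<subseteq> F" "finite_dimension K F"
  shows "subfield F R"
  using subring_is_subfield[OF assms(1-3)] finite_dimension_imp_algebraic[OF assms(1,2,4)] by blast

text \<open>Bilinearity reduces products of spans to products of spanning vectors. Keeping the three
  lists apart lets the same fact serve for the closure of one span and for products between
  different ones.\<close>

lemma (in cring) Span_mult_closed:
  assumes K: "subfield K R" and c: "set Us \<subseteq> carrier R" "set Vs \<subseteq> carrier R" "set Ws \<subseteq> carrier R"
    and uv: "\<And>u v. u \<in> set Us \<Longrightarrow> v \<in> set Vs \<Longrightarrow> u \<otimes> v \<in> Span K Ws"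
    and a: "a \<in> Span K Us" and b: "b \<in> Span K Vs"
  shows "a \<otimes> b \<in> Span K Ws"
proof -
  note Kc = subfieldE(3)[OF K]
  have W: "\<zero> \<in> Span K Ws" "\<And>k v. \<lbrakk>k \<in> K; v \<in> Span K Ws\<rbrakk> \<Longrightarrow> k \<otimes> v \<in> Span K Ws"
    "\<And>v w. \<lbrakk>v \<in> Span K Ws; w \<in> Span K Ws\<rbrakk> \<Longrightarrow> v \<oplus> w \<in> Span K Ws"
    using Span_subgroup_props[OF K c(3)] Span_smult_closed[OF K c(3)] by auto
  have 1: "u \<otimes> b \<in> Span K Ws" if u: "u \<in> set Us" for u
    using c(2) uv[OF u] b
  proof (induction Vs arbitrary: b)
    case Nil
    then show ?case using u c W(1) by auto
  next
    case (Cons v Vs)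
    obtain k b' where kb: "k \<in> K" "b' \<in> Span K Vs" "b = k \<otimes> v \<oplus> b'"
      using Cons.prems(3) by (auto simp: line_extension_mem_iff)
    have cc: "u \<in> carrier R" "v \<in> carrier R" "k \<in> carrier R" "b' \<in> carrier R"
      using u c(1) Cons.prems(1) kb Kc Span_in_carrier[OF Kc, of Vs] by auto
    have "u \<otimes> b = k \<otimes> (u \<otimes> v) \<oplus> u \<otimes> b'"
      unfolding kb(3) using cc by (simp add: r_distr m_ac)
    moreover have "u \<otimes> b' \<in> Span K Ws" using Cons kb by auto
    ultimately show ?case using W kb Cons.prems(2) by auto
  qed
  show ?thesis using c(1) 1 a
  proof (induction Us arbitrary: a)
    case Nil
    then show ?case using b c W(1) Span_in_carrier[OF Kc c(2)] by auto
  next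
    case (Cons u Us)
    obtain k a' where kb: "k \<in> K" "a' \<in> Span K Us" "a = k \<otimes> u \<oplus> a'"
      using Cons.prems(3) by (auto simp: line_extension_mem_iff)
    have cc: "u \<in> carrier R" "b \<in> carrier R" "k \<in> carrier R" "a' \<in> carrier R"
      using Cons.prems(1) kb Kc Span_in_carrier[OF Kc, of Us] b Span_in_carrier[OF Kc c(2)] by auto
    have "a \<otimes> b = k \<otimes> (u \<otimes> b) \<oplus> a' \<otimes> b"
      unfolding kb(3) using cc by (simp add: l_distr m_assoc)
    moreover have "a' \<otimes> b \<in> Span K Ws" using Cons kb by auto
    ultimately show ?case using W kb Cons.prems(2) by auto
  qed
qed

lemma (in ring) Span_dimension_le:
  assumes K: "subfield K R" and c: "set Us \<subseteq> carrier R"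
  shows "\<exists>d \<le> length Us. dimension d K (Span K Us)"
  using c
proof (induction Us)
  case Nil
  then show ?case using dimension.zero_dim by auto
next
  case (Cons u Us)
  then obtain d where d: "d \<le> length Us" "dimension d K (Span K Us)" by auto
  show ?case
  proof (cases "u \<in> Span K Us")
    case True
    then have "set (u # Us) \<subseteq> Span K Us" using Span_base_incl[OF K, of Us] Cons.prems by auto
    then have "Span K (u # Us) = Span K Us"
      using mono_Span_subset[OF K, of "u # Us" Us] mono_Span[OF K, of Us u] Cons.prems by auto
    then show ?thesis using d by (metis le_SucI length_Cons)
  next
    case False
    then have "dimension (Suc d) K (Span K (u # Us))"
      using dimension.Suc_dim[of u "Span K Us" d K] d Cons.prems by simp
    then show ?thesis using d(1) by (metis Suc_le_mono length_Cons)
  qed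
qed

lemma (in cring) Span_is_subring:
  assumes K: "subfield K R" and c: "set Us \<subseteq> carrier R"
    and one: "\<one> \<in> Span K Us"
    and uv: "\<And>u v. u \<in> set Us \<Longrightarrow> v \<in> set Us \<Longrightarrow> u \<otimes> v \<in> Span K Us"
  shows "subring (Span K Us) R"
  by (rule subringI) (use Span_subgroup_props[OF K c] one Span_mult_closed[OF K c c c uv] in auto)

lemma (in ring) Span_contains_base_field:
  assumes K: "subfield K R" and c: "set Us \<subseteq> carrier R" and one: "\<one> \<in> Span K Us"
  shows "K \<subseteq> Span K Us"
  using Span_smult_closed[OF K c _ one] subfieldE(3)[OF K] by fastforce

text \<open>A subring of finite dimension over \<open>K\<close> consists of algebraic elements and
  is therefore a field. In this way fields are built as spans of explicit lists, which can then be
  formed over smaller base fields as well.\<close>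

lemma (in field) Span_is_subfield:
  assumes K: "subfield K R" and c: "set Us \<subseteq> carrier R"
    and one: "\<one> \<in> Span K Us"
    and uv: "\<And>u v. u \<in> set Us \<Longrightarrow> v \<in> set Us \<Longrightarrow> u \<otimes> v \<in> Span K Us"
  shows "subfield (Span K Us) R"
  using finite_dimension_subring_is_subfield[OF K Span_is_subring[OF assms] Span_contains_base_field[OF K c one]
     Span_finite_dimension[OF K c]] .

subsection \<open>Transcendence degree of a finitely generated field\<close>

context field
begin

text \<open>The monomial that occurs inside \<open>indexed_value\<close>.\<close>

definition monom_value :: "'a multiset \<Rightarrow> 'a"
  where "monom_value m = (\<Otimes>x \<in> set_mset m. x [^] count m x)"

lemma monom_value_closed [simp]: "set_mset m \<subseteq> carrier R \<Longrightarrow> monom_value m \<in> carrier R"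
  unfolding monom_value_def by (intro finprod_closed) auto

lemma monom_value_empty [simp]: "monom_value {#} = \<one>"
  by (simp add: monom_value_def)

lemma monom_value_superset:
  assumes "set_mset m \<subseteq> A" "finite A" "A \<subseteq> carrier R"
  shows "monom_value m = (\<Otimes>x\<in>A. x [^] count m x)"
  unfolding monom_value_def
proof (rule finprod_mono_neutral_cong_left)
  show "x [^] count m x = \<one>" if "x \<in> A - set_mset m" for x
    using that by (simp add: not_in_iff)
qed (use assms in auto)

lemma monom_value_union:
  assumes "set_mset m \<subseteq> carrier R" "set_mset n \<subseteq> carrier R"
  shows "monom_value (m + n) = monom_value m \<otimes> monom_value n"
proof -
  let ?A = "set_mset m \<union> set_mset n"
  have A: "finite ?A" "?A \<subseteq> carrier R" using assms by auto
  have "monom_value (m + n) = (\<Otimes>x\<in>?A. x [^] count (m + n) x)"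
    using A by (intro monom_value_superset) auto
  also have "\<dots> = (\<Otimes>x\<in>?A. x [^] count m x \<otimes> x [^] count n x)"
    using A by (intro finprod_cong') (auto simp: nat_pow_mult)
  also have "\<dots> = (\<Otimes>x\<in>?A. x [^] count m x) \<otimes> (\<Otimes>x\<in>?A. x [^] count n x)"
    using A by (intro finprod_multf) auto
  also have "\<dots> = monom_value m \<otimes> monom_value n"
    using A monom_value_superset[of m ?A] monom_value_superset[of n ?A] by auto
  finally show ?thesis .
qed

lemma monom_value_single [simp]: "x \<in> carrier R \<Longrightarrow> monom_value {#x#} = x"
  by (simp add: monom_value_def)

lemma monom_value_add_mset:
  assumes "x \<in> carrier R" "set_mset m \<subseteq> carrier R"
  shows "monom_value (add_mset x m) = x \<otimes> monom_value m"
  using monom_value_union[of "{#x#}" m] assms by simp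

end

text \<open>Bounding each exponent separately, rather than the total degree, makes the number of
  monomials an exact power and lets the bounds add up under multiplication.\<close>

definition bounded_monoms :: "'b set \<Rightarrow> nat \<Rightarrow> 'b multiset set"
  where "bounded_monoms B E = {m. set_mset m \<subseteq> B \<and> (\<forall>x. count m x \<le> E)}"

lemma bounded_monoms_finite_card:
  assumes "finite B"
  shows "finite (bounded_monoms B E)" "card (bounded_monoms B E) = (E + 1) ^ card B"
proof -
  define f :: "'a multiset \<Rightarrow> 'a \<Rightarrow> nat" where "f m = (\<lambda>x\<in>B. count m x)" for m
  have "bij_betw f (bounded_monoms B E) (PiE B (\<lambda>_. {..E}))"
  proof (rule bij_betwI')
    show "f m = f n \<longleftrightarrow> m = n" if m: "m \<in> bounded_monoms B E" and n: "n \<in> bounded_monoms B E" for m n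
    proof
      assume eq: "f m = f n"
      show "m = n"
      proof (rule multiset_eqI)
        fix x
        show "count m x = count n x"
        proof (cases "x \<in> B")
          case True
          then show ?thesis using fun_cong[OF eq, of x] by (simp add: f_def)
        next
          case False
          then have "x \<notin># m" "x \<notin># n" using m n by (auto simp: bounded_monoms_def)
          then show ?thesis by (simp add: count_eq_zero_iff[symmetric])
        qed
      qed
    qed auto
    show "f m \<in> PiE B (\<lambda>_. {..E})" if "m \<in> bounded_monoms B E" for m
      using that by (auto simp: f_def bounded_monoms_def)
    show "\<exists>m \<in> bounded_monoms B E. g = f m" if g: "g \<in> PiE B (\<lambda>_. {..E})" for g
    proof -
      define h where "h x = (if x \<in> B then g x else 0)" for x
      have fin: "finite {x. h x > 0}" by (rule finite_subset[OF _ assms]) (auto simp: h_def)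
      have c: "count (Abs_multiset h) x = h x" for x using fin by simp
      have "Abs_multiset h \<in> bounded_monoms B E"
        unfolding bounded_monoms_def using g by (auto simp: c count_greater_zero_iff[symmetric] h_def PiE_iff simp del: count_greater_zero_iff split: if_splits)
      moreover have "g = f (Abs_multiset h)"
        using g by (auto simp: f_def c h_def PiE_iff extensional_def fun_eq_iff)
      ultimately show ?thesis by blast
    qed
  qed
  then show "finite (bounded_monoms B E)" "card (bounded_monoms B E) = (E + 1) ^ card B"
    using bij_betw_finite[of f] bij_betw_same_card[of f] finite_PiE[OF assms, of "\<lambda>_. {..E}"] card_PiE[OF assms, of "\<lambda>_. {..E}"]
    by auto
qed

lemma bounded_monoms_add:
  "m \<in> bounded_monoms B E \<Longrightarrow> n \<in> bounded_monoms B F \<Longrightarrow> m + n \<in> bounded_monoms B (E + F)"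
  by (auto simp: bounded_monoms_def add_mono)

lemma size_bounded_monoms:
  assumes "finite B" "m \<in> bounded_monoms B E"
  shows "size m \<le> card B * E"
proof -
  have "size m = (\<Sum>x\<in>set_mset m. count m x)" by (simp add: size_multiset_overloaded_eq)
  also have "\<dots> \<le> (\<Sum>x\<in>B. count m x)" using assms by (intro sum_mono2) (auto simp: bounded_monoms_def)
  also have "\<dots> \<le> (\<Sum>x\<in>B. E)" using assms by (intro sum_mono) (auto simp: bounded_monoms_def)
  finally show ?thesis by simp
qed

section \<open>Polynomials with prescribed coefficients and linear independence of monomials\<close>

context ring
begin

lemma monomial_in_indexed_pset:
  fixes B :: "'c set"
  assumes "subring k R" "c \<in> k" "set_mset m \<subseteq> B"
  shows "(\<lambda>n. if n = m then c else \<zero>) \<in> indexed_pset B k"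
  using assms(3)
proof (induction m)
  case empty
  have "(\<lambda>n::'c multiset. if n = {#} then c else \<zero>) = indexed_const c" by (auto simp: indexed_const_def)
  then show ?case using indexed_pset.indexed_const[OF assms(2)] by simp
next
  case (add x m)
  have "indexed_pmult (\<lambda>n. if n = m then c else \<zero>) x = (\<lambda>n. if n = add_mset x m then c else \<zero>)"
    by (rule ext) (auto simp: indexed_pmult_def dest!: multi_member_split)
  then show ?case using indexed_pset.indexed_pmult[of "\<lambda>n. if n = m then c else \<zero>" B k x] add by simp
qed

lemma finite_support_in_indexed_pset:
  fixes B :: "'c set"
  assumes k: "subring k R" and "finite S" and "\<And>m. m \<in> S \<Longrightarrow> set_mset m \<subseteq> B \<and> f m \<in> k"
  shows "(\<lambda>m. if m \<in> S then f m else \<zero>) \<in> indexed_pset B k"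
  using assms(2,3)
proof (induction S)
  case empty
  have "(\<lambda>m::'c multiset. \<zero>) = indexed_const \<zero>" by (simp add: indexed_zero_def)
  then show ?case using indexed_pset.indexed_const[of \<zero> k] subringE(2)[OF k] by simp
next
  case (insert n S)
  have "indexed_padd (\<lambda>m. if m = n then f n else \<zero>) (\<lambda>m. if m \<in> S then f m else \<zero>)
      = (\<lambda>m. if m \<in> insert n S then f m else \<zero>)"
  proof -
    have "f m \<in> carrier R" if "m \<in> insert n S" for m
      using insert.prems[OF that] subringE(1)[OF k] by auto
    then show ?thesis using insert.hyps by (intro ext) (auto simp: indexed_padd_def)
  qed
  then show ?case
    using indexed_pset.indexed_padd[OF monomial_in_indexed_pset[OF k, of "f n" n B]] insert by fastforce
qed

lemma combine_as_finsum:
  assumes "distinct ms" "\<And>m. m \<in> set ms \<Longrightarrow> f m \<in> carrier R" "\<And>m. m \<in> set ms \<Longrightarrow> g m \<in> carrier R"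
  shows "combine (map f ms) (map g ms) = (\<Oplus>m\<in>set ms. f m \<otimes> g m)"
  using assms by (induction ms) auto

end

context field
begin

text \<open>A linear relation between distinct monomials is a polynomial over \<open>k\<close> whose
  value at the elements of \<open>B\<close> is zero. In this form algebraic independence enters the
  dimension count.\<close>

lemma alg_independent_imp_independent:
  assumes k: "subfield k R" and B: "alg_independent k B"
    and ms: "distinct ms" "\<And>m. m \<in> set ms \<Longrightarrow> set_mset m \<subseteq> B"
  shows "independent k (map monom_value ms)"
proof (rule ccontr)
  assume dep: "\<not> ?thesis"
  have Bc: "B \<subseteq> carrier R" using B by (simp add: alg_independent_def)
  have vc: "monom_value m \<in> carrier R" if "m \<in> set ms" for m using ms(2)[OF that] Bc by auto
  obtain Ks where Ks: "length Ks = length (map monom_value ms)" "combine Ks (map monom_value ms) = \<zero>"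
      "set Ks \<subseteq> k" "set Ks \<noteq> {\<zero>}"
    using dependent_imp_non_trivial_combine[OF k _ dep] vc by auto
  have kc: "k \<subseteq> carrier R" using subfieldE(3)[OF k] .
  define f where "f m = the (map_of (zip ms Ks) m)" for m
  have "map f ms = Ks"
    unfolding f_def using Ks(1) ms(1) by (intro nth_equalityI) (auto simp: map_of_zip_nth)
  then have Ksf: "Ks = map f ms" by simp
  have fk: "f m \<in> k" if "m \<in> set ms" for m using Ks(3) that unfolding Ksf by auto
  define P where "P m = (if m \<in> set ms then f m else \<zero>)" for m
  have P: "P \<in> indexed_pset B k"
    unfolding P_def using finite_support_in_indexed_pset[OF subfieldE(1)[OF k], of "set ms" B f] ms(2) fk by auto
  have "indexed_value P = (\<Oplus>m\<in>{m. P m \<noteq> \<zero>}. P m \<otimes> monom_value m)"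
    by (simp add: indexed_value_def monom_value_def)
  also have "\<dots> = (\<Oplus>m\<in>set ms. f m \<otimes> monom_value m)"
    by (rule add.finprod_mono_neutral_cong_left) (use fk vc kc in \<open>auto simp: P_def\<close>)
  also have "\<dots> = combine Ks (map monom_value ms)"
    unfolding Ksf using fk kc by (intro combine_as_finsum[symmetric] ms(1) vc) auto
  finally have "indexed_value P = \<zero>" using Ks(2) by simp
  then have "P = indexed_const \<zero>" using B P by (simp add: alg_independent_def)
  then have "P m = \<zero>" for m by (simp add: indexed_zero_def)
  then have "\<forall>m\<in>set ms. f m = \<zero>" unfolding P_def by metis
  then have "set Ks \<subseteq> {\<zero>}" unfolding Ksf by auto
  \<comment> \<open>\<open>set Ks \<noteq> {\<zero>}\<close> also holds for the empty list, so the
    case that remains is an empty list of monomials, which is independent.\<close>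
  then have "Ks = []" using Ks(4) by (metis set_empty subset_singletonD)
  then have "ms = []" using Ksf by simp
  then show False using dep by simp
qed

text \<open>The values of polynomials over \<open>k\<close> in the elements of \<open>C\<close>, of degree at most \<open>E\<close> in each of them.\<close>

definition box_span :: "'a set \<Rightarrow> 'a set \<Rightarrow> nat \<Rightarrow> 'a set"
  where "box_span k C E = Span k (map monom_value (SOME ms. set ms = bounded_monoms C E \<and> distinct ms))"

lemma box_span_list:
  assumes "finite C" "C \<subseteq> carrier R"
  obtains us where "set us = monom_value ` bounded_monoms C E" "length us = (E + 1) ^ card C"
    "set us \<subseteq> carrier R" "box_span k C E = Span k us"
proof -
  define ms where "ms = (SOME ms. set ms = bounded_monoms C E \<and> distinct ms)"
  have ms: "set ms = bounded_monoms C E \<and> distinct ms"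
    unfolding ms_def by (rule someI_ex) (rule finite_distinct_list[OF bounded_monoms_finite_card(1)[OF assms(1)]])
  show thesis
  proof (rule that[of "map monom_value ms"])
    show "set (map monom_value ms) = monom_value ` bounded_monoms C E" using ms by simp
    show "length (map monom_value ms) = (E + 1) ^ card C"
      using ms bounded_monoms_finite_card(2)[OF assms(1), of E] distinct_card[of ms] by simp
    show "set (map monom_value ms) \<subseteq> carrier R" using ms assms(2) by (auto simp: bounded_monoms_def)
    show "box_span k C E = Span k (map monom_value ms)" by (simp add: box_span_def ms_def)
  qed
qed

section \<open>Counting bound for the transcendence degree of a finitely generated field\<close>

context
  fixes k C assumes k: "subfield k R" and C: "finite C" "C \<subseteq> carrier R"
begin

lemma box_span_props:
  "box_span k C E \<subseteq> carrier R" "\<zero> \<in> box_span k C E"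
  "\<lbrakk>a \<in> box_span k C E; b \<in> box_span k C E\<rbrakk> \<Longrightarrow> a \<oplus> b \<in> box_span k C E"
  "a \<in> box_span k C E \<Longrightarrow> \<ominus> a \<in> box_span k C E"
proof -
  obtain us where us: "set us \<subseteq> carrier R" "box_span k C E = Span k us"
    using box_span_list[OF C] by metis
  show "box_span k C E \<subseteq> carrier R" "\<zero> \<in> box_span k C E"
  "\<lbrakk>a \<in> box_span k C E; b \<in> box_span k C E\<rbrakk> \<Longrightarrow> a \<oplus> b \<in> box_span k C E"
  "a \<in> box_span k C E \<Longrightarrow> \<ominus> a \<in> box_span k C E"
    unfolding us(2) using Span_subgroup_props[OF k us(1)] by auto
qed

lemma box_span_mult:
  assumes "a \<in> box_span k C E" "b \<in> box_span k C F"
  shows "a \<otimes> b \<in> box_span k C (E + F)"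
proof -
  obtain us where us: "set us = monom_value ` bounded_monoms C E" "set us \<subseteq> carrier R" "box_span k C E = Span k us"
    using box_span_list[OF C] by metis
  obtain vs where vs: "set vs = monom_value ` bounded_monoms C F" "set vs \<subseteq> carrier R" "box_span k C F = Span k vs"
    using box_span_list[OF C] by metis
  obtain ws where ws: "set ws = monom_value ` bounded_monoms C (E + F)" "set ws \<subseteq> carrier R"
      "box_span k C (E + F) = Span k ws"
    using box_span_list[OF C] by metis
  have "u \<otimes> v \<in> Span k ws" if uv: "u \<in> set us" "v \<in> set vs" for u v
  proof -
    obtain m n where mn: "m \<in> bounded_monoms C E" "n \<in> bounded_monoms C F" "u = monom_value m" "v = monom_value n"
      using uv unfolding us(1) vs(1) by blast
    then have "u \<otimes> v = monom_value (m + n)"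
      using C(2) by (subst monom_value_union) (auto simp: bounded_monoms_def)
    then have "u \<otimes> v \<in> set ws" using ws(1) bounded_monoms_add[OF mn(1,2)] by auto
    then show ?thesis using Span_base_incl[OF k ws(2)] by auto
  qed
  then show ?thesis using Span_mult_closed[OF k us(2) vs(2) ws(2)] assms us(3) vs(3) ws(3) by auto
qed

lemma box_span_base: "k \<subseteq> box_span k C E"
proof -
  obtain us where us: "set us = monom_value ` bounded_monoms C E" "set us \<subseteq> carrier R" "box_span k C E = Span k us"
    using box_span_list[OF C] by metis
  have "monom_value {#} \<in> set us" unfolding us(1) by (rule imageI) (simp add: bounded_monoms_def)
  then show ?thesis unfolding us(3) using Span_contains_base_field[OF k us(2)] Span_base_incl[OF k us(2)] by auto
qed

lemma box_span_var: "C \<subseteq> box_span k C 1"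
proof
  fix c assume c: "c \<in> C"
  obtain us where us: "set us = monom_value ` bounded_monoms C 1" "set us \<subseteq> carrier R" "box_span k C 1 = Span k us"
    using box_span_list[OF C] by metis
  have "monom_value {#c#} \<in> set us" unfolding us(1) by (rule imageI) (use c in \<open>auto simp: bounded_monoms_def\<close>)
  then show "c \<in> box_span k C 1" 
    unfolding us(3) using Span_base_incl[OF k us(2)] monom_value_single[of c] c C by (metis subsetD)
qed

lemma box_span_one: "\<one> \<in> box_span k C E"
  using box_span_base subringE(3)[OF subfieldE(1)[OF k]] by auto

lemma box_span_pow: "a \<in> box_span k C E \<Longrightarrow> a [^] (n::nat) \<in> box_span k C (n * E)"
proof (induction n)
  case (Suc n)
  then show ?case using box_span_mult[of "a [^] n" "n * E" a E] by (simp add: add.commute)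
qed (simp add: box_span_one)

text \<open>Fractions are expressed without division: \<open>h\<close> is a denominator and
  \<open>x \<otimes> h\<close> the numerator. Since both obey the same bound \<open>E\<close>,
  inversion only exchanges them.\<close>

lemma generate_field_fraction:
  assumes "x \<in> generate_field R (k \<union> C)"
  obtains E h where "h \<in> box_span k C E" "h \<noteq> \<zero>" "x \<otimes> h \<in> box_span k C E"
proof -
  let ?P = "\<lambda>x. \<exists>E h. h \<in> box_span k C E \<and> h \<noteq> \<zero> \<and> x \<otimes> h \<in> box_span k C E"
  have kC: "k \<union> C \<subseteq> carrier R" using C subfieldE(3)[OF k] by auto
  have xc: "x \<in> carrier R" if "x \<in> generate_field R (k \<union> C)" for x
    using generate_field_in_carrier[OF kC that] .
  have "?P x" using assms
  proof (induction rule: generate_field.induct)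
    case one
    show ?case by (rule exI[of _ 0], rule exI[of _ \<one>]) (simp add: box_span_one)
  next
    case (incl h)
    then have "h \<in> box_span k C 1" using box_span_var box_span_base by auto
    moreover have "h \<in> carrier R" using incl kC by auto
    ultimately show ?case
      by (intro exI[of _ 1] exI[of _ \<one>]) (simp add: box_span_one)
  next
    case (a_inv x)
    then obtain E h where h: "h \<in> box_span k C E" "h \<noteq> \<zero>" "x \<otimes> h \<in> box_span k C E" by blast
    then have "\<ominus> x \<otimes> h = \<ominus> (x \<otimes> h)"
      using xc[OF a_inv.hyps] box_span_props(1)[of E] by (auto simp: l_minus)
    then show ?case using h box_span_props(4) by metis
  next
    case (m_inv x)
    then obtain E h where h: "h \<in> box_span k C E" "h \<noteq> \<zero>" "x \<otimes> h \<in> box_span k C E" by blast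
    have c: "x \<in> carrier R" "h \<in> carrier R" "x \<in> Units R"
      using xc[OF m_inv.hyps(1)] h box_span_props(1)[of E] m_inv.hyps by (auto simp: field_Units)
    have "inv x \<otimes> (x \<otimes> h) = h" using c by (simp add: m_assoc[symmetric])
    moreover have "x \<otimes> h \<noteq> \<zero>" using c h m_inv.hyps integral by blast
    ultimately show ?case using h by metis
  next
    case (eng_add x y)
    then obtain E h F g where h: "h \<in> box_span k C E" "h \<noteq> \<zero>" "x \<otimes> h \<in> box_span k C E"
      and g: "g \<in> box_span k C F" "g \<noteq> \<zero>" "y \<otimes> g \<in> box_span k C F" by blast
    have c: "x \<in> carrier R" "h \<in> carrier R" "y \<in> carrier R" "g \<in> carrier R"
      using eng_add.hyps xc h g box_span_props(1) by auto
    have "(x \<oplus> y) \<otimes> (h \<otimes> g) = (x \<otimes> h) \<otimes> g \<oplus> h \<otimes> (y \<otimes> g)"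
      using c by (simp add: l_distr r_distr m_ac)
    also have "\<dots> \<in> box_span k C (E + F)" using h g by (intro box_span_props(3) box_span_mult)
    finally have "(x \<oplus> y) \<otimes> (h \<otimes> g) \<in> box_span k C (E + F)" .
    moreover have "h \<otimes> g \<noteq> \<zero>" using c h g integral by blast
    ultimately show ?case using box_span_mult[OF h(1) g(1)] by blast
  next
    case (eng_mult x y)
    then obtain E h F g where h: "h \<in> box_span k C E" "h \<noteq> \<zero>" "x \<otimes> h \<in> box_span k C E"
      and g: "g \<in> box_span k C F" "g \<noteq> \<zero>" "y \<otimes> g \<in> box_span k C F" by blast
    have c: "x \<in> carrier R" "h \<in> carrier R" "y \<in> carrier R" "g \<in> carrier R"
      using eng_mult.hyps xc h g box_span_props(1) by auto
    have "(x \<otimes> y) \<otimes> (h \<otimes> g) = (x \<otimes> h) \<otimes> (y \<otimes> g)"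
      using c by (simp add: m_ac)
    also have "\<dots> \<in> box_span k C (E + F)" using h g by (intro box_span_mult)
    finally have "(x \<otimes> y) \<otimes> (h \<otimes> g) \<in> box_span k C (E + F)" .
    moreover have "h \<otimes> g \<noteq> \<zero>" using c h g integral by blast
    ultimately show ?case using box_span_mult[OF h(1) g(1)] by blast
  qed
  then show thesis using that by blast
qed

lemma common_denominator:
  assumes "finite B" "B \<subseteq> generate_field R (k \<union> C)"
  shows "\<exists>E h. h \<in> box_span k C E \<and> h \<noteq> \<zero> \<and> (\<forall>x\<in>B. x \<otimes> h \<in> box_span k C E)"
  using assms
proof (induction B)
  case empty
  show ?case by (rule exI[of _ 0], rule exI[of _ \<one>]) (simp add: box_span_one)
next
  case (insert x B)
  have kC: "k \<union> C \<subseteq> carrier R" using C subfieldE(3)[OF k] by auto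
  obtain E h where h: "h \<in> box_span k C E" "h \<noteq> \<zero>" "\<forall>x\<in>B. x \<otimes> h \<in> box_span k C E"
    using insert by auto
  obtain F g where g: "g \<in> box_span k C F" "g \<noteq> \<zero>" "x \<otimes> g \<in> box_span k C F"
    using generate_field_fraction insert.prems by (metis insert_subset)
  have c: "h \<in> carrier R" "g \<in> carrier R" "x \<in> carrier R"
    using h g box_span_props(1) insert.prems generate_field_in_carrier[OF kC] by auto
  have "y \<otimes> (h \<otimes> g) \<in> box_span k C (E + F)" if "y \<in> insert x B" for y
  proof (cases "y = x")
    case True
    then have "y \<otimes> (h \<otimes> g) = h \<otimes> (x \<otimes> g)" using c by (simp add: m_ac)
    then show ?thesis using box_span_mult[OF h(1) g(3)] by simp
  next
    case False
    then have y: "y \<in> B" using that by simp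
    then have "y \<in> carrier R" using insert.prems generate_field_in_carrier[OF kC] by auto
    then have "y \<otimes> (h \<otimes> g) = (y \<otimes> h) \<otimes> g" using c by (simp add: m_ac)
    then show ?thesis using box_span_mult[of "y \<otimes> h" E g F] h(3) y g(1) by simp
  qed
  moreover have "h \<otimes> g \<noteq> \<zero>" using c h g integral by blast
  ultimately show ?case using box_span_mult[OF h(1) g(1)] by blast
qed

text \<open>Each variable of the monomial uses up one factor \<open>h\<close>, and surplus factors
  do no harm. With one exponent \<open>n\<close> for all monomials, everything lands in a single
  box.\<close>

lemma monom_value_times_denominator:
  assumes B: "B \<subseteq> carrier R" and h: "h \<in> box_span k C E" "\<And>x. x \<in> B \<Longrightarrow> x \<otimes> h \<in> box_span k C E"
    and m: "set_mset m \<subseteq> B" "size m \<le> n"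
  shows "monom_value m \<otimes> h [^] n \<in> box_span k C (n * E)"
  using m
proof (induction m arbitrary: n)
  case empty
  have "h \<in> carrier R" using h(1) box_span_props(1) by auto
  then show ?case using box_span_pow[OF h(1)] by simp
next
  case (add x m)
  then obtain n' where n: "n = Suc n'" "size m \<le> n'" by (cases n) auto
  have hc: "h \<in> carrier R" using h(1) box_span_props(1) by auto
  have mc: "set_mset m \<subseteq> carrier R" "x \<in> carrier R" using add.prems B by auto
  have "monom_value (add_mset x m) \<otimes> h [^] n = (x \<otimes> h) \<otimes> (monom_value m \<otimes> h [^] n')"
    unfolding n(1) using hc mc by (simp add: monom_value_add_mset m_ac)
  also have "\<dots> \<in> box_span k C (E + n' * E)"
    using add n h by (intro box_span_mult) auto
  finally show ?case by (simp add: n(1))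
qed

text \<open>Growth comparison: there are (D+1)^|B| monomials in \<open>B\<close> with exponents at
  most \<open>D\<close>, and after clearing denominators they lie in a space of dimension at most
  (nE+1)^|C| with n linear in \<open>D\<close>. For |B| > |C| this is impossible once
  \<open>D\<close> is large.\<close>

theorem alg_independent_card_le:
  assumes B: "finite B" "B \<subseteq> generate_field R (k \<union> C)" "alg_independent k B"
  shows "card B \<le> card C"
proof (rule ccontr)
  assume "\<not> card B \<le> card C"
  then have MN: "card C + 1 \<le> card B" by simp
  have Bc: "B \<subseteq> carrier R" using B(3) by (simp add: alg_independent_def)
  obtain E h where h: "h \<in> box_span k C E" "h \<noteq> \<zero>" "\<And>x. x \<in> B \<Longrightarrow> x \<otimes> h \<in> box_span k C E"
    using common_denominator[OF B(1,2)] by blast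
  have hc: "h \<in> carrier R" using h(1) box_span_props(1) by auto
  define M where "M = card B"
  \<comment> \<open>\<open>D\<close> is chosen to absorb the constant: n E + 1 \<le> (E M + 1)(D +
    1), and the |C|-th power of the right side is D (D+1)^|C|, which is less than (D+1)^(|C|+1). The
    \<open>n\<close> of the next line is the largest total degree.\<close>
  define D where "D = (E * M + 1) ^ card C"
  define n where "n = M * D"
  obtain ms where ms: "set ms = bounded_monoms B D" "distinct ms"
    using finite_distinct_list[OF bounded_monoms_finite_card(1)[OF B(1)]] by metis
  have lms: "length ms = (D + 1) ^ M"
    using ms bounded_monoms_finite_card(2)[OF B(1), of D] distinct_card[of ms] by (simp add: M_def)
  have msB: "set_mset m \<subseteq> B" if "m \<in> set ms" for m using that ms(1) by (auto simp: bounded_monoms_def)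
  have ind: "independent k (map monom_value ms)"
    using alg_independent_imp_independent[OF k B(3) ms(2) msB] by blast
  define g where "g = h [^] n"
  have g: "g \<in> carrier R" "g \<noteq> \<zero>" using hc h(2) nat_pow_zero_iff[OF hc] by (auto simp: g_def)
  have ind': "independent k (map (\<lambda>m. monom_value m \<otimes> g) ms)"
  proof (rule trivial_combine_imp_independent[OF k])
    show "set (map (\<lambda>m. monom_value m \<otimes> g) ms) \<subseteq> carrier R" using msB Bc g by fastforce
    fix Ks assume Ks: "set Ks \<subseteq> k" "combine Ks (map (\<lambda>m. monom_value m \<otimes> g) ms) = \<zero>"
    have mc: "set_mset m \<subseteq> carrier R" if "m \<in> set ms" for m using msB[OF that] Bc by auto
    have "combine Ks (map (\<lambda>m. monom_value m \<otimes> g) ms) = combine Ks (map monom_value ms) \<otimes> g"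
      using mc \<open>set Ks \<subseteq> k\<close>
    proof (induction ms arbitrary: Ks)
      case Nil
      then show ?case using g by simp
    next
      case (Cons m ms)
      show ?case
      proof (cases Ks)
        case Nil
        then show ?thesis using g by simp
      next
        case (Cons c Ks')
        have cc: "c \<in> carrier R" "set Ks' \<subseteq> carrier R" "set_mset m \<subseteq> carrier R"
          using Cons Cons.prems subfieldE(3)[OF k] by auto
        have "set (map monom_value ms) \<subseteq> carrier R" using Cons.prems(1) by auto
        then have "combine Ks' (map monom_value ms) \<in> carrier R" using cc by blast
        then show ?thesis using Cons Cons.IH[of Ks'] Cons.prems cc g by (simp add: l_distr m_assoc)
      qed
    qed
    then have "combine Ks (map monom_value ms) \<otimes> g = \<zero>" using Ks(2) by simp
    moreover have "combine Ks (map monom_value ms) \<in> carrier R"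
      using Ks(1) subfieldE(3)[OF k] mc by (intro combine_in_carrier) auto
    ultimately have "combine Ks (map monom_value ms) = \<zero>" using g integral by blast
    then show "set (take (length (map (\<lambda>m. monom_value m \<otimes> g) ms)) Ks) \<subseteq> {\<zero>}"
      using independent_imp_trivial_combine[OF k ind Ks(1)] by simp
  qed
  obtain us where us: "length us = (n * E + 1) ^ card C" "set us \<subseteq> carrier R" "box_span k C (n * E) = Span k us"
    using box_span_list[OF C] by metis
  have sub: "set (map (\<lambda>m. monom_value m \<otimes> g) ms) \<subseteq> Span k us"
  proof
    fix y assume "y \<in> set (map (\<lambda>m. monom_value m \<otimes> g) ms)"
    then obtain m where m: "m \<in> set ms" "y = monom_value m \<otimes> g" by auto
    have "size m \<le> n" using size_bounded_monoms[OF B(1)] m(1) ms(1) by (auto simp: n_def M_def)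
    then show "y \<in> Span k us"
      using monom_value_times_denominator[OF Bc h(1,3) msB[OF m(1)], of n] m(2) us(3) by (simp add: g_def)
  qed
  obtain d where d: "d \<le> length us" "dimension d k (Span k us)"
    using Span_dimension_le[OF k us(2)] by blast
  have "length (map (\<lambda>m. monom_value m \<otimes> g) ms) \<le> d"
    by (rule independent_length_le_dimension[OF k d(2) ind' sub])
  then have le: "(D + 1) ^ M \<le> (n * E + 1) ^ card C" using d(1) us(1) lms by simp
  have "n * E + 1 \<le> (E * M + 1) * (D + 1)" by (simp add: n_def algebra_simps)
  then have "(n * E + 1) ^ card C \<le> ((E * M + 1) * (D + 1)) ^ card C" by (rule power_mono) simp
  also have "\<dots> = D * (D + 1) ^ card C" by (simp only: power_mult_distrib D_def[symmetric])
  also have "\<dots> < (D + 1) * (D + 1) ^ card C" by simp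
  also have "\<dots> = (D + 1) ^ (card C + 1)" by simp
  also have "\<dots> \<le> (D + 1) ^ M" using MN by (intro power_increasing) (auto simp: M_def)
  finally show False using le by simp
qed

lemma trdeg_generate_field_le: "trdeg k (generate_field R (k \<union> C)) \<le> enat (card C)"
  unfolding trdeg_def by (rule SUP_least) (auto intro: alg_independent_card_le)

end

end

subsection \<open>Descent of field extensions and p-independence\<close>

text \<open>Used in the polynomial ring with \<open>q\<close> the polynomial X - x, to see that
  every factor of (X - x)^p is a power of X - x up to a unit.\<close>

lemma (in domain) divisor_of_prime_power:
  assumes q: "q \<in> carrier R" "ring_prime q"
    and "a \<in> carrier R" "b \<in> carrier R" "a \<otimes> b = q [^] (n::nat)"
  shows "\<exists>u\<in>Units R. \<exists>j\<le>n. a = u \<otimes> q [^] j"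
  using assms(3-5)
proof (induction n arbitrary: a b)
  case 0
  then have "a \<in> Units R" unfolding Units_def using m_comm[of a b] by auto
  then show ?case by (intro bexI[of _ a] exI[of _ 0]) (use 0 in auto)
next
  case (Suc n)
  have q0: "q \<noteq> \<zero>" using q(2) by (simp add: ring_prime_def)
  have "q divides a \<otimes> b" unfolding Suc.prems(3) using q(1)
    by (intro dividesI[of "q [^] n"]) (auto simp: m_comm)
  then have "q divides a \<or> q divides b"
    using q(2) Suc.prems by (auto simp: ring_prime_def prime_def)
  then show ?case
  proof
    assume "q divides a"
    then obtain a' where a': "a' \<in> carrier R" "a = q \<otimes> a'" by auto
    have "q \<otimes> (a' \<otimes> b) = q \<otimes> q [^] n"
      using Suc.prems a' q(1) by (simp add: m_ac)
    then have "a' \<otimes> b = q [^] n" using m_lcancel[OF q0 q(1)] a' Suc.prems(2) q(1) by auto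
    then obtain u j where u: "u \<in> Units R" "j \<le> n" "a' = u \<otimes> q [^] j"
      using Suc.IH[OF a'(1) Suc.prems(2)] by blast
    have "a = u \<otimes> q [^] Suc j" unfolding a'(2) u(3) using u(1) q(1) by (simp add: m_ac Units_closed)
    then show ?thesis using u by (intro bexI[of _ u] exI[of _ "Suc j"]) auto
  next
    assume "q divides b"
    then obtain b' where b': "b' \<in> carrier R" "b = q \<otimes> b'" by auto
    have "q \<otimes> (a \<otimes> b') = q \<otimes> q [^] n"
      using Suc.prems b' q(1) by (simp add: m_ac)
    then have "a \<otimes> b' = q [^] n" using m_lcancel[OF q0 q(1)] b' Suc.prems(1) q(1) by auto
    then show ?thesis using Suc.IH[OF Suc.prems(1) b'(1)] le_SucI by blast
  qed
qed

section \<open>Fields spanned by lists and their descent to smaller base fields\<close>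

context field
begin

text \<open>A relation for \<open>b [^] D\<close> makes the span of the lower powers stable under
  multiplication by \<open>b\<close>. \<open>D\<close> may differ from the degree of
  \<open>b\<close> over \<open>E\<close>: after descent to a smaller field only the relation is at
  hand.\<close>

lemma exp_base_Span_subfield:
  assumes E: "subfield E R" and b: "b \<in> carrier R" and D: "D \<ge> 1"
    and bD: "b [^] D \<in> Span E (exp_base b D)"
  shows "subfield (Span E (exp_base b D)) R" "b \<in> Span E (exp_base b D)" "E \<subseteq> Span E (exp_base b D)"
proof -
  note c = exp_base_closed[OF b, of D]
  have mem: "b [^] j \<in> Span E (exp_base b D)" if "j < D" for j
    using Span_base_incl[OF E c] that by (auto simp: exp_base_def)
  have step: "b \<otimes> y \<in> Span E (exp_base b D)" if "y \<in> Span E (exp_base b D)" for y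
  proof (rule Span_mult_closed[OF E _ c c _ _ that])
    show "set [b] \<subseteq> carrier R" "b \<in> Span E [b]" using b Span_base_incl[OF E, of "[b]"] by auto
    fix u v assume "u \<in> set [b]" "v \<in> set (exp_base b D)"
    then obtain j where j: "u = b" "v = b [^] j" "j < D" by (auto simp: exp_base_def)
    have "u \<otimes> v = b [^] Suc j" using j b nat_pow_Suc2 by simp
    then show "u \<otimes> v \<in> Span E (exp_base b D)"
      using mem[of "Suc j"] bD j by (cases "Suc j = D") auto
  qed
  have pow: "b [^] (j::nat) \<in> Span E (exp_base b D)" for j
  proof (induction j)
    case 0
    then show ?case using mem[of 0] D by simp
  next
    case (Suc j)
    then show ?case using step[OF Suc] b nat_pow_Suc2[OF b, of j] by simp
  qed
  show "subfield (Span E (exp_base b D)) R"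
  proof (rule Span_is_subfield[OF E c])
    show "\<one> \<in> Span E (exp_base b D)" using pow[of 0] by simp
    fix u v assume "u \<in> set (exp_base b D)" "v \<in> set (exp_base b D)"
    then obtain i j where "u = b [^] (i::nat)" "v = b [^] (j::nat)" by (auto simp: exp_base_def)
    then show "u \<otimes> v \<in> Span E (exp_base b D)" using pow[of "i + j"] b by (simp add: nat_pow_mult)
  qed
  show "b \<in> Span E (exp_base b D)" using pow[of 1] b by simp
  show "E \<subseteq> Span E (exp_base b D)" using Span_contains_base_field[OF E c] pow[of 0] by simp
qed

lemma simple_extension_eq_generate_field:
  assumes E: "subfield E R" and b: "b \<in> carrier R" "(algebraic over E) b"
  shows "simple_extension E b = generate_field R (insert b E)"
proof
  have c: "insert b E \<subseteq> carrier R" using b subfieldE(3)[OF E] by auto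
  have g: "subfield (generate_field R (insert b E)) R" using generate_field_is_subfield[OF c] .
  show "simple_extension E b \<subseteq> generate_field R (insert b E)"
    by (rule simple_extension_subring_incl[OF subfieldE(1)[OF g]]) (auto intro: generate_field.incl)
  show "generate_field R (insert b E) \<subseteq> simple_extension E b"
  proof (rule generate_field_min_subfield1[OF c])
    show "subfield (simple_extension E b) R" using simple_extension_is_subfield[OF E b(1)] b(2) by simp
    show "insert b E \<subseteq> simple_extension E b"
      using simple_extension_incl[OF subfieldE(3)[OF E] b(1)] simple_extension_mem[OF subfieldE(1)[OF E] b(1)] by auto
  qed
qed

lemma generate_field_generate_field:
  assumes "A \<subseteq> carrier R" "B \<subseteq> carrier R"
  shows "generate_field R (generate_field R A \<union> B) = generate_field R (A \<union> B)"
proof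
  have g: "generate_field R A \<subseteq> carrier R" using generate_field_incl[OF assms(1)] .
  show "generate_field R (generate_field R A \<union> B) \<subseteq> generate_field R (A \<union> B)"
    using mono_generate_field[of A "A \<union> B"] assms g
    by (intro generate_field_min_subfield1 generate_field_is_subfield) (auto intro: generate_field.incl)
  show "generate_field R (A \<union> B) \<subseteq> generate_field R (generate_field R A \<union> B)"
    using assms g by (intro generate_field_min_subfield1 generate_field_is_subfield) (auto intro: generate_field.incl)
qed

lemma generate_field_insert:
  assumes K: "K \<subseteq> carrier R" and bs: "set bs \<subseteq> carrier R" and b: "b \<in> carrier R"
    and "E = generate_field R (K \<union> set bs)"
  shows "generate_field R (K \<union> set (b # bs)) = generate_field R (insert b E)"
  using generate_field_generate_field[of "K \<union> set bs" "{b}"] assms by (simp add: insert_commute Un_commute)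

lemma generate_field_self:
  assumes "subfield K R" shows "generate_field R K = K"
  using generate_fieldI[OF subfieldE(3)[OF assms] assms] by auto

text \<open>An equality of spans instead of a statement about bases, because the same list of
  products has to serve over \<open>K\<close> and over every smaller field \<open>K0\<close>, where
  only the spans are under control.\<close>

lemma Span_Span_exp_base:
  assumes F: "subfield F R" and c: "set Bs \<subseteq> carrier R" and b: "b \<in> carrier R"
    and E: "subfield (Span F Bs) R"
  shows "Span F (concat (map (\<lambda>j. map (\<lambda>c. c \<otimes> b [^] j) Bs) [0..<D])) = Span (Span F Bs) (exp_base b D)"
    (is "Span F ?B' = Span ?E _")
proof
  note ce = exp_base_closed[OF b, of D]
  have c': "set ?B' \<subseteq> carrier R" using c b by auto
  have FE: "F \<subseteq> ?E" using Span_contains_base_field[OF F c] subringE(3)[OF subfieldE(1)[OF E]] by auto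
  show "Span F ?B' \<subseteq> Span ?E (exp_base b D)"
  proof (rule subalgebra_Span_incl[OF F])
    show "subalgebra F (Span ?E (exp_base b D)) R"
      using Span_is_add_subgroup[OF E ce] Span_smult_closed[OF E ce] FE
      by (auto simp: subalgebra_def subalgebra_axioms_def)
    show "set ?B' \<subseteq> Span ?E (exp_base b D)"
      using Span_smult_closed[OF E ce] Span_base_incl[OF E ce] Span_base_incl[OF F c]
      by (auto simp: exp_base_def)
  qed
  have prod: "a \<otimes> u \<in> Span F ?B'" if a: "a \<in> ?E" and u: "u \<in> set (exp_base b D)" for a u
  proof (rule Span_mult_closed[OF F c _ c' _ a])
    obtain j where j: "u = b [^] j" "j < D" using u by (auto simp: exp_base_def)
    show "set [u] \<subseteq> carrier R" "u \<in> Span F [u]" using j b Span_base_incl[OF F, of "[u]"] by auto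
    fix v w assume "v \<in> set Bs" "w \<in> set [u]"
    then have "v \<otimes> w \<in> set ?B'" using j by auto
    then show "v \<otimes> w \<in> Span F ?B'" using Span_base_incl[OF F c'] by auto
  qed
  have "Span ?E us \<subseteq> Span F ?B'" if "set us \<subseteq> set (exp_base b D)" for us
    using that
  proof (induction us)
    case Nil
    then show ?case using Span_subgroup_props(2)[OF F c'] by auto
  next
    case (Cons u us)
    show ?case
    proof
      fix y assume "y \<in> Span ?E (u # us)"
      then obtain a v where "a \<in> ?E" "v \<in> Span ?E us" "y = a \<otimes> u \<oplus> v"
        by (auto simp: line_extension_mem_iff)
      then show "y \<in> Span F ?B'"
        using Cons prod Span_subgroup_props(3)[OF F c'] by auto
    qed
  qed
  then show "Span ?E (exp_base b D) \<subseteq> Span F ?B'" by simp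
qed

text \<open>
  The minimal polynomial of the last generator \<open>b\<close> over the field \<open>E\<close> generated by the others has
  \<open>D = [E(b):E]\<close> coefficients in \<open>E\<close>, each of which has \<open>[E:K]\<close> coordinates: altogether at most
  \<open>[E(b):K]\<close> elements of \<open>K\<close> for each generator.
\<close>

theorem finitely_generated_field_descent:
  assumes K: "subfield K R" and fin: "finite_dimension K (carrier R)"
    and "set bs \<subseteq> carrier R"
  shows "\<exists>C Bs. finite C \<and> C \<subseteq> K \<and> card C \<le> length bs * length Bs \<and> set Bs \<subseteq> carrier R \<and>
    Span K Bs = generate_field R (K \<union> set bs) \<and> dimension (length Bs) K (Span K Bs) \<and>
    (\<forall>K0. subfield K0 R \<and> C \<subseteq> K0 \<and> K0 \<subseteq> K \<longrightarrow>
       subfield (Span K0 Bs) R \<and> K0 \<subseteq> Span K0 Bs \<and> set bs \<subseteq> Span K0 Bs)"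
  using assms(3)
proof (induction bs)
  case Nil
  have S: "Span F [\<one>] = F" if F: "subfield F R" for F
    using subfieldE(3)[OF F] subringE[OF subfieldE(1)[OF F]] by (force simp: line_extension_mem_iff)
  show ?case
    by (rule exI[of _ "{}"], rule exI[of _ "[\<one>]"]) (use S K dimension_one[OF K] generate_field_self[OF K] in auto)
next
  case (Cons b bs)
  have b: "b \<in> carrier R" and bs: "set bs \<subseteq> carrier R" using Cons.prems by auto
  obtain C Bs where IH: "finite C" "C \<subseteq> K" "card C \<le> length bs * length Bs" "set Bs \<subseteq> carrier R"
    "Span K Bs = generate_field R (K \<union> set bs)" "dimension (length Bs) K (Span K Bs)"
    and IH7: "\<forall>K0. subfield K0 R \<and> C \<subseteq> K0 \<and> K0 \<subseteq> K \<longrightarrow>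
       subfield (Span K0 Bs) R \<and> K0 \<subseteq> Span K0 Bs \<and> set bs \<subseteq> Span K0 Bs"
    using Cons.IH[OF bs] by (elim exE conjE) (rule that; assumption)
  note desc_bs = IH7[rule_format, OF conjI, OF _ conjI]
  define E where "E = Span K Bs"
  have E: "subfield E R" and KE: "K \<subseteq> E" and EC: "E = generate_field R (K \<union> set bs)"
    using desc_bs[OF K IH(2)] IH(5) by (auto simp: E_def)
  have algE: "(algebraic over E) b"
    using algebraic_mono[OF KE] finite_dimension_imp_algebraic[OF K carrier_is_subring fin b] by simp
  define D where "D = degree (Irr E b)"
  have D1: "D \<ge> 1" unfolding D_def by (rule pirreducible_degree[OF E IrrE(1,2)[OF E b algE]])
  have dimD: "dimension D E (simple_extension E b)" unfolding D_def by (rule dimension_simple_extension[OF E b algE])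
  have SE: "Span E (exp_base b D) = simple_extension E b" unfolding D_def by (rule Span_exp_base[OF E b algE])
  have "b \<in> simple_extension E b" using simple_extension_mem[OF subfieldE(1)[OF E] b] .
  then have "b [^] D \<in> simple_extension E b"
    by (rule subring_nat_pow_closed[OF simple_extension_is_subring[OF subfieldE(1)[OF E] b]])
  then have "b [^] D \<in> Span E (exp_base b D)" using SE by simp
  \<comment> \<open>The coefficients \<open>Es\<close> of this relation, expanded over
    \<open>Bs\<close> by \<open>cf\<close> below, supply the only new elements of \<open>K\<close>
    that the smaller field has to contain.\<close>
  then obtain Es where Es: "set Es \<subseteq> E" "length Es = D" "b [^] D = combine Es (exp_base b D)"
    using Span_mem_iff_length_version[OF E exp_base_closed[OF b, of D]] by (auto simp: exp_base_def)
  have "\<exists>Ks. set Ks \<subseteq> K \<and> length Ks = length Bs \<and> e = combine Ks Bs" if "e \<in> set Es" for e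
    using Span_mem_iff_length_version[OF K IH(4), of e] that Es(1) by (auto simp: E_def)
  then obtain cf where cf: "\<And>e. e \<in> set Es \<Longrightarrow> set (cf e) \<subseteq> K \<and> length (cf e) = length Bs \<and> e = combine (cf e) Bs"
    by metis
  define C' where "C' = C \<union> (\<Union>e\<in>set Es. set (cf e))"
  define Bs' where "Bs' = concat (map (\<lambda>j. map (\<lambda>c. c \<otimes> b [^] j) Bs) [0..<D])"
  have Bs'c: "set Bs' \<subseteq> carrier R" using IH(4) b by (auto simp: Bs'_def)
  have len: "length Bs' = length Bs * D"
    by (simp add: Bs'_def length_concat comp_def sum_list_triv)
  have "card (\<Union>e\<in>set Es. set (cf e)) \<le> (\<Sum>e\<in>set Es. card (set (cf e)))" by (rule card_UN_le) simp
  also have "\<dots> \<le> (\<Sum>e\<in>set Es. length Bs)" by (rule sum_mono) (metis cf card_length)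
  also have "\<dots> \<le> D * length Bs" using card_length[of Es] Es(2) by simp
  finally have "card C' \<le> length bs * length Bs + D * length Bs"
    unfolding C'_def using IH(3) card_Un_le[of C "\<Union>e\<in>set Es. set (cf e)"] by linarith
  \<comment> \<open>\<open>Bs'\<close> is \<open>D\<close> times as long as \<open>Bs\<close>. The
    old bound may be enlarged by the factor \<open>D\<close>, and the new coordinates contribute one
    further copy of \<open>length Bs'\<close>.\<close>
  also have "length bs * length Bs \<le> length bs * (D * length Bs)" using D1 by simp
  finally have cardC': "card C' \<le> length (b # bs) * length Bs'" unfolding len by (simp add: mult.commute)
  have desc: "subfield (Span K0 Bs') R \<and> K0 \<subseteq> Span K0 Bs' \<and> set (b # bs) \<subseteq> Span K0 Bs'"
    if K0: "subfield K0 R" "C' \<subseteq> K0" "K0 \<subseteq> K" for K0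
  proof -
    define E0 where "E0 = Span K0 Bs"
    have E0: "subfield E0 R" "K0 \<subseteq> E0" "set bs \<subseteq> E0" using desc_bs[OF K0(1) _ K0(3)] K0(2) by (auto simp: E0_def C'_def)
    \<comment> \<open>The coordinates of the coefficients were put into \<open>C'\<close>, so the
      relation for \<open>b [^] D\<close> already holds over \<open>E0\<close>.\<close>
    have "set Es \<subseteq> E0"
    proof
      fix e assume e: "e \<in> set Es"
      then have "set (cf e) \<subseteq> K0" using K0(2) by (auto simp: C'_def)
      then show "e \<in> E0" unfolding E0_def using cf[OF e] Span_eq_combine_set[OF K0(1) IH(4)] by auto
    qed
    then have "b [^] D \<in> Span E0 (exp_base b D)"
      unfolding Es(3) using Span_eq_combine_set[OF E0(1) exp_base_closed[OF b]] by auto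
    note e = exp_base_Span_subfield[OF E0(1) b D1 this]
    have "Span K0 Bs' = Span E0 (exp_base b D)"
      unfolding Bs'_def E0_def by (rule Span_Span_exp_base[OF K0(1) IH(4) b]) (use E0 in \<open>simp add: E0_def\<close>)
    then show ?thesis using e E0 by auto
  qed
  have "Span K Bs' = Span E (exp_base b D)"
    unfolding Bs'_def E_def by (rule Span_Span_exp_base[OF K IH(4) b]) (use E in \<open>simp add: E_def\<close>)
  then have SB: "Span K Bs' = simple_extension E b" using SE by simp
  also have "\<dots> = generate_field R (K \<union> set (b # bs))"
    using simple_extension_eq_generate_field[OF E b algE] generate_field_insert[OF subfieldE(3)[OF K] bs b EC] by simp
  finally have gen: "Span K Bs' = generate_field R (K \<union> set (b # bs))" .
  have "dimension (length Bs') K (Span K Bs')"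
    unfolding SB len using telescopic_base[OF K E _ dimD] IH(6) by (simp add: E_def)
  moreover have "finite C'" "C' \<subseteq> K" using IH(1,2) cf by (auto simp: C'_def)
  ultimately show ?case using cardC' Bs'c gen desc by (intro exI[of _ C'] exI[of _ Bs']) (simp del: set_simps)
qed

end

section \<open>Extensions by p-th roots and p-bases\<close>

context field_prime_char
begin

lemma poly_ring_char: "[p] \<cdot>\<^bsub>poly_ring R\<^esub> \<one>\<^bsub>poly_ring R\<^esub> = \<zero>\<^bsub>poly_ring R\<^esub>"
proof -
  interpret UP: domain "poly_ring R" using univ_poly_is_domain[OF carrier_is_subring] .
  interpret H: ring_hom_ring R "poly_ring R" poly_of_const
    using canonical_embedding_ring_hom[OF carrier_is_subring] by simp
  have "poly_of_const ([n] \<cdot> \<one>) = [n] \<cdot>\<^bsub>poly_ring R\<^esub> \<one>\<^bsub>poly_ring R\<^esub>" for n :: nat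
    by (induction n) auto
  from this[of p] show ?thesis unfolding p_one by simp
qed

lemma linear_power:
  assumes x: "x \<in> carrier R" "x \<noteq> \<zero>"
  shows "[\<one>, \<ominus> x] [^]\<^bsub>poly_ring R\<^esub> p = monom \<one> p \<oplus>\<^bsub>poly_ring R\<^esub> [(\<ominus> x) [^] p]"
proof -
  interpret UP: domain "poly_ring R" using univ_poly_is_domain[OF carrier_is_subring] .
  have nx: "\<ominus> x \<in> carrier R" "\<ominus> x \<noteq> \<zero>" using x by (auto simp: add.inv_eq_1_iff)
  have c: "[\<ominus> x] \<in> carrier (poly_ring R)" "X \<in> carrier (poly_ring R)"
    using nx var_closed[OF carrier_is_subring] by (auto simp: univ_poly_def polynomial_def)
  have "[\<one>, \<ominus> x] = X \<oplus>\<^bsub>poly_ring R\<^esub> [\<ominus> x]"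
    using x by (simp add: univ_poly_add var_def)
  then have "[\<one>, \<ominus> x] [^]\<^bsub>poly_ring R\<^esub> p = X [^]\<^bsub>poly_ring R\<^esub> p \<oplus>\<^bsub>poly_ring R\<^esub> [\<ominus> x] [^]\<^bsub>poly_ring R\<^esub> p"
    using UP.frobenius_add[OF p_prime poly_ring_char c(2,1)] by simp
  moreover have "[\<ominus> x] [^]\<^bsub>poly_ring R\<^esub> n = [(\<ominus> x) [^] n]" for n :: nat
    using nx nat_pow_zero_iff[OF nx(1)] integral_iff
    by (induction n) (auto simp: univ_poly_one univ_poly_mult)
  ultimately show ?thesis using unitary_monom_eq_var_pow[OF carrier_is_subring, of p] by simp
qed

text \<open>The minimal polynomial divides X^p - x^p = (X - x)^p, so over the ambient field it is (X
  - x)^j. Its constant term (-x)^j lies in \<open>F\<close>; for 0 < j < p the exponents j and p are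
  coprime, and \<open>x\<close> itself would lie in \<open>F\<close>.\<close>

lemma degree_Irr_p_th_root:
  assumes F: "subfield F R" and x: "x \<in> carrier R" "x \<notin> F" and xp: "x [^] p \<in> F"
  shows "(algebraic over F) x" "degree (Irr F x) = p"
proof -
  interpret UP: domain "poly_ring R" using univ_poly_is_domain[OF carrier_is_subring] .
  note Fr = subfieldE(1)[OF F] and Fs = subringE[OF subfieldE(1)[OF F]]
  have x0: "x \<noteq> \<zero>" using x Fs(2) by auto
  define z where "z = \<ominus> x"
  have z: "z \<in> carrier R" "z \<noteq> \<zero>" using x x0 by (auto simp: z_def add.inv_eq_1_iff)
  have zp: "z [^] p = \<ominus> (x [^] p)" using frob_minus[OF x(1), of 1] by (simp add: z_def)
  have zpF: "z [^] p \<in> F" unfolding zp using xp Fs by auto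
  have zpow0: "z [^] n \<noteq> \<zero>" for n :: nat using nat_pow_zero_iff[OF z(1)] z(2) by auto
  define Q where "Q = poly_add (monom \<one> p) [z [^] p]"
  have mon: "polynomial F (monom \<one> p)" using monom_is_polynomial[OF Fr] Fs(3) by auto
  have const: "polynomial F [z [^] p]" using zpF zpow0 by (auto simp: polynomial_def)
  have QF: "Q \<in> carrier (F[X])" unfolding Q_def
    using poly_add_closed[OF Fr mon const] univ_poly_carrier by blast
  have "length Q = Suc p" unfolding Q_def
    using poly_add_length_eq[OF Fr mon const] p_pos by (auto simp: monom_def)
  then have Qdeg: "degree Q = p" "Q \<noteq> []" by auto
  have Qx: "eval Q x = \<zero>"
  proof -
    have "eval Q x = eval (monom \<one> p) x \<oplus> eval [z [^] p] x"
      unfolding Q_def using x z by (intro eval_poly_add monom_in_carrier) auto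
    then show ?thesis using x z by (simp add: eval_monom zp r_neg)
  qed
  show alg: "(algebraic over F) x" using algebraicI[OF QF Qdeg(2) Qx] .
  define P where "P = Irr F x"
  note PI = IrrE[OF F x(1) alg, folded P_def]
  have PC: "P \<in> carrier (poly_ring R)" using carrier_polynomial_shell[OF Fr PI(1)] .
  have "P pdivides Q" unfolding P_def by (rule Irr_minimal[OF F x(1) alg QF Qx])
  then obtain G where G: "G \<in> carrier (poly_ring R)" "Q = P \<otimes>\<^bsub>poly_ring R\<^esub> G"
    unfolding pdivides_def by auto
  let ?q = "[\<one>, z]"
  have q: "?q \<in> carrier (poly_ring R)" using z by (auto simp: univ_poly_def polynomial_def)
  have Qq: "Q = ?q [^]\<^bsub>poly_ring R\<^esub> p"
    using linear_power[OF x(1) x0] by (simp add: Q_def z_def univ_poly_add)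
  have "ring_prime\<^bsub>poly_ring R\<^esub> ?q"
    using pprime_iff_pirreducible[OF carrier_is_subfield q] degree_one_imp_pirreducible[OF carrier_is_subfield q] by simp
  then obtain u j where u: "u \<in> Units (poly_ring R)" "j \<le> p" "P = u \<otimes>\<^bsub>poly_ring R\<^esub> ?q [^]\<^bsub>poly_ring R\<^esub> j"
    using UP.divisor_of_prime_power[OF q _ PC G(1)] G(2) Qq by metis
  obtain c where c: "u = [c]" "c \<in> carrier R" "c \<noteq> \<zero>" using u(1) univ_poly_carrier_units by auto
  have qj: "?q [^]\<^bsub>poly_ring R\<^esub> n \<in> carrier (poly_ring R) \<and> ?q [^]\<^bsub>poly_ring R\<^esub> n \<noteq> [] \<and>
     lead_coeff (?q [^]\<^bsub>poly_ring R\<^esub> n) = \<one> \<and> degree (?q [^]\<^bsub>poly_ring R\<^esub> n) = n" for n :: nat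
  proof (induction n)
    case 0
    then show ?case by (simp add: univ_poly_one) (simp add: univ_poly_def polynomial_def)
  next
    case (Suc n)
    let ?a = "?q [^]\<^bsub>poly_ring R\<^esub> n"
    have pa: "polynomial (carrier R) ?a" "polynomial (carrier R) ?q" using Suc q univ_poly_carrier by blast+
    have n0: "?a \<noteq> []" "?q \<noteq> []" using Suc by auto
    have "lead_coeff (poly_mult ?a ?q) = \<one>"
      using poly_mult_lead_coeff[OF carrier_is_subring pa n0] Suc by simp
    moreover have dg: "degree (poly_mult ?a ?q) = Suc n"
    proof -
      have "length ?a = Suc n" using Suc n0 by (metis Suc_diff_1 length_greater_0_conv)
      then show ?thesis using poly_mult_degree_eq[OF carrier_is_subring pa] n0 by simp
    qed
    moreover have "poly_mult ?a ?q \<noteq> []" using dg by auto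
    moreover have "poly_mult ?a ?q \<in> carrier (poly_ring R)"
      using poly_mult_closed[OF carrier_is_subring pa] univ_poly_carrier by blast
    ultimately show ?case by (simp add: univ_poly_mult)
  qed
  let ?qj = "?q [^]\<^bsub>poly_ring R\<^esub> j"
  have pu: "polynomial (carrier R) u" using c by (simp add: polynomial_def)
  have pqj: "polynomial (carrier R) ?qj" using qj univ_poly_carrier by blast
  have "lead_coeff P = c"
    using poly_mult_lead_coeff[OF carrier_is_subring pu pqj] qj[of j] c u(3) by (simp add: univ_poly_mult)
  then have "c = \<one>" using PI(3) by simp
  then have Pq: "P = ?qj" using u(3) c(1) qj[of j] UP.l_one[of ?qj] by (simp add: univ_poly_one)
  then have degP: "degree P = j" using qj[of j] by simp
  have j1: "j \<ge> 1" using pirreducible_degree[OF F PI(1,2)] degP by simp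
  show "degree (Irr F x) = p"
  proof (rule ccontr)
    assume "degree (Irr F x) \<noteq> p"
    then have "j < p" using degP u(2) by (auto simp: P_def)
    \<comment> \<open>Evaluation at zero extracts the constant coefficient without expanding the
      power.\<close>
    interpret H: ring_hom_ring "poly_ring R" R "\<lambda>f. eval f \<zero>" using eval_ring_hom[OF carrier_is_subring zero_closed] .
    have "eval P \<zero> = (eval ?q \<zero>) [^] j" unfolding Pq using H.hom_nat_pow[OF q] by simp
    then have ev: "eval P \<zero> = z [^] j" using z by simp
    have "ring.eval (R\<lparr>carrier := F\<rparr>) P \<zero> \<in> carrier (R\<lparr>carrier := F\<rparr>)"
    proof (rule ring.eval_in_carrier[OF subring_is_ring[OF Fr]])
      have "polynomial F P" using PI(1) univ_poly_carrier by blast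
      then show "set P \<subseteq> carrier (R\<lparr>carrier := F\<rparr>)" using polynomial_incl by simp
    qed (use Fs in auto)
    then have zj: "z [^] j \<in> F" using ev by (simp add: eval_consistent[OF Fr])
    have "\<not> p dvd j" using \<open>j < p\<close> j1 by (auto dest: dvd_imp_le)
    then have cop: "coprime j p" using p_prime prime_imp_coprime coprime_commute by blast
    obtain s t where st: "j * s = p * t + 1"
      using bezout_nat[of j p] j1 cop by (metis coprime_imp_gcd_eq_1 not_one_le_zero)
    have "z [^] (p * t) \<otimes> z = z [^] (j * s)" unfolding st by simp
    also have "\<dots> \<in> F" using subring_nat_pow_closed[OF Fr zj, of s] z by (simp add: nat_pow_pow)
    finally have "z [^] (p * t) \<otimes> z \<in> F" .
    moreover have "z [^] (p * t) \<in> F - {\<zero>}"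
      using subring_nat_pow_closed[OF Fr zpF, of t] z zpow0 by (simp add: nat_pow_pow)
    ultimately have "z \<in> F" using subfield_m_inv_simprule[OF F _ z(1)] by blast
    then have "x \<in> F" using Fs(5)[of z] x by (simp add: z_def)
    then show False using x by simp
  qed
qed

lemma dimension_p_th_root:
  assumes F: "subfield F R" and x: "x \<in> carrier R" "x \<notin> F" and xp: "x [^] p \<in> F"
  shows "dimension p F (generate_field R (insert x F))"
  using dimension_simple_extension[OF F x(1) degree_Irr_p_th_root(1)[OF assms]]
    simple_extension_eq_generate_field[OF F x(1) degree_Irr_p_th_root(1)[OF assms]] degree_Irr_p_th_root(2)[OF assms]
  by simp

lemma Span_mono_field:
  assumes "subfield K R" "subfield F R" "K \<subseteq> F" "set Us \<subseteq> carrier R"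
  shows "Span K Us \<subseteq> Span F Us"
  unfolding Span_eq_combine_set[OF assms(1,4)] Span_eq_combine_set[OF assms(2,4)] using assms(3) by blast

lemma finite_dimension_superfield:
  assumes "subfield K R" "subfield F R" "K \<subseteq> F" "finite_dimension K (carrier R)"
  shows "finite_dimension F (carrier R)"
proof -
  obtain n where "dimension n K (carrier R)" using assms(4) by auto
  then obtain Us where Us: "set Us \<subseteq> carrier R" "Span K Us = carrier R" using exists_base[OF assms(1)] by metis
  then have "Span F Us = carrier R"
    using Span_mono_field[OF assms(1-3) Us(1)] Span_in_carrier[OF subfieldE(3)[OF assms(2)] Us(1)] by auto
  then show ?thesis using Span_finite_dimension[OF assms(2) Us(1)] by simp
qed

text \<open>Over a field \<open>F\<close> that contains all p-th powers this is the usual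
  p-independence. The sequential form matches the definition of normal generating sequences and lets
  the degree grow by the factor \<open>p\<close> with each term.\<close>

definition p_independent_seq :: "'a set \<Rightarrow> 'a list \<Rightarrow> bool"
  where "p_independent_seq F xs \<longleftrightarrow> set xs \<subseteq> carrier R \<and>
    (\<forall>i < length xs. xs ! i \<notin> generate_field R (F \<union> set (take i xs)))"

lemma dimension_p_independent_seq:
  assumes F: "subfield F R" and xp: "\<And>x. x \<in> carrier R \<Longrightarrow> x [^] p \<in> F"
    and "p_independent_seq F xs"
  shows "dimension (p ^ length xs) F (generate_field R (F \<union> set xs))"
  using assms(3)
proof (induction xs rule: rev_induct)
  case Nil
  then show ?case using dimension_one[OF F] generate_field_self[OF F] by simp
next
  case (snoc x xs)
  let ?G = "generate_field R (F \<union> set xs)"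
  have c: "x \<in> carrier R" "set xs \<subseteq> carrier R" using snoc.prems by (auto simp: p_independent_seq_def)
  have Fc: "F \<union> set xs \<subseteq> carrier R" using c subfieldE(3)[OF F] by auto
  have G: "subfield ?G R" by (rule generate_field_is_subfield[OF Fc])
  have ng: "xs ! i \<notin> generate_field R (F \<union> set (take i xs))" if "i < length xs" for i
  proof -
    have "(xs @ [x]) ! i \<notin> generate_field R (F \<union> set (take i (xs @ [x])))"
      using snoc.prems that by (simp add: p_independent_seq_def del: Un_insert_right)
    then show ?thesis using that by (simp add: nth_append)
  qed
  have IH: "dimension (p ^ length xs) F ?G" using snoc.IH ng c by (auto simp: p_independent_seq_def)
  have "x \<notin> ?G" using snoc.prems unfolding p_independent_seq_def by (auto dest!: spec[of _ "length xs"])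
  moreover have "x [^] p \<in> ?G" using xp[OF c(1)] by (auto intro: generate_field.incl)
  ultimately have "dimension p ?G (generate_field R (insert x ?G))"
    using dimension_p_th_root[OF G c(1)] by simp
  then have "dimension (p ^ length xs * p) F (generate_field R (insert x ?G))"
    using telescopic_base[OF F G IH] by simp
  moreover have "generate_field R (F \<union> set (xs @ [x])) = generate_field R (insert x ?G)"
    using generate_field_insert[OF subfieldE(3)[OF F] c(2,1)] by simp
  ultimately show ?case by (simp add: mult.commute)
qed

lemma p_independent_seq_length_le:
  assumes F: "subfield F R" and xp: "\<And>x. x \<in> carrier R \<Longrightarrow> x [^] p \<in> F"
    and "p_independent_seq F xs" and d: "dimension d F (carrier R)"
  shows "p ^ length xs \<le> d"
proof -
  obtain Us where "independent F Us" "length Us = p ^ length xs" "set Us \<subseteq> carrier R"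
    using exists_base[OF F dimension_p_independent_seq[OF F xp assms(3)]] by metis
  then show ?thesis using independent_length_le_dimension[OF F d] by metis
qed

text \<open>A p-independent sequence of greatest length generates, since any missing element could
  be appended. Lengths are bounded because a sequence of length l generates a field of degree p^l
  over \<open>F\<close>.\<close>

lemma exists_p_basis:
  assumes F: "subfield F R" and xp: "\<And>x. x \<in> carrier R \<Longrightarrow> x [^] p \<in> F"
    and fin: "finite_dimension F (carrier R)"
  obtains ys where "set ys \<subseteq> carrier R" "generate_field R (F \<union> set ys) = carrier R"
    "dimension (p ^ length ys) F (carrier R)"
proof -
  obtain d where d: "dimension d F (carrier R)" using fin by auto
  have bound: "length xs \<le> d" if "p_independent_seq F xs" for xs
  proof -
    have "length xs < p ^ length xs" using power_gt_expt[of p] p_gt_1 by simp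
    then show ?thesis using p_independent_seq_length_le[OF F xp that d] by linarith
  qed
  have "p_independent_seq F []" by (simp add: p_independent_seq_def)
  then obtain ys where ys: "p_independent_seq F ys" "\<And>xs. p_independent_seq F xs \<Longrightarrow> length xs \<le> length ys"
  proof -
    have "\<forall>xs. p_independent_seq F xs \<longrightarrow> length xs < Suc d" using bound by (simp add: less_Suc_eq_le)
    from ex_has_greatest_nat[of "p_independent_seq F", OF \<open>p_independent_seq F []\<close> this] that show thesis by metis
  qed
  have yc: "set ys \<subseteq> carrier R" using ys(1) by (simp add: p_independent_seq_def)
  have Fc: "F \<union> set ys \<subseteq> carrier R" using yc subfieldE(3)[OF F] by auto
  have "carrier R \<subseteq> generate_field R (F \<union> set ys)"
  proof
    fix x assume x: "x \<in> carrier R"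
    show "x \<in> generate_field R (F \<union> set ys)"
    proof (rule ccontr)
      assume "x \<notin> generate_field R (F \<union> set ys)"
      then have "p_independent_seq F (ys @ [x])"
        using ys(1) x by (auto simp: p_independent_seq_def nth_append less_Suc_eq)
      then show False using ys(2)[of "ys @ [x]"] by simp
    qed
  qed
  then have "generate_field R (F \<union> set ys) = carrier R" using generate_field_incl[OF Fc] by auto
  then show thesis using that[OF yc] dimension_p_independent_seq[OF F xp ys(1)] by simp
qed

end

subsection \<open>Perturbation of minimal polynomials\<close>

context field
begin

definition linear_functional :: "'a set \<Rightarrow> ('a \<Rightarrow> 'a) \<Rightarrow> bool"
  where "linear_functional K l \<longleftrightarrow> (\<forall>a\<in>carrier R. l a \<in> K) \<and>
    (\<forall>a\<in>carrier R. \<forall>b\<in>carrier R. l (a \<oplus> b) = l a \<oplus> l b) \<and>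
    (\<forall>c\<in>K. \<forall>a\<in>carrier R. l (c \<otimes> a) = c \<otimes> l a)"

lemma linear_functionalD:
  assumes "linear_functional K l"
  shows "a \<in> carrier R \<Longrightarrow> l a \<in> K"
    "a \<in> carrier R \<Longrightarrow> b \<in> carrier R \<Longrightarrow> l (a \<oplus> b) = l a \<oplus> l b"
    "c \<in> K \<Longrightarrow> a \<in> carrier R \<Longrightarrow> l (c \<otimes> a) = c \<otimes> l a"
  using assms by (simp_all add: linear_functional_def)

text \<open>\<open>l\<close> is the coordinate along \<open>z\<close> in a basis that completes
  \<open>z # zs\<close>; moving the added vectors \<open>Vs\<close> behind \<open>z\<close> exhibits
  the span \<open>W\<close> of all the others as a complement.\<close>

lemma separating_functional:
  assumes K: "subfield K R" and fin: "finite_dimension K (carrier R)"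
    and ind: "independent K (z # zs)"
  shows "\<exists>l. linear_functional K l \<and> l z = \<one> \<and> (\<forall>w\<in>set zs. l w = \<zero>)"
proof -
  note Kr = subringE[OF subfieldE(1)[OF K]]
  obtain n where n: "dimension n K (carrier R)" using fin by auto
  obtain Vs where Vs: "independent K (Vs @ z # zs)" "Span K (Vs @ z # zs) = carrier R"
    using complete_base[OF K n ind] independent_in_carrier[OF ind] by auto
  have "independent K (z # zs @ Vs)"
    using independent_same_set[OF K _ _ Vs(1), of "z # zs @ Vs"] by auto
  moreover have "Span K (z # zs @ Vs) = carrier R"
    using Span_same_set[OF K, of "Vs @ z # zs" "z # zs @ Vs"] Vs(2) independent_in_carrier[OF Vs(1)] by auto
  ultimately have base: "independent K (z # zs @ Vs)" "Span K (z # zs @ Vs) = carrier R" .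
  define W where "W = Span K (zs @ Vs)"
  have c: "z \<in> carrier R" "set (zs @ Vs) \<subseteq> carrier R" using independent_in_carrier[OF base(1)] by auto
  have zW: "z \<notin> W" using independent_backwards(1)[OF base(1)] by (simp add: W_def)
  have Wp: "W \<subseteq> carrier R" "\<zero> \<in> W" "\<And>a b. a \<in> W \<Longrightarrow> b \<in> W \<Longrightarrow> a \<oplus> b \<in> W" "\<And>a. a \<in> W \<Longrightarrow> \<ominus> a \<in> W"
     "\<And>k v. k \<in> K \<Longrightarrow> v \<in> W \<Longrightarrow> k \<otimes> v \<in> W"
    using Span_subgroup_props[OF K c(2)] Span_smult_closed[OF K c(2)] by (auto simp: W_def)
  have ex: "\<exists>k\<in>K. \<exists>v\<in>W. a = k \<otimes> z \<oplus> v" if "a \<in> carrier R" for a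
    using that unfolding base(2)[symmetric] by (simp add: W_def line_extension_mem_iff)
  have uniq: "k = k'" if h: "k \<in> K" "k' \<in> K" "v \<in> W" "v' \<in> W" "k \<otimes> z \<oplus> v = k' \<otimes> z \<oplus> v'" for k k' v v'
  proof (rule ccontr)
    assume ne: "k \<noteq> k'"
    have cc: "k \<in> carrier R" "k' \<in> carrier R" "v \<in> carrier R" "v' \<in> carrier R" using h Kr(1) Wp(1) by blast+
    have "k \<ominus> k' \<in> K" using h Kr by (simp add: a_minus_def)
    moreover have "k \<ominus> k' \<noteq> \<zero>" using ne cc by simp
    moreover have "(k \<ominus> k') \<otimes> z = v' \<ominus> v"
    proof -
      have "(k \<ominus> k') \<otimes> z = (k \<otimes> z \<oplus> v) \<ominus> (k' \<otimes> z) \<ominus> v" using cc c(1) by algebra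
      also have "\<dots> = v' \<ominus> v" unfolding h(5) using cc c(1) by algebra
      finally show ?thesis .
    qed
    moreover have "v' \<ominus> v \<in> W" using h Wp by (simp add: a_minus_def)
    ultimately have "z \<in> W" using Span_m_inv_simprule[OF K c(2) _ c(1), of "k \<ominus> k'"] by (simp add: W_def)
    then show False using zW by simp
  qed
  define l where "l a = (THE k. k \<in> K \<and> (\<exists>v\<in>W. a = k \<otimes> z \<oplus> v))" for a
  have lI: "l a = k" if "k \<in> K" "v \<in> W" "a = k \<otimes> z \<oplus> v" for a k v
    unfolding l_def by (rule the_equality) (use that uniq in blast)+
  have lE: "\<exists>v\<in>W. l a \<in> K \<and> a = l a \<otimes> z \<oplus> v" if "a \<in> carrier R" for a
    using ex[OF that] lI by metis
  show ?thesis
  proof (intro exI[of _ l] conjI ballI linear_functional_def[THEN iffD2])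
    show "l a \<in> K" if "a \<in> carrier R" for a using lE[OF that] by auto
    show "l (a \<oplus> b) = l a \<oplus> l b" if ab: "a \<in> carrier R" "b \<in> carrier R" for a b
    proof -
      obtain v w where v: "v \<in> W" "l a \<in> K" "a = l a \<otimes> z \<oplus> v" and w: "w \<in> W" "l b \<in> K" "b = l b \<otimes> z \<oplus> w"
        using lE ab by meson
      have cc: "l a \<in> carrier R" "l b \<in> carrier R" "v \<in> carrier R" "w \<in> carrier R" using v w Kr(1) Wp(1) by blast+
      have "(l a \<otimes> z \<oplus> v) \<oplus> (l b \<otimes> z \<oplus> w) = (l a \<oplus> l b) \<otimes> z \<oplus> (v \<oplus> w)" using cc c(1) by algebra
      then have "a \<oplus> b = (l a \<oplus> l b) \<otimes> z \<oplus> (v \<oplus> w)" using v(3) w(3) by simp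
      then show ?thesis by (intro lI[of _ "v \<oplus> w"]) (use v(1,2) w(1,2) Kr(7) Wp(3) in auto)
    qed
    show "l (k \<otimes> a) = k \<otimes> l a" if ab: "k \<in> K" "a \<in> carrier R" for k a
    proof -
      obtain v where v: "v \<in> W" "l a \<in> K" "a = l a \<otimes> z \<oplus> v" using lE ab by meson
      have cc: "l a \<in> carrier R" "k \<in> carrier R" "v \<in> carrier R" using v ab Kr(1) Wp(1) by blast+
      have "k \<otimes> (l a \<otimes> z \<oplus> v) = (k \<otimes> l a) \<otimes> z \<oplus> (k \<otimes> v)" using cc c(1) by algebra
      then have "k \<otimes> a = (k \<otimes> l a) \<otimes> z \<oplus> (k \<otimes> v)" using v(3) by simp
      then show ?thesis by (intro lI[of _ "k \<otimes> v"]) (use v(1,2) ab Kr(6) Wp(5) in auto)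
    qed
    show "l z = \<one>" by (rule lI[of _ \<zero>]) (use Kr(3) Wp(2) c in auto)
    show "l w = \<zero>" if "w \<in> set zs" for w
    proof -
      have "w \<in> W" using Span_base_incl[OF K c(2)] that by (auto simp: W_def)
      then show ?thesis by (intro lI[of _ w]) (use Kr(2) Wp(1) c in auto)
    qed
  qed
qed

lemma finite_zeros:
  assumes "set d \<subseteq> carrier R" "eval d \<zero> \<noteq> \<zero>"
  shows "finite {u \<in> carrier R. eval d u = \<zero>}"
proof -
  have n: "normalize d \<in> carrier (poly_ring R)" using normalize_gives_polynomial[OF assms(1)] univ_poly_carrier by blast
  have "normalize d \<noteq> []" using eval_normalize[OF assms(1) zero_closed] assms(2) by auto
  then have "{u \<in> carrier R. eval d u = \<zero>} \<subseteq> {u. is_root (normalize d) u}"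
    using eval_normalize[OF assms(1)] by (auto simp: is_root_def)
  then show ?thesis using finite_number_of_roots[OF n] finite_subset by blast
qed

text \<open>The parameter lies in \<open>K\<close>, so its powers are scalars and \<open>l\<close>
  passes to the coefficients. Hence the values of \<open>l\<close> on a polynomial family are again
  polynomial in the parameter.\<close>

lemma additive_eval:
  assumes K: "subfield K R"
    and lf: "linear_functional K l"
    and f: "set f \<subseteq> carrier R" and u: "u \<in> K"
  shows "l (eval f u) = eval (map l f) u"
  using f
proof (induction f)
  case Nil
  note l = linear_functionalD[OF lf]
  have "l (\<zero> \<otimes> \<zero>) = \<zero> \<otimes> l \<zero>" using subringE(2)[OF subfieldE(1)[OF K]] by (intro l(3)) auto
  then show ?case using l(1)[of \<zero>] subfieldE(3)[OF K] by auto
next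
  case (Cons a f)
  note l = linear_functionalD[OF lf]
  have uc: "u \<in> carrier R" and un: "u [^] length f \<in> K"
    using u subfieldE(3)[OF K] subring_nat_pow_closed[OF subfieldE(1)[OF K] u] by auto
  have c: "a \<in> carrier R" "eval f u \<in> carrier R" "l a \<in> carrier R"
    using Cons.prems eval_in_carrier[of f u] uc l(1) subfieldE(3)[OF K] by auto
  have "l (a \<otimes> u [^] length f) = l (u [^] length f \<otimes> a)" using c uc by (simp add: m_comm)
  also have "\<dots> = l a \<otimes> u [^] length f" using l(3)[OF un c(1)] c uc by (simp add: m_comm)
  finally show ?case using Cons l(2)[of "a \<otimes> u [^] length f" "eval f u"] c uc by simp
qed

text \<open>
  Vectors depending polynomially on a parameter \<open>u\<close>, independent at \<open>u = 0\<close>, are independent for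
  all but finitely many \<open>u\<close>. A functional \<open>l\<close> with \<open>l (f 0) = 1\<close> that kills the other vectors at
  \<open>u = 0\<close> allows an elimination step without division, by which the value \<open>l (f u)\<close> of the pivot
  is only required to be nonzero.
\<close>

lemma independent_open:
  assumes K: "subfield K R" and fin: "finite_dimension K (carrier R)"
    and c: "\<And>f. f \<in> set fs \<Longrightarrow> set f \<subseteq> carrier R"
    and ind: "independent K (map (\<lambda>f. eval f \<zero>) fs)"
  shows "finite {u \<in> K. dependent K (map (\<lambda>f. eval f u) fs)}"
  using c ind
proof (induction "length fs" arbitrary: fs)
  case 0
  then show ?case by simp
next
  case (Suc n)
  then obtain f gs where fs: "fs = f # gs" "length gs = n" by (metis length_Suc_conv)
  note Kr = subringE[OF subfieldE(1)[OF K]]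
  have fc: "set f \<subseteq> carrier R" and gc: "\<And>g. g \<in> set gs \<Longrightarrow> set g \<subseteq> carrier R" using Suc.prems(1) fs by auto
  have ind0: "independent K (eval f \<zero> # map (\<lambda>f. eval f \<zero>) gs)" using Suc.prems(2) fs by simp
  obtain l where lf: "linear_functional K l" and l0: "    l (eval f \<zero>) = \<one> \<and> (\<forall>w\<in>set (map (\<lambda>f. eval f \<zero>) gs). l w = \<zero>)"
    using separating_functional[OF K fin ind0] by (elim exE conjE) (rule that; simp)
  note l = linear_functionalD[OF lf] l0[THEN conjunct1] l0[THEN conjunct2, rule_format]
  note le = additive_eval[OF K lf]
  have lca: "l a \<in> carrier R" if "a \<in> carrier R" for a using l(1)[OF that] Kr(1) by blast
  have lc: "set (map l g) \<subseteq> carrier R" if "set g \<subseteq> carrier R" for g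
    using lca that by (auto simp: subset_iff)
  \<comment> \<open>Elimination on coefficient lists: at a parameter in \<open>K\<close> the value
    of \<open>h g\<close> is a combination of the values of \<open>g\<close> and \<open>f\<close>
    that \<open>l\<close> annihilates.\<close>
  define h where "h g = poly_add (poly_mult (map l f) g) (map (\<lambda>a. \<ominus> a) (poly_mult (map l g) f))" for g
  have pm: "set (poly_mult (map l f) g) \<subseteq> carrier R" "set (poly_mult (map l g) f) \<subseteq> carrier R"
    if "set g \<subseteq> carrier R" for g
    using poly_mult_in_carrier lc fc that by auto
  have hc: "set (h g) \<subseteq> carrier R" if "set g \<subseteq> carrier R" for g
    unfolding h_def using pm[OF that] by (intro poly_add_in_carrier) auto
  have ev_neg: "eval (map (\<lambda>a. \<ominus> a) q) u = \<ominus> (eval q u)" if "set q \<subseteq> carrier R" "u \<in> carrier R" for q u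
    using that by (induction q) (auto simp: eval_in_carrier l_minus minus_add)
  have hev: "eval (h g) u = l (eval f u) \<otimes> eval g u \<ominus> l (eval g u) \<otimes> eval f u"
    if g: "set g \<subseteq> carrier R" and u: "u \<in> K" for g u
  proof -
    have uc: "u \<in> carrier R" using u Kr by auto
    have "eval (h g) u = eval (poly_mult (map l f) g) u \<oplus> eval (map (\<lambda>a. \<ominus> a) (poly_mult (map l g) f)) u"
      unfolding h_def using pm[OF g] uc by (intro eval_poly_add) auto
    also have "\<dots> = eval (map l f) u \<otimes> eval g u \<ominus> eval (map l g) u \<otimes> eval f u"
      using ev_neg[OF pm(2)[OF g] uc] eval_poly_mult[OF lc[OF fc] g uc] eval_poly_mult[OF lc[OF g] fc uc]
      by (simp add: a_minus_def)
    finally show ?thesis using le[OF fc u] le[OF g u] by simp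
  qed
  have z: "\<zero> \<in> K" using Kr(2) .
  \<comment> \<open>At zero the pivot is one and \<open>l\<close> kills the other vectors, so
    elimination changes nothing there and the induction hypothesis applies to
    \<open>map h gs\<close>.\<close>
  have h0: "eval (h g) \<zero> = eval g \<zero>" if "g \<in> set gs" for g
    using hev[OF gc[OF that] z] l(4) l(5)[of "eval g \<zero>"] that
      eval_in_carrier[OF fc, of \<zero>] eval_in_carrier[OF gc[OF that], of \<zero>]
    by (simp add: a_minus_def)
  have "independent K (map (\<lambda>f. eval f \<zero>) (map h gs))"
  proof -
    have "map (\<lambda>f. eval f \<zero>) (map h gs) = map (\<lambda>f. eval f \<zero>) gs" using h0 by simp
    then show ?thesis using independent_backwards(2)[OF ind0] by (simp only:)
  qed
  then have A: "finite {u \<in> K. dependent K (map (\<lambda>f. eval f u) (map h gs))}"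
    using Suc.hyps(1)[of "map h gs"] fs(2) hc gc by auto
  have "eval (map l f) \<zero> \<noteq> \<zero>" using le[OF fc z] l(4) zero_not_one by metis
  then have B: "finite {u \<in> carrier R. eval (map l f) u = \<zero>}" using finite_zeros[OF lc[OF fc]] by simp
  have "{u \<in> K. dependent K (map (\<lambda>f. eval f u) fs)} \<subseteq>
     {u \<in> K. dependent K (map (\<lambda>f. eval f u) (map h gs))} \<union> {u \<in> carrier R. eval (map l f) u = \<zero>}"
  proof
    fix u assume "u \<in> {u \<in> K. dependent K (map (\<lambda>f. eval f u) fs)}"
    then have u: "u \<in> K" "dependent K (map (\<lambda>f. eval f u) fs)" by auto
    then have uc: "u \<in> carrier R" using Kr by auto
    show "u \<in> {u \<in> K. dependent K (map (\<lambda>f. eval f u) (map h gs))} \<union> {u \<in> carrier R. eval (map l f) u = \<zero>}"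
    proof (rule ccontr)
      assume "u \<notin> {u \<in> K. dependent K (map (\<lambda>f. eval f u) (map h gs))} \<union> {u \<in> carrier R. eval (map l f) u = \<zero>}"
      then have ih: "independent K (map (\<lambda>f. eval f u) (map h gs))" and d0: "l (eval f u) \<noteq> \<zero>"
        using u uc le[OF fc u(1)] by auto
      let ?d = "l (eval f u)" and ?z = "eval f u" and ?v = "\<lambda>g. eval g u"
      have zc: "?z \<in> carrier R" "?d \<in> K" "?d \<in> carrier R"
        using eval_in_carrier[OF fc uc] l(1)[of "eval f u"] lca[of "eval f u"] by blast+
      have vc: "?v g \<in> carrier R" "l (?v g) \<in> carrier R" if "g \<in> set gs" for g
        using eval_in_carrier[OF gc[OF that] uc] lca[of "eval g u"] by blast+
      have hvc: "?v (h g) \<in> carrier R" if "g \<in> set gs" for g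
        using eval_in_carrier[OF hc[OF gc[OF that]] uc] .
      have id1: "d \<otimes> (k \<otimes> v \<oplus> s) = (k \<otimes> (d \<otimes> v \<ominus> m \<otimes> z) \<oplus> t) \<oplus> (k \<otimes> m \<oplus> e) \<otimes> z"
        if "d \<otimes> s = t \<oplus> e \<otimes> z" "d \<in> carrier R" "k \<in> carrier R" "v \<in> carrier R" "s \<in> carrier R"
          "m \<in> carrier R" "z \<in> carrier R" "t \<in> carrier R" "e \<in> carrier R" for d k v s m z t e
      proof -
        have "d \<otimes> (k \<otimes> v \<oplus> s) = k \<otimes> (d \<otimes> v) \<oplus> d \<otimes> s" using that(2-) by algebra
        also have "\<dots> = k \<otimes> (d \<otimes> v) \<oplus> (t \<oplus> e \<otimes> z)" using that(1) by simp
        also have "\<dots> = (k \<otimes> (d \<otimes> v \<ominus> m \<otimes> z) \<oplus> t) \<oplus> (k \<otimes> m \<oplus> e) \<otimes> z" using that(2-) by algebra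
        finally show ?thesis .
      qed
      have id2: "d \<otimes> (k \<otimes> z \<oplus> s) \<ominus> (k \<otimes> d \<oplus> e) \<otimes> z = t"
        if "d \<otimes> s = t \<oplus> e \<otimes> z" "d \<in> carrier R" "k \<in> carrier R" "s \<in> carrier R"
          "z \<in> carrier R" "t \<in> carrier R" "e \<in> carrier R" for d k s z t e
      proof -
        have "d \<otimes> (k \<otimes> z \<oplus> s) \<ominus> (k \<otimes> d \<oplus> e) \<otimes> z = d \<otimes> s \<ominus> e \<otimes> z" using that(2-) by algebra
        also have "\<dots> = t" unfolding that(1) using that(2-) by algebra
        finally show ?thesis .
      qed
      \<comment> \<open>Summing the elimination identities with coefficients in \<open>K\<close>,
        over which \<open>l\<close> is linear, carries relations between the original vectors over
        to the eliminated ones.\<close>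
      have comb: "combine Ks (map ?v hs) \<in> carrier R \<and>
          ?d \<otimes> combine Ks (map ?v hs) = combine Ks (map ?v (map h hs)) \<oplus> l (combine Ks (map ?v hs)) \<otimes> ?z"
        if "set hs \<subseteq> set gs" "set Ks \<subseteq> K" "length Ks = length hs" for hs Ks
        using that(3,1,2)
      proof (induction Ks hs rule: list_induct2)
        case Nil
        have "l \<zero> = \<zero>"
        proof -
          have "l (\<zero> \<otimes> \<zero>) = \<zero> \<otimes> l \<zero>" by (rule l(3)[OF z zero_closed])
          then show ?thesis using lca[of \<zero>] by simp
        qed
        then show ?case using zc by simp
      next
        case (Cons k Ks g hs)
        let ?S = "combine Ks (map ?v hs)" and ?T = "combine Ks (map ?v (map h hs))"
        have IH: "?S \<in> carrier R" "?d \<otimes> ?S = ?T \<oplus> l ?S \<otimes> ?z" using Cons by auto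
        have k: "k \<in> K" "k \<in> carrier R" using Cons.prems Kr by auto
        have g: "g \<in> set gs" using Cons.prems by auto
        have Tc: "?T \<in> carrier R"
        proof (rule combine_in_carrier)
          show "set Ks \<subseteq> carrier R" using Cons.prems Kr by auto
          show "set (map ?v (map h hs)) \<subseteq> carrier R"
            using Cons.prems(1) hvc by auto
        qed
        have lS: "l ?S \<in> carrier R" using lca[OF IH(1)] .
        have lsum: "l (k \<otimes> ?v g \<oplus> ?S) = k \<otimes> l (?v g) \<oplus> l ?S"
          using l(2)[of "k \<otimes> ?v g" ?S] l(3)[OF k(1) vc(1)[OF g]] k vc[OF g] IH(1) by simp
        have hg: "?v (h g) = ?d \<otimes> ?v g \<ominus> l (?v g) \<otimes> ?z" using hev[OF gc[OF g] u(1)] .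
        have "?d \<otimes> (k \<otimes> ?v g \<oplus> ?S) = (k \<otimes> (?d \<otimes> ?v g \<ominus> l (?v g) \<otimes> ?z) \<oplus> ?T) \<oplus> (k \<otimes> l (?v g) \<oplus> l ?S) \<otimes> ?z"
          by (rule id1[OF IH(2) zc(3) k(2) vc(1)[OF g] IH(1) vc(2)[OF g] zc(1) Tc lS])
        then show ?case using lsum hg k vc[OF g] IH(1) by simp
      qed
      have "independent K (map ?v fs)"
      proof (rule trivial_combine_imp_independent[OF K])
        show "set (map ?v fs) \<subseteq> carrier R" using zc vc fs by auto
        fix Ks' assume Ks': "set Ks' \<subseteq> K" "combine Ks' (map ?v fs) = \<zero>"
        have sc: "set (map ?v fs) \<subseteq> carrier R" using zc vc fs by auto
        \<comment> \<open>\<open>Ks'\<close> may be longer or shorter than the list of vectors;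
          \<open>Ks0\<close> is a version of the exact length, so that the coefficient of the pivot
          can be split off.\<close>
        obtain Ks0 where Ks0: "set (take (length (map ?v fs)) Ks') \<subseteq> set Ks0" "set Ks0 \<subseteq> set (take (length (map ?v fs)) Ks') \<union> {\<zero>}"
          "length Ks0 = length (map ?v fs)" "combine Ks0 (map ?v fs) = \<zero>"
          using combine_normalize[OF subset_trans[OF Ks'(1) Kr(1)] sc Ks'(2)] .
        have Ks0K: "set Ks0 \<subseteq> K" 
          using Ks0(2) subset_trans[OF set_take_subset[of "length (map ?v fs)" Ks'] Ks'(1)] z by blast
        obtain k Ks where Ks: "Ks0 = k # Ks" "length Ks = length gs" using Ks0(3) fs by (auto simp: length_Suc_conv)
        have kK: "k \<in> K" "set Ks \<subseteq> K" using Ks0K Ks by auto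
        then have kc: "k \<in> carrier R" using Kr by auto
        let ?S = "combine Ks (map ?v gs)" and ?T = "combine Ks (map ?v (map h gs))"
        have eq: "k \<otimes> ?z \<oplus> ?S = \<zero>" using Ks0(4) Ks fs by simp
        have cs: "?S \<in> carrier R" "?d \<otimes> ?S = ?T \<oplus> l ?S \<otimes> ?z" using comb[OF subset_refl kK(2) Ks(2)] by auto
        have Tc: "?T \<in> carrier R"
        proof (rule combine_in_carrier)
          show "set Ks \<subseteq> carrier R" using kK Kr by auto
          show "set (map ?v (map h gs)) \<subseteq> carrier R" using hvc by auto
        qed
        have lS: "l ?S \<in> carrier R" using lca[OF cs(1)] .
        have l0: "l \<zero> = \<zero>"
        proof -
          have "l (\<zero> \<otimes> \<zero>) = \<zero> \<otimes> l \<zero>" by (rule l(3)[OF z zero_closed])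
          then show ?thesis using lca[of \<zero>] by simp
        qed
        have "l (k \<otimes> ?z \<oplus> ?S) = k \<otimes> ?d \<oplus> l ?S"
          using l(2)[of "k \<otimes> ?z" ?S] l(3)[OF kK(1) zc(1)] zc kc cs(1) by simp
        then have leq: "k \<otimes> ?d \<oplus> l ?S = \<zero>" using eq l0 by simp
        \<comment> \<open>Applying \<open>l\<close> to the relation gave the scalar relation
          \<open>leq\<close>. The two together annihilate the right side, which leaves a relation
          between the eliminated vectors alone.\<close>
        have "?T = ?d \<otimes> (k \<otimes> ?z \<oplus> ?S) \<ominus> (k \<otimes> ?d \<oplus> l ?S) \<otimes> ?z"
          by (rule id2[OF cs(2) zc(3) kc cs(1) zc(1) Tc lS, symmetric])
        then have "?T = \<zero>" unfolding eq leq using zc by simp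
        then have "set (take (length (map ?v (map h gs))) Ks) \<subseteq> {\<zero>}"
          by (rule independent_imp_trivial_combine[OF K ih kK(2)])
        then have Ks_zero: "set Ks \<subseteq> {\<zero>}" using Ks(2) by simp
        then have "Ks = replicate (length (map ?v gs)) \<zero>" using Ks(2)
          by (metis length_map replicate_length_same singletonD subsetD)
        then have "?S = \<zero>" using combine_replicate[of "map ?v gs"] vc by auto
        then have "l ?S = \<zero>" using l0 by simp
        then have "k \<otimes> ?d = \<zero>" using leq zc kc by simp
        then have "k = \<zero>" using d0 zc kc integral by blast
        then have "set Ks0 \<subseteq> {\<zero>}" using Ks Ks_zero by auto
        then show "set (take (length (map ?v fs)) Ks') \<subseteq> {\<zero>}" using Ks0(1) by auto
      qed
      then show False using u(2) by simp
    qed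
  qed
  then show ?case using A B finite_subset by blast
qed

end

section \<open>Formal derivatives and first-order expansion in a parameter\<close>

context field
begin

lemma poly_deriv_in:
  assumes K: "subring K R" and "set f \<subseteq> K"
  shows "poly_deriv f \<in> carrier (K[X])" "length (poly_deriv f) \<le> length f - 1"
proof -
  have add: "[i] \<cdot> a \<in> K" if "a \<in> K" for i :: nat and a
    using that subringE(2,7)[OF K] by (induction i) auto
  have "coeff f i \<in> K" if "i < length f" for i
    using that assms(2) coeff_img_restrict[of f] by auto
  then have "set (map (\<lambda>i. [i] \<cdot> coeff f i) (rev [1..<length f])) \<subseteq> K" using add by auto
  then show "poly_deriv f \<in> carrier (K[X])"
    unfolding poly_deriv_def using normalize_gives_polynomial univ_poly_carrier by blast
  show "length (poly_deriv f) \<le> length f - 1"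
    unfolding poly_deriv_def using normalize_length_le[of "map (\<lambda>i. [i] \<cdot> coeff f i) (rev [1..<length f])"] by simp
qed

lemma eval_poly_deriv_Cons:
  assumes c: "set (a # f) \<subseteq> carrier R" and x: "x \<in> carrier R"
  shows "eval (poly_deriv (a # f)) x = [length f] \<cdot> a \<otimes> x [^] (length f - 1) \<oplus> eval (poly_deriv f) x"
proof (cases "f = []")
  case True
  then show ?thesis using assms by (simp add: poly_deriv_def)
next
  case False
  define g where "g = map (\<lambda>i. [i] \<cdot> coeff f i) (rev [1..<length f])"
  have gc: "set g \<subseteq> carrier R" using c by (auto simp: g_def)
  have "rev [1..<length (a # f)] = length f # rev [1..<length f]" using False by (cases f) auto
  moreover have "map (\<lambda>i. [i] \<cdot> coeff (a # f) i) (rev [1..<length f]) = g" by (auto simp: g_def)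
  ultimately have "poly_deriv (a # f) = normalize (([length f] \<cdot> a) # g)"
    by (simp add: poly_deriv_def del: normalize.simps)
  then have "eval (poly_deriv (a # f)) x = eval (([length f] \<cdot> a) # g) x"
    using eval_normalize[of "([length f] \<cdot> a) # g" x] gc c x by simp
  moreover have "eval (poly_deriv f) x = eval g x"
    using eval_normalize[OF gc x] by (simp add: poly_deriv_def g_def)
  ultimately show ?thesis by (simp add: g_def)
qed

text \<open>Taylor expansion to first order in \<open>u\<close>, with everything beyond the constant
  term collected in one polynomial \<open>w\<close>; the value of \<open>w\<close> at zero is the
  derivative of the power in the direction \<open>b\<close>.\<close>

lemma power_perturbation:
  assumes t: "t \<in> carrier R" and b: "b \<in> carrier R"
  shows "\<exists>w. set w \<subseteq> carrier R \<and> eval w \<zero> = [n] \<cdot> (t [^] (n - 1) \<otimes> b) \<and>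
    (\<forall>u\<in>carrier R. (t \<oplus> u \<otimes> b) [^] (n::nat) = t [^] n \<oplus> u \<otimes> eval w u)"
proof (induction n)
  case 0
  show ?case by (rule exI[of _ "[]"]) simp
next
  case (Suc n)
  then obtain w where w: "set w \<subseteq> carrier R" "eval w \<zero> = [n] \<cdot> (t [^] (n - 1) \<otimes> b)"
    "\<And>u. u \<in> carrier R \<Longrightarrow> (t \<oplus> u \<otimes> b) [^] n = t [^] n \<oplus> u \<otimes> eval w u" by blast
  define w' where "w' = poly_add (poly_mult w [b, t]) [t [^] n \<otimes> b]"
  have bt: "set [b, t] \<subseteq> carrier R" using t b by simp
  have w'c: "set w' \<subseteq> carrier R"
    unfolding w'_def using poly_mult_in_carrier[OF w(1) bt] t b by (intro poly_add_in_carrier) auto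
  have ev: "eval w' u = eval w u \<otimes> (b \<otimes> u \<oplus> t) \<oplus> t [^] n \<otimes> b" if u: "u \<in> carrier R" for u
  proof -
    have "eval w' u = eval (poly_mult w [b, t]) u \<oplus> eval [t [^] n \<otimes> b] u"
      unfolding w'_def using poly_mult_in_carrier[OF w(1) bt] t b u by (intro eval_poly_add) auto
    then show ?thesis using eval_poly_mult[OF w(1) bt u] t b u by simp
  qed
  have "eval w' \<zero> = eval w \<zero> \<otimes> t \<oplus> t [^] n \<otimes> b" using ev[of \<zero>] t b by simp
  also have "eval w \<zero> \<otimes> t = [n] \<cdot> (t [^] n \<otimes> b)"
  proof (cases n)
    case 0
    then show ?thesis using w(2) t by simp
  next
    case (Suc m)
    have "[n] \<cdot> (t [^] m \<otimes> b) \<otimes> t = [n] \<cdot> (t [^] m \<otimes> b \<otimes> t)"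
      by (rule add_pow_ldistr) (use t b in auto)
    also have "t [^] m \<otimes> b \<otimes> t = t [^] n \<otimes> b" unfolding Suc using t b by (simp add: m_ac)
    finally show ?thesis unfolding w(2) Suc by simp
  qed
  also have "[n] \<cdot> (t [^] n \<otimes> b) \<oplus> t [^] n \<otimes> b = [Suc n] \<cdot> (t [^] n \<otimes> b)"
    using t b by simp
  finally have 0: "eval w' \<zero> = [Suc n] \<cdot> (t [^] (Suc n - 1) \<otimes> b)" by simp
  have "(t \<oplus> u \<otimes> b) [^] Suc n = t [^] Suc n \<oplus> u \<otimes> eval w' u" if u: "u \<in> carrier R" for u
  proof -
    define e s where "e = eval w u" and "s = t [^] n"
    have ec: "e \<in> carrier R" "s \<in> carrier R" using eval_in_carrier[OF w(1) u] t by (auto simp: e_def s_def)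
    have "(s \<oplus> u \<otimes> e) \<otimes> (t \<oplus> u \<otimes> b) = s \<otimes> t \<oplus> u \<otimes> (e \<otimes> (b \<otimes> u \<oplus> t) \<oplus> s \<otimes> b)"
      using ec t b u by algebra
    then show ?thesis using w(3)[OF u] ev[OF u] by (simp add: e_def s_def)
  qed
  then show ?case using w'c 0 by blast
qed

lemma eval_perturbation:
  assumes t: "t \<in> carrier R" and b: "b \<in> carrier R" and f: "set f \<subseteq> carrier R"
  shows "\<exists>w. set w \<subseteq> carrier R \<and> eval w \<zero> = eval (poly_deriv f) t \<otimes> b \<and>
    (\<forall>u\<in>carrier R. eval f (t \<oplus> u \<otimes> b) = eval f t \<oplus> u \<otimes> eval w u)"
  using f
proof (induction f)
  case Nil
  show ?case by (rule exI[of _ "[]"]) (use b in \<open>simp add: poly_deriv_def\<close>)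
next
  case (Cons a f)
  have a: "a \<in> carrier R" and fc: "set f \<subseteq> carrier R" using Cons.prems by auto
  obtain w where w: "set w \<subseteq> carrier R" "eval w \<zero> = eval (poly_deriv f) t \<otimes> b"
    "\<And>u. u \<in> carrier R \<Longrightarrow> eval f (t \<oplus> u \<otimes> b) = eval f t \<oplus> u \<otimes> eval w u" using Cons.IH[OF fc] by blast
  let ?n = "length f"
  obtain v where v: "set v \<subseteq> carrier R" "eval v \<zero> = [?n] \<cdot> (t [^] (?n - 1) \<otimes> b)"
    "\<And>u. u \<in> carrier R \<Longrightarrow> (t \<oplus> u \<otimes> b) [^] ?n = t [^] ?n \<oplus> u \<otimes> eval v u"
    using power_perturbation[OF t b, of ?n] by blast
  define w' where "w' = poly_add (poly_mult [a] v) w"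
  have av: "set (poly_mult [a] v) \<subseteq> carrier R" using a v(1) by (intro poly_mult_in_carrier) auto
  have w'c: "set w' \<subseteq> carrier R" unfolding w'_def by (rule poly_add_in_carrier[OF av w(1)])
  have ev: "eval w' u = a \<otimes> eval v u \<oplus> eval w u" if u: "u \<in> carrier R" for u
  proof -
    have "set [a] \<subseteq> carrier R" using a by simp
    then show ?thesis unfolding w'_def eval_poly_add[OF av w(1) u] using eval_poly_mult[OF _ v(1) u, of "[a]"] a by simp
  qed
  have dc: "eval (poly_deriv f) t \<in> carrier R"
    using poly_deriv_in(1)[OF carrier_is_subring fc] t univ_poly_carrier polynomial_incl eval_in_carrier by metis
  have "a \<otimes> [?n] \<cdot> (t [^] (?n - 1) \<otimes> b) = [?n] \<cdot> a \<otimes> t [^] (?n - 1) \<otimes> b"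
    using a t b by (simp add: add_pow_rdistr add_pow_ldistr m_assoc)
  then have "eval w' \<zero> = eval (poly_deriv (a # f)) t \<otimes> b"
    using ev[of \<zero>] v(2) w(2) a t b dc eval_poly_deriv_Cons[OF Cons.prems t] by (simp add: l_distr)
  moreover have "eval (a # f) (t \<oplus> u \<otimes> b) = eval (a # f) t \<oplus> u \<otimes> eval w' u" if u: "u \<in> carrier R" for u
  proof -
    define e1 e2 s g where "e1 = eval v u" and "e2 = eval w u" and "s = t [^] ?n" and "g = eval f t"
    have c: "e1 \<in> carrier R" "e2 \<in> carrier R" "s \<in> carrier R" "g \<in> carrier R"
      using eval_in_carrier v(1) w(1) fc u t by (auto simp: e1_def e2_def s_def g_def)
    have "a \<otimes> (s \<oplus> u \<otimes> e1) \<oplus> (g \<oplus> u \<otimes> e2) = (a \<otimes> s \<oplus> g) \<oplus> u \<otimes> (a \<otimes> e1 \<oplus> e2)"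
      using c a u by algebra
    then show ?thesis using v(3)[OF u] w(3)[OF u] ev[OF u] by (simp add: e1_def e2_def s_def g_def)
  qed
  ultimately show ?case using w'c by blast
qed

lemma eval_in_simple_extension:
  assumes "subfield K R" "x \<in> carrier R" "f \<in> carrier (K[X])"
  shows "eval f x \<in> simple_extension K x"
  using simple_extension_as_eval_img[OF subfieldE(3)[OF assms(1)] assms(2)] assms(3) by blast

text \<open>
  The vectors \<open>1, t + ub, \<dots>, (t + ub)\<^sup>m\<^sup>-\<^sup>1\<close> and \<open>P(t + ub) / u\<close>, where \<open>P\<close> is the minimal polynomial
  of \<open>t\<close> and \<open>m\<close> its degree, specialise at \<open>u = 0\<close> to \<open>1, t, \<dots>, t\<^sup>m\<^sup>-\<^sup>1\<close> and \<open>P'(t) b\<close>.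
\<close>

lemma degree_perturbation:
  assumes K: "subfield K R" and fin: "finite_dimension K (carrier R)"
    and t: "t \<in> carrier R" and b: "b \<in> carrier R" "b \<notin> simple_extension K t"
    and D: "eval (poly_deriv (Irr K t)) t \<noteq> \<zero>"
  shows "finite {u \<in> K. degree (Irr K (t \<oplus> u \<otimes> b)) \<le> degree (Irr K t)}"
proof -
  note Kr = subringE[OF subfieldE(1)[OF K]]
  have alg: "(algebraic over K) x" if "x \<in> carrier R" for x
    using finite_dimension_imp_algebraic[OF K carrier_is_subring fin] that .
  define P where "P = Irr K t"
  define m where "m = degree P"
  note PI = IrrE[OF K t alg[OF t], folded P_def]
  have Pp: "set P \<subseteq> K" using PI(1) univ_poly_carrier polynomial_incl by metis
  then have Pc: "set P \<subseteq> carrier R" using Kr by auto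
  define E where "E = simple_extension K t"
  have E: "subfield E R" using simple_extension_is_subfield[OF K t] alg[OF t] by (simp add: E_def)
  have SE: "Span K (exp_base t m) = E" unfolding E_def m_def P_def by (rule Span_exp_base[OF K t alg[OF t]])
  obtain w where w: "set w \<subseteq> carrier R" "eval w \<zero> = eval (poly_deriv P) t \<otimes> b"
    "\<And>u. u \<in> carrier R \<Longrightarrow> eval P (t \<oplus> u \<otimes> b) = eval P t \<oplus> u \<otimes> eval w u"
    using eval_perturbation[OF t b(1) Pc] by blast
  have "\<forall>j. \<exists>v. set v \<subseteq> carrier R \<and> (\<forall>u\<in>carrier R. (t \<oplus> u \<otimes> b) [^] (j::nat) = t [^] j \<oplus> u \<otimes> eval v u)"
    using power_perturbation[OF t b(1)] by blast
  from choice[OF this]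
  obtain v where v: "\<And>j. set (v j) \<subseteq> carrier R"
    "\<And>j u. u \<in> carrier R \<Longrightarrow> (t \<oplus> u \<otimes> b) [^] (j::nat) = t [^] j \<oplus> u \<otimes> eval (v j) u"
    by blast
  \<comment> \<open>Appending an entry to a coefficient list multiplies by the parameter and adds a
    constant term, so the lists \<open>v j @ [t [^] j]\<close> represent the powers of t + u b. The
    head \<open>w\<close> represents P(t + u b) / u.\<close>
  define fs where "fs = w # map (\<lambda>j. v j @ [t [^] j]) (rev [0..<m])"
  have fc: "set f \<subseteq> carrier R" if "f \<in> set fs" for f 
  proof -
    have "set (v j @ [t [^] j]) \<subseteq> carrier R" for j using v(1)[of j] t by simp
    then show ?thesis using that w(1) unfolding fs_def by (auto simp del: set_append)
  qed
  have evj: "eval (v j @ [t [^] j]) u = (t \<oplus> u \<otimes> b) [^] j" if u: "u \<in> carrier R" for j u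
    using eval_append_aux[OF v(1) _ u, of "t [^] j" j] v(2)[OF u, of j] t u eval_in_carrier[OF v(1) u, of j]
    by (simp add: m_comm a_comm)
  \<comment> \<open>P'(t) is a nonzero element of the field K(t), so P'(t) b lies outside K(t) just
    as \<open>b\<close> does.\<close>
  have "D \<in> E \<Longrightarrow> D \<noteq> \<zero> \<Longrightarrow> D \<otimes> b \<notin> E" for D
    using subfield_m_inv_simprule[OF E _ b(1)] b(2) by (auto simp: E_def)
  then have "eval w \<zero> \<notin> Span K (exp_base t m)"
    unfolding SE w(2) E_def P_def
    using eval_in_simple_extension[OF K t poly_deriv_in(1)[OF subfieldE(1)[OF K]]] Pp D by (simp add: P_def)
  then have "independent K (eval w \<zero> # exp_base t m)"
    using independent.li_Cons[of "eval w \<zero>" K "exp_base t m"] exp_base_independent[OF K t alg[OF t]]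
      eval_in_carrier[OF w(1) zero_closed] by (simp add: m_def P_def)
  moreover have "map (\<lambda>f. eval f \<zero>) fs = eval w \<zero> # exp_base t m"
    using evj[OF zero_closed] t b by (simp add: fs_def exp_base_def comp_def)
  ultimately have bad: "finite {u \<in> K. dependent K (map (\<lambda>f. eval f u) fs)}"
    using independent_open[OF K fin fc] by simp
  \<comment> \<open>The value u = 0 is set aside because P(t + u b) / u is recognised as an element
    of K(t + u b) by dividing by u. For the other good u there are m + 1 independent vectors in K(t
    + u b), which forces its degree above m.\<close>
  have "{u \<in> K. degree (Irr K (t \<oplus> u \<otimes> b)) \<le> degree (Irr K t)} \<subseteq>
      insert \<zero> {u \<in> K. dependent K (map (\<lambda>f. eval f u) fs)}"
  proof
    fix u assume "u \<in> {u \<in> K. degree (Irr K (t \<oplus> u \<otimes> b)) \<le> degree (Irr K t)}"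
    then have u: "u \<in> K" "degree (Irr K (t \<oplus> u \<otimes> b)) \<le> m" by (auto simp: m_def P_def)
    then have uc: "u \<in> carrier R" using Kr by auto
    show "u \<in> insert \<zero> {u \<in> K. dependent K (map (\<lambda>f. eval f u) fs)}"
    proof (rule ccontr)
      assume "u \<notin> insert \<zero> {u \<in> K. dependent K (map (\<lambda>f. eval f u) fs)}"
      then have u0: "u \<noteq> \<zero>" and ind: "independent K (map (\<lambda>f. eval f u) fs)" using u by auto
      define t' where "t' = t \<oplus> u \<otimes> b"
      have t': "t' \<in> carrier R" using t b uc by (simp add: t'_def)
      define E' where "E' = simple_extension K t'"
      have E': "subfield E' R" "K \<subseteq> E'" "t' \<in> E'"
        using simple_extension_is_subfield[OF K t'] alg[OF t'] simple_extension_incl[OF Kr(1) t']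
          simple_extension_mem[OF subfieldE(1)[OF K] t'] by (auto simp: E'_def)
      have "u \<otimes> eval w u = eval P t'" using w(3)[OF uc] PI(4) uc eval_in_carrier[OF w(1) uc] by (simp add: t'_def)
      also have "\<dots> \<in> E'" unfolding E'_def by (rule eval_in_simple_extension[OF K t' PI(1)])
      finally have "eval w u \<in> E'"
        using subfield_m_inv_simprule[OF E'(1) _ eval_in_carrier[OF w(1) uc], of u] E'(2) u(1) u0 by auto
      moreover have "eval (v j @ [t [^] j]) u \<in> E'" for j
        unfolding evj[OF uc] using subring_nat_pow_closed[OF subfieldE(1)[OF E'(1)] E'(3)] by (simp add: t'_def)
      ultimately have "set (map (\<lambda>f. eval f u) fs) \<subseteq> E'" by (auto simp: fs_def)
      moreover have "dimension (degree (Irr K t')) K E'"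
        unfolding E'_def by (rule dimension_simple_extension[OF K t' alg[OF t']])
      ultimately have "length (map (\<lambda>f. eval f u) fs) \<le> degree (Irr K t')"
        using independent_length_le_dimension[OF K _ ind] by blast
      then show False using u(2) by (simp add: fs_def t'_def)
    qed
  qed
  then show ?thesis using bad finite_subset by blast
qed

end

subsection \<open>The fields generated by Frobenius powers\<close>

context ring
begin

lemma spanning_list_independent:
  assumes K: "subfield K R" and "set Us \<subseteq> carrier R" "dimension (length Us) K (Span K Us)"
  shows "independent K Us"
  using assms(2,3)
proof (induction Us)
  case Nil
  then show ?case by simp
next
  case (Cons u Us)
  have c: "u \<in> carrier R" "set Us \<subseteq> carrier R" using Cons.prems(1) by auto
  obtain d where d: "d \<le> length Us" "dimension d K (Span K Us)" using Span_dimension_le[OF K c(2)] by blast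
  have u: "u \<notin> Span K Us"
  proof
    assume "u \<in> Span K Us"
    then have "set (u # Us) \<subseteq> Span K Us" using Span_base_incl[OF K c(2)] by auto
    then have "Span K (u # Us) = Span K Us"
      using mono_Span_subset[OF K _ c(2)] mono_Span[OF K c(2,1)] by blast
    then have "d = length (u # Us)" using dimension_is_inj[OF K d(2)] Cons.prems(2) by simp
    then show False using d(1) by simp
  qed
  then have "dimension (Suc d) K (Span K (u # Us))" using Suc_dim[OF c(1) u d(2)] by simp
  then have "Suc d = length (u # Us)" using dimension_is_inj[OF K _ Cons.prems(2)] by blast
  then have "independent K Us" using Cons.IH c(2) d(2) by simp
  then show ?case using li_Cons[OF c(1) u] by simp
qed

lemma subfield_is_subalgebra:
  assumes "subfield E R" "K \<subseteq> E"
  shows "subalgebra K E R"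
  using subring.axioms(1)[OF subfieldE(1)[OF assms(1)]] subringE(6)[OF subfieldE(1)[OF assms(1)]] assms(2)
  by (auto simp: subalgebra_def subalgebra_axioms_def)

lemma subspace_eqI:
  assumes K: "subfield K R" and "dimension d K V" "dimension d K W" "V \<subseteq> W"
  shows "V = W"
proof -
  obtain Us where Us: "set Us \<subseteq> carrier R" "independent K Us" "length Us = d" "Span K Us = V"
    using exists_base[OF K assms(2)] by blast
  then have "set Us \<subseteq> W" using Span_base_incl[OF K Us(1)] assms(4) by auto
  then show ?thesis using independent_length_eq_dimension[OF K assms(3) Us(2)] Us(3,4) by blast
qed

end

context field_prime_char
begin

lemma frob1:
  "x \<in> carrier R \<Longrightarrow> y \<in> carrier R \<Longrightarrow> (x \<oplus> y) [^] p = x [^] p \<oplus> y [^] p"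
  "x \<in> carrier R \<Longrightarrow> y \<in> carrier R \<Longrightarrow> (x \<otimes> y) [^] p = x [^] p \<otimes> y [^] p"
  using frob_add[of x y 1] frob_mult[of x y 1] by auto

lemma Span_frob:
  assumes K: "subfield K R" and Us: "set Us \<subseteq> carrier R" and y: "y \<in> Span K Us"
  shows "y [^] p \<in> Span K (map (\<lambda>u. u [^] p) Us)"
  using Us y
proof (induction Us arbitrary: y)
  case Nil
  then show ?case using frob_zero[of 1] by simp
next
  case (Cons u Us)
  obtain k v where k: "k \<in> K" "v \<in> Span K Us" "y = k \<otimes> u \<oplus> v"
    using Cons.prems(2) by (auto simp: line_extension_mem_iff)
  have c: "k \<in> carrier R" "v \<in> carrier R" "u \<in> carrier R"
    using k subfieldE(3)[OF K] Cons.prems(1) Span_in_carrier[OF subfieldE(3)[OF K], of Us] by auto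
  have "y [^] p = k [^] p \<otimes> u [^] p \<oplus> v [^] p" unfolding k(3) using c by (simp add: frob1)
  moreover have "k [^] p \<in> K" using subring_nat_pow_closed[OF subfieldE(1)[OF K] k(1)] .
  moreover have "v [^] p \<in> Span K (map (\<lambda>u. u [^] p) Us)" using Cons k by simp
  ultimately show ?case by (auto simp: line_extension_mem_iff)
qed

text \<open>With L the whole ambient field this is K(L^(p^n)), a decreasing chain. Its member for
  \<open>n = 1\<close> is the field M, and its eventual value takes the place of the separable
  part.\<close>

definition frob_field :: "'a set \<Rightarrow> nat \<Rightarrow> 'a set"
  where "frob_field K n = generate_field R (K \<union> (\<lambda>x. x [^] (p ^ n)) ` carrier R)"

context
  fixes K assumes K: "subfield K R" and fin: "finite_dimension K (carrier R)"
begin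

lemma frob_field_gens: "K \<union> (\<lambda>x. x [^] (p ^ n)) ` carrier R \<subseteq> carrier R"
  using subfieldE(3)[OF K] by auto

lemma frob_field_props:
  "subfield (frob_field K n) R" "K \<subseteq> frob_field K n" "x \<in> carrier R \<Longrightarrow> x [^] (p ^ n) \<in> frob_field K n"
  using generate_field_is_subfield[OF frob_field_gens]
  by (auto simp: frob_field_def intro: generate_field.incl)

lemma frob_field_least:
  assumes "subfield E R" "K \<subseteq> E" "\<And>x. x \<in> carrier R \<Longrightarrow> x [^] (p ^ n) \<in> E"
  shows "frob_field K n \<subseteq> E"
  unfolding frob_field_def by (rule generate_field_min_subfield1[OF frob_field_gens assms(1)]) (use assms in auto)

lemma frob_field_0: "frob_field K 0 = carrier R"
  
proof
  show "carrier R \<subseteq> frob_field K 0" using frob_field_props(3)[where n = 0] by auto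
qed (rule subfieldE(3)[OF frob_field_props(1)])

lemma frob_field_Suc: "frob_field K (Suc n) \<subseteq> frob_field K n"
proof (rule frob_field_least[OF frob_field_props(1,2)])
  fix x assume x: "x \<in> carrier R"
  then show "x [^] p ^ Suc n \<in> frob_field K n"
    using frob_field_props(3)[of "x [^] p" n] by (simp add: nat_pow_pow)
qed

lemma frob_field_Suc_pow:
  assumes "z \<in> frob_field K n"
  shows "z [^] p \<in> frob_field K (Suc n)"
proof -
  have "z [^] (p ^ 1) \<in> frob_field K (Suc n)"
  proof (rule generate_field_frob[OF frob_field_gens frob_field_props(1) _ assms[unfolded frob_field_def]])
    fix h assume "h \<in> K \<union> (\<lambda>x. x [^] (p ^ n)) ` carrier R"
    then show "h [^] p ^ 1 \<in> frob_field K (Suc n)"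
    proof
      assume "h \<in> K"
      then show ?thesis using subring_nat_pow_closed[OF subfieldE(1)[OF K]] frob_field_props(2)[of "Suc n"] by blast
    next
      assume "h \<in> (\<lambda>x. x [^] (p ^ n)) ` carrier R"
      then obtain x where x: "x \<in> carrier R" "h = x [^] (p ^ n)" by auto
      then show ?thesis using frob_field_props(3)[OF x(1), of "Suc n"] by (simp add: nat_pow_pow mult.commute)
    qed
  qed
  then show ?thesis by simp
qed

lemma dimension_subfield:
  assumes "subfield E R" "K \<subseteq> E"
  obtains d where "dimension d K E"
proof -
  have "finite_dimension K E"
    using subalbegra_incl_imp_finite_dimension[OF K fin subfield_is_subalgebra[OF assms] subfieldE(3)[OF assms(1)]] .
  then show thesis using that by auto
qed

lemma algebraic_all: "x \<in> carrier R \<Longrightarrow> (algebraic over K) x"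
  using finite_dimension_imp_algebraic[OF K carrier_is_subring fin] .

text \<open>A member of least dimension over \<open>K\<close> in the decreasing chain must equal its
  successor.\<close>

lemma frob_field_stable: "\<exists>N. frob_field K (Suc N) = frob_field K N"
proof -
  have "\<exists>d. dimension d K (frob_field K n)" for n using dimension_subfield[OF frob_field_props(1,2)] by blast
  then obtain d where d: "\<And>n. dimension (d n) K (frob_field K n)" by metis
  obtain N where N: "\<And>n. d N \<le> d n" using ex_has_least_nat[of "\<lambda>_. True" 0 d] by auto
  obtain Us where Us: "set Us \<subseteq> carrier R" "independent K Us" "length Us = d (Suc N)" "Span K Us = frob_field K (Suc N)"
    using exists_base[OF K d] by blast
  have "set Us \<subseteq> frob_field K N" using Span_base_incl[OF K Us(1)] Us(4) frob_field_Suc by blast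
  then have "d (Suc N) \<le> d N" using independent_length_le_dimension[OF K d Us(2)] Us(3) by simp
  then have "d (Suc N) = d N" using N[of "Suc N"] by simp
  then have "frob_field K (Suc N) = frob_field K N"
    using subspace_eqI[OF K, of "d N" "frob_field K (Suc N)"] d[of N] d[of "Suc N"] frob_field_Suc by simp
  then show ?thesis by blast
qed

lemma frob_field_stable_Suc:
  assumes "frob_field K (Suc N) = frob_field K N"
  shows "frob_field K (Suc (Suc N)) = frob_field K (Suc N)"
proof
  show "frob_field K (Suc N) \<subseteq> frob_field K (Suc (Suc N))"
  proof (rule frob_field_least[OF frob_field_props(1,2)])
    fix x assume x: "x \<in> carrier R"
    have "x [^] (p ^ N) \<in> frob_field K (Suc N)" using frob_field_props(3)[OF x] assms by simp
    then have "(x [^] (p ^ N)) [^] p \<in> frob_field K (Suc (Suc N))" by (rule frob_field_Suc_pow)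
    then show "x [^] p ^ Suc N \<in> frob_field K (Suc (Suc N))" using x by (simp add: nat_pow_pow mult.commute)
  qed
qed (rule frob_field_Suc)

text \<open>Complete \<open>zs\<close> to a basis of the stable field. The p-th powers of this basis
  span a field containing K(L^(p^(N+1))), which is the stable field again, and a spanning list whose
  length is the dimension is independent. This stands in for separability of the stable
  field.\<close>

lemma independent_frob:
  assumes st: "frob_field K (Suc N) = frob_field K N"
    and ind: "independent K zs" and zs: "set zs \<subseteq> frob_field K N"
  shows "independent K (map (\<lambda>x. x [^] p) zs)"
proof -
  obtain d where d: "dimension d K (frob_field K N)" using dimension_subfield[OF frob_field_props(1,2)] by blast
  obtain Vs where Vs: "length (Vs @ zs) = d" "independent K (Vs @ zs)" "Span K (Vs @ zs) = frob_field K N"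
    using complete_base[OF K d ind zs] by blast
  define B where "B = Vs @ zs"
  let ?F = "\<lambda>x. x [^] p"
  have Bc: "set B \<subseteq> carrier R" using independent_in_carrier[OF Vs(2)] by (simp add: B_def)
  have Fc: "set (map ?F B) \<subseteq> carrier R" using Bc by auto
  have SB: "Span K B = frob_field K N" using Vs(3) by (simp add: B_def)
  have pow: "y [^] p \<in> Span K (map ?F B)" if "y \<in> frob_field K N" for y
    using Span_frob[OF K Bc] that SB by simp
  note Fr = subringE[OF subfieldE(1)[OF frob_field_props(1)[of N]]]
  have one: "\<one> \<in> Span K (map ?F B)" using pow[OF Fr(3)] by simp
  have sub: "subfield (Span K (map ?F B)) R"
  proof (rule Span_is_subfield[OF K Fc one])
    fix u v assume "u \<in> set (map ?F B)" "v \<in> set (map ?F B)"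
    then obtain a b where ab: "a \<in> set B" "b \<in> set B" "u = a [^] p" "v = b [^] p" by auto
    then have "a \<in> frob_field K N" "b \<in> frob_field K N" using Span_base_incl[OF K Bc] SB by auto
    then have "a \<otimes> b \<in> frob_field K N" using Fr(6) by simp
    then have "(a \<otimes> b) [^] p \<in> Span K (map ?F B)" by (rule pow)
    moreover have "(a \<otimes> b) [^] p = u \<otimes> v" unfolding ab(3,4) using ab(1,2) Bc by (intro frob1(2)) auto
    ultimately show "u \<otimes> v \<in> Span K (map ?F B)" by simp
  qed
  have "frob_field K (Suc N) \<subseteq> Span K (map ?F B)"
  proof (rule frob_field_least[OF sub Span_contains_base_field[OF K Fc one]])
    fix x assume x: "x \<in> carrier R"
    show "x [^] p ^ Suc N \<in> Span K (map ?F B)"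
      using pow[OF frob_field_props(3)[OF x]] x by (simp add: nat_pow_pow mult.commute)
  qed
  moreover have "Span K (map ?F B) \<subseteq> frob_field K N"
  proof (rule subalgebra_Span_incl[OF K subfield_is_subalgebra[OF frob_field_props(1,2)]])
    show "set (map ?F B) \<subseteq> frob_field K N"
      using Span_base_incl[OF K Bc] SB subring_nat_pow_closed[OF subfieldE(1)[OF frob_field_props(1)[of N]]] by auto
  qed
  ultimately have "Span K (map ?F B) = frob_field K N" using st by blast
  then have "independent K (map ?F B)"
    using spanning_list_independent[OF K Fc] d Vs(1) by (simp add: B_def)
  then have "independent K (map ?F Vs @ map ?F zs)" by (simp add: B_def)
  then show ?thesis by (rule independent_split(1)[OF K])
qed

section \<open>Minimal polynomials of elements of the stable field\<close>

lemma add_pow_eq_zero: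
  assumes "a \<in> carrier R" "[i] \<cdot> a = \<zero>" "\<not> p dvd i"
  shows "a = \<zero>"
proof -
  have "[p] \<cdot> a = \<zero>" using add_pow_char_multiple[OF p_one _ assms(1), of p] by simp
  then have "add.ord a dvd p" "add.ord a dvd i" using add.pow_eq_id[OF assms(1)] assms(2) by auto
  then have "add.ord a = 1" using p_prime assms(3) by (auto simp: prime_nat_iff)
  then have "[(1::nat)] \<cdot> a = \<zero>" using add.pow_eq_id[OF assms(1), of 1] by simp
  then show ?thesis using assms(1) by simp
qed

lemma eval_in_p_powers:
  assumes "x \<in> carrier R" "set f \<subseteq> K" "length f \<le> p * t" "\<And>i. i < length f \<Longrightarrow> \<not> p dvd i \<Longrightarrow> coeff f i = \<zero>"
  shows "eval f x \<in> Span K (exp_base (x [^] p) t)"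
  using assms(2-4)
proof (induction f)
  have c: "set (exp_base (x [^] p) t) \<subseteq> carrier R" using exp_base_closed assms(1) by simp
  note S = Span_subgroup_props[OF K c] Span_smult_closed[OF K c]
  {
    case Nil
    then show ?case using S(2) by simp
  next
    case (Cons a f)
    have cf: "coeff f i = \<zero>" if "i < length f" "\<not> p dvd i" for i
      using Cons.prems(3)[of i] that by simp
    have f: "eval f x \<in> Span K (exp_base (x [^] p) t)" using Cons cf by simp
    have a: "a \<in> K" using Cons.prems by simp
    have "a \<otimes> x [^] length f \<in> Span K (exp_base (x [^] p) t)"
    proof (cases "p dvd length f")
      case True
      then obtain s where s: "length f = p * s" by auto
      then have "s < t" using Cons.prems(2) p_pos by (metis Suc_le_lessD length_Cons mult_less_cancel1)
      then have "(x [^] p) [^] s \<in> Span K (exp_base (x [^] p) t)"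
        using Span_base_incl[OF K c] by (auto simp: exp_base_def)
      then show ?thesis using S(5)[OF a] assms(1) by (simp add: s nat_pow_pow)
    next
      case False
      then have "a = \<zero>" using Cons.prems(3)[of "length f"] by simp
      then show ?thesis using S(2) assms(1) by simp
    qed
    then show ?case using S(3) f by simp
  }
qed

text \<open>A vanishing derivative would make the minimal polynomial one in X^p, of degree m = p t,
  so that (x^p)^t is a combination of lower powers of x^p. But 1, x, ..., x^(m-1) are independent,
  hence so are their p-th powers, and t < m.\<close>

lemma poly_deriv_Irr_not_zero:
  assumes st: "frob_field K (Suc N) = frob_field K N" and x: "x \<in> frob_field K N"
  shows "poly_deriv (Irr K x) \<noteq> []"
proof
  assume pd: "poly_deriv (Irr K x) = []"
  have xc: "x \<in> carrier R" using x subfieldE(3)[OF frob_field_props(1)] by blast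
  define P where "P = Irr K x"
  define m where "m = degree P"
  note PI = IrrE[OF K xc algebraic_all[OF xc], folded P_def]
  have m1: "m \<ge> 1" unfolding m_def by (rule pirreducible_degree[OF K PI(1,2)])
  then obtain f where P: "P = \<one> # f" using PI(3) by (cases P) (auto simp: m_def)
  have lf: "length f = m" by (simp add: m_def P)
  have PK: "set P \<subseteq> K" using PI(1) univ_poly_carrier polynomial_incl by metis
  have Pc: "set P \<subseteq> carrier R" using PK subfieldE(3)[OF K] by auto
  define g where "g = map (\<lambda>i. [i] \<cdot> coeff P i) (rev [1..<length P])"
  have "normalize g = []" using pd by (simp add: poly_deriv_def P_def g_def)
  then have "g = replicate (length g) \<zero>" using normalize_trick[of g] by simp
  then have gz: "\<forall>y\<in>set g. y = \<zero>" by (metis in_set_replicate)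
  have cz: "coeff P i = \<zero>" if "i < length P" "\<not> p dvd i" for i
  proof -
    have "i \<ge> 1" using that(2) by (cases i) auto
    then have "[i] \<cdot> coeff P i \<in> set g" using that(1) by (auto simp: g_def)
    then have "[i] \<cdot> coeff P i = \<zero>" using gz by blast
    then show ?thesis using add_pow_eq_zero that(2) Pc by simp
  qed
  have "coeff P m = \<one>" using P lf by simp
  then have "p dvd m" using cz[of m] lf P by auto
  then obtain t where t: "m = p * t" by auto
  have tm: "t < m" using t m1 p_gt_1 n_less_m_mult_n[of t p] by (cases "t = 0") auto
  have cf: "coeff f i = \<zero>" if "i < length f" "\<not> p dvd i" for i
    using cz[of i] that P by simp
  have "eval f x \<in> Span K (exp_base (x [^] p) t)"
    by (rule eval_in_p_powers[OF xc]) (use PK P lf t cf in auto)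
  moreover have fc: "set f \<subseteq> carrier R" using Pc P by auto
  have "eval f x = \<ominus> (x [^] m)"
  proof -
    have "x [^] m \<oplus> eval f x = \<zero>" using PI(4) P lf xc by simp
    then show ?thesis using xc eval_in_carrier[OF fc xc]
      by (metis a_comm minus_equality nat_pow_closed)
  qed
  ultimately have "\<ominus> (x [^] m) \<in> Span K (exp_base (x [^] p) t)" by metis
  then have "\<ominus> (\<ominus> (x [^] m)) \<in> Span K (exp_base (x [^] p) t)"
    by (rule Span_subgroup_props(4)[OF K exp_base_closed[OF nat_pow_closed[OF xc]]])
  moreover have "\<ominus> (\<ominus> (x [^] m)) = (x [^] p) [^] t" using xc by (simp add: t nat_pow_pow)
  ultimately have mem: "(x [^] p) [^] t \<in> Span K (exp_base (x [^] p) t)" by metis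
  have ind: "independent K (map (\<lambda>x. x [^] p) (exp_base x m))"
  proof (rule independent_frob[OF st])
    show "independent K (exp_base x m)"
      unfolding m_def P_def by (rule exp_base_independent[OF K xc algebraic_all[OF xc]])
    show "set (exp_base x m) \<subseteq> frob_field K N"
      using subring_nat_pow_closed[OF subfieldE(1)[OF frob_field_props(1)] x] by (auto simp: exp_base_def)
  qed
  have "map (\<lambda>x. x [^] p) (exp_base x m) = exp_base (x [^] p) m"
    using xc by (simp add: exp_base_def nat_pow_pow mult.commute)
  also have "exp_base (x [^] p) m = map (\<lambda>i. (x [^] p) [^] i) (rev [Suc t..<Suc t + (m - Suc t)]) @ exp_base (x [^] p) (Suc t)"
    using exp_base_append[of "x [^] p" "Suc t" "m - Suc t"] tm by simp
  finally have "independent K (exp_base (x [^] p) (Suc t))"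
    using ind independent_split(1)[OF K] by simp
  moreover have "exp_base (x [^] p) (Suc t) = (x [^] p) [^] t # exp_base (x [^] p) t"
    by (simp add: exp_base_def)
  ultimately have "(x [^] p) [^] t \<notin> Span K (exp_base (x [^] p) t)"
    using independent_backwards(1) by metis
  then show False using mem by simp
qed

lemma degree_poly_deriv_Irr:
  assumes xc: "x \<in> carrier R"
  shows "poly_deriv (Irr K x) \<in> carrier (K[X])" "length (poly_deriv (Irr K x)) < length (Irr K x)"
proof -
  note PI = IrrE[OF K xc algebraic_all[OF xc]]
  have PK: "set (Irr K x) \<subseteq> K" using PI(1) univ_poly_carrier polynomial_incl by metis
  show "poly_deriv (Irr K x) \<in> carrier (K[X])" by (rule poly_deriv_in(1)[OF subfieldE(1)[OF K] PK])
  have "length (Irr K x) \<ge> 1" using pirreducible_degree[OF K PI(1,2)] by simp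
  then show "length (poly_deriv (Irr K x)) < length (Irr K x)"
    using poly_deriv_in(2)[OF subfieldE(1)[OF K] PK] by linarith
qed

lemma eval_poly_deriv_Irr_not_zero:
  assumes st: "frob_field K (Suc N) = frob_field K N" and x: "x \<in> frob_field K N"
  shows "eval (poly_deriv (Irr K x)) x \<noteq> \<zero>"
proof
  assume ev: "eval (poly_deriv (Irr K x)) x = \<zero>"
  have xc: "x \<in> carrier R" using x subfieldE(3)[OF frob_field_props(1)] by blast
  note PI = IrrE[OF K xc algebraic_all[OF xc]]
  note dg = degree_poly_deriv_Irr[OF xc]
  have "(Irr K x) pdivides (poly_deriv (Irr K x))"
    by (rule Irr_minimal[OF K xc algebraic_all[OF xc] dg(1) ev])
  then have "degree (Irr K x) \<le> degree (poly_deriv (Irr K x))"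
    by (rule pdivides_imp_degree_le[OF subfieldE(1)[OF K] PI(1) dg(1) poly_deriv_Irr_not_zero[OF st x]])
  moreover have "length (poly_deriv (Irr K x)) > 0" using poly_deriv_Irr_not_zero[OF st x] by simp
  ultimately show False using dg(2) by linarith
qed

text \<open>The chain is constant from \<open>n = 0\<close> on, so the derivative of the minimal
  polynomial is nonzero, and for degree reasons the irreducible polynomial does not divide it.
  Contrapositively, an inseparable extension has M \<noteq> L, that is s \<ge> 1.\<close>

lemma separable_elem_if_frob_surjective:
  assumes M: "frob_field K 1 = carrier R" and x: "x \<in> carrier R"
  shows "separable_elem K x"
proof -
  have st: "frob_field K (Suc 0) = frob_field K 0" using M frob_field_0 by simp
  have x0: "x \<in> frob_field K 0" using x frob_field_0 by simp
  note PI = IrrE[OF K x algebraic_all[OF x]]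
  note dg = degree_poly_deriv_Irr[OF x]
  let ?P = "Irr K x" and ?D = "poly_deriv (Irr K x)"
  have D0: "?D \<noteq> []" by (rule poly_deriv_Irr_not_zero[OF st x0])
  interpret UP: principal_domain "K[X]" using univ_poly_is_principal[OF K] .
  have "\<one>\<^bsub>K[X]\<^esub> gcdof\<^bsub>K[X]\<^esub> ?P ?D"
    unfolding isgcd_def
  proof (intro conjI ballI impI)
    show "\<one>\<^bsub>K[X]\<^esub> divides\<^bsub>K[X]\<^esub> ?P" using UP.one_divides PI(1) by blast
    show "\<one>\<^bsub>K[X]\<^esub> divides\<^bsub>K[X]\<^esub> ?D" using UP.one_divides dg(1) by blast
    fix y assume y: "y \<in> carrier (K[X])" and yd: "y divides\<^bsub>K[X]\<^esub> ?P \<and> y divides\<^bsub>K[X]\<^esub> ?D"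
    obtain g where g: "g \<in> carrier (K[X])" "?P = y \<otimes>\<^bsub>K[X]\<^esub> g" using yd by auto
    have "y \<in> Units (K[X])"
    proof (rule ccontr)
      assume "y \<notin> Units (K[X])"
      then have gu: "g \<in> Units (K[X])"
        using pirreducibleE(3)[OF subfieldE(1)[OF K] PI(1,2) y g(1,2)] by blast
      have "?P \<sim>\<^bsub>K[X]\<^esub> y"
        using UP.associatedI2'[OF g(2) gu y] by simp
      then have "length ?P = length y"
        using associated_polynomials_imp_same_length[OF subfieldE(1)[OF K] PI(1) y] by simp
      moreover have "degree y \<le> degree ?D"
        using pdivides_imp_degree_le[OF subfieldE(1)[OF K] y dg(1) D0] pdivides_iff_shell[OF K y dg(1)] yd by simp
      moreover have "length ?D > 0" using D0 by simp
      ultimately show False using dg(2) by linarith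
    qed
    then show "y divides\<^bsub>K[X]\<^esub> \<one>\<^bsub>K[X]\<^esub>" using UP.unit_divides[of y] by simp
  qed
  then show ?thesis using algebraic_all[OF x] by (simp add: separable_elem_def separable_poly_def)
qed

text \<open>Choose \<open>z\<close> in M so that t = (y + z)^(p^N) has the greatest degree over
  \<open>K\<close>. If K(t) did not contain the stable field, adding some c w^p to \<open>z\<close>
  would move t to t + u b with u = c^(p^N) and b outside K(t), and for a suitable c in
  \<open>K\<close> the degree would rise.\<close>

lemma exists_primitive_shift:
  assumes st: "frob_field K (Suc N) = frob_field K N" and inf: "infinite K" and y: "y \<in> carrier R"
  shows "\<exists>z\<in>frob_field K 1. frob_field K N \<subseteq> simple_extension K ((y \<oplus> z) [^] (p ^ N))"
proof -
  let ?M = "frob_field K 1" and ?q = "p ^ N"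
  note Mr = subringE[OF subfieldE(1)[OF frob_field_props(1)[of 1]]]
  define dg where "dg z = degree (Irr K ((y \<oplus> z) [^] ?q))" for z
  obtain d where d: "dimension d K (carrier R)" using fin by auto
  have cl: "(y \<oplus> z) [^] ?q \<in> carrier R" if "z \<in> ?M" for z using y that Mr(1) by auto
  have bound: "dg z < Suc d" if z: "z \<in> ?M" for z
  proof -
    have "independent K (exp_base ((y \<oplus> z) [^] ?q) (dg z))"
      unfolding dg_def by (rule exp_base_independent[OF K cl[OF z] algebraic_all[OF cl[OF z]]])
    moreover have "set (exp_base ((y \<oplus> z) [^] ?q) (dg z)) \<subseteq> carrier R" using exp_base_closed[OF cl[OF z]] .
    ultimately have "length (exp_base ((y \<oplus> z) [^] ?q) (dg z)) \<le> d"
      using independent_length_le_dimension[OF K d] by blast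
    then show ?thesis by (simp add: exp_base_def)
  qed
  obtain z where z: "z \<in> ?M" "\<And>z'. z' \<in> ?M \<Longrightarrow> dg z' \<le> dg z"
    using ex_has_greatest_nat[of "\<lambda>z. z \<in> ?M" \<zero> dg "Suc d"] Mr(2) bound by auto
  define t where "t = (y \<oplus> z) [^] ?q"
  have t: "t \<in> carrier R" "t \<in> frob_field K N"
    using cl[OF z(1)] frob_field_props(3)[of "y \<oplus> z" N] y z(1) Mr(1) by (auto simp: t_def)
  have "frob_field K N \<subseteq> simple_extension K t"
  proof (rule ccontr)
    assume not: "\<not> ?thesis"
    have E: "subfield (simple_extension K t) R" using simple_extension_is_subfield[OF K t(1)] algebraic_all[OF t(1)] by simp
    have KE: "K \<subseteq> simple_extension K t" using simple_extension_incl[OF subfieldE(3)[OF K] t(1)] .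
    \<comment> \<open>By stability the powers with exponent \<open>p ^ Suc N\<close> generate the
      stable field over \<open>K\<close> too. The missing element is then a \<open>?q\<close>-th
      power of w^p, and w^p lies in M, so it may be used to shift \<open>z\<close>.\<close>
    have "\<exists>w\<in>carrier R. w [^] (p ^ Suc N) \<notin> simple_extension K t"
      using frob_field_least[OF E KE, of "Suc N"] not st by auto
    then obtain w where w: "w \<in> carrier R" "w [^] (p ^ Suc N) \<notin> simple_extension K t" by auto
    define b where "b = (w [^] p) [^] ?q"
    have b: "b \<in> carrier R" "b \<notin> simple_extension K t"
      using w by (auto simp: b_def nat_pow_pow)
    have "finite {u \<in> K. degree (Irr K (t \<oplus> u \<otimes> b)) \<le> degree (Irr K t)}"
      by (rule degree_perturbation[OF K fin t(1) b eval_poly_deriv_Irr_not_zero[OF st t(2)]])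
    \<comment> \<open>Shifts by multiples of w^p produce only parameters \<open>u\<close> that are
      \<open>?q\<close>-th powers; injectivity of Frobenius leaves infinitely many of them.\<close>
    moreover have "infinite ((\<lambda>c. c [^] ?q) ` K)"
    proof
      assume "finite ((\<lambda>c. c [^] ?q) ` K)"
      moreover have "inj_on (\<lambda>c. c [^] ?q) K" using frob_inj subfieldE(3)[OF K] by (auto intro!: inj_onI)
      ultimately show False using inf finite_imageD by blast
    qed
    ultimately have "infinite ((\<lambda>c. c [^] ?q) ` K - {u \<in> K. degree (Irr K (t \<oplus> u \<otimes> b)) \<le> degree (Irr K t)})"
      by (rule Diff_infinite_finite)
    then obtain u where u: "u \<in> (\<lambda>c. c [^] ?q) ` K" "u \<notin> {u \<in> K. degree (Irr K (t \<oplus> u \<otimes> b)) \<le> degree (Irr K t)}"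
      using infinite_imp_nonempty by blast
    then obtain c where c: "c \<in> K" "u = c [^] ?q" by auto
    have "u \<in> K" unfolding c(2) using subring_nat_pow_closed[OF subfieldE(1)[OF K] c(1)] .
    then have big: "degree (Irr K (t \<oplus> u \<otimes> b)) > degree (Irr K t)" using u(2) by auto
    define z' where "z' = z \<oplus> c \<otimes> w [^] p"
    have cM: "c \<in> ?M" "w [^] p \<in> ?M" using c(1) frob_field_props(2)[of 1] frob_field_props(3)[OF w(1), of 1] by auto
    then have z': "z' \<in> ?M" using z(1) Mr(6,7) by (simp add: z'_def)
    have cc: "c \<in> carrier R" "z \<in> carrier R" using cM z(1) Mr(1) by auto
    have "y \<oplus> z' = (y \<oplus> z) \<oplus> c \<otimes> w [^] p" unfolding z'_def using y w(1) cc by (simp add: a_assoc)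
    then have "(y \<oplus> z') [^] ?q = t \<oplus> u \<otimes> b"
      using y w(1) cc by (simp add: frob_add frob_mult t_def b_def c(2))
    then have "dg z' > dg z" using big by (simp add: dg_def t_def)
    then show False using z(2)[OF z'] by simp
  qed
  then show ?thesis using z(1) by (auto simp: t_def)
qed

end

end

subsection \<open>Essential dimension\<close>

context field_prime_char
begin

text \<open>An inequality, since a root may already be present when its turn comes. For the
  descended field a lower bound from the compositum will give equality.\<close>

lemma generate_p_th_roots_dimension_le:
  assumes F: "subfield F R" and "set xs \<subseteq> carrier R" "\<And>x. x \<in> set xs \<Longrightarrow> x [^] p \<in> F"
  shows "\<exists>e \<le> p ^ length xs. dimension e F (generate_field R (F \<union> set xs))"
  using assms(2,3)
proof (induction xs)
  case Nil
  then show ?case using dimension_one[OF F] generate_field_self[OF F] by auto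
next
  case (Cons x xs)
  let ?E = "generate_field R (F \<union> set xs)"
  have c: "x \<in> carrier R" "set xs \<subseteq> carrier R" using Cons.prems by auto
  obtain e where e: "e \<le> p ^ length xs" "dimension e F ?E" using Cons by auto
  have Fc: "F \<union> set xs \<subseteq> carrier R" using c subfieldE(3)[OF F] by auto
  have E: "subfield ?E R" by (rule generate_field_is_subfield[OF Fc])
  have gen: "generate_field R (F \<union> set (x # xs)) = generate_field R (insert x ?E)"
    by (rule generate_field_insert[OF subfieldE(3)[OF F] c(2,1) refl])
  show ?case
  proof (cases "x \<in> ?E")
    case True
    then have "generate_field R (insert x ?E) = ?E" using generate_field_self[OF E] by (simp add: insert_absorb)
    moreover have "p ^ length xs \<le> p ^ length (x # xs)" using p_pos by simp
    ultimately show ?thesis using e gen le_trans by metis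
  next
    case False
    have "x [^] p \<in> ?E" using Cons.prems(2)[of x] by (auto intro: generate_field.incl)
    then have "dimension p ?E (generate_field R (insert x ?E))" by (rule dimension_p_th_root[OF E c(1) False])
    then have "dimension (e * p) F (generate_field R (insert x ?E))" by (rule telescopic_base[OF F E e(2)])
    moreover have "e * p \<le> p ^ length (x # xs)" using e(1) by (simp add: mult.commute)
    ultimately show ?thesis using gen by metis
  qed
qed

context
  fixes K assumes K: "subfield K R" and fin: "finite_dimension K (carrier R)"
begin

lemma frob_field_pow:
  assumes "z \<in> frob_field K m"
  shows "z [^] (p ^ n) \<in> frob_field K (m + n)"
proof (induction n)
  case 0
  have "z \<in> carrier R" using assms subfieldE(3)[OF frob_field_props(1)[OF K fin]] by auto
  then show ?case using assms by simp
next
  case (Suc n)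
  have "z \<in> carrier R" using assms subfieldE(3)[OF frob_field_props(1)[OF K fin]] by auto
  then have "z [^] (p ^ Suc n) = (z [^] (p ^ n)) [^] p" by (simp add: nat_pow_pow mult.commute)
  then show ?case using frob_field_Suc_pow[OF K fin Suc] by simp
qed

text \<open>Shifting one generator by an element of M preserves generation over M, and a suitable
  shift puts the stable field inside the field generated over \<open>K\<close> by the p-th powers.
  From there the inclusion climbs the chain up to M.\<close>

lemma exists_p_basis_with_generating_powers:
  assumes inf: "infinite K" and ys: "ys \<noteq> []" "set ys \<subseteq> carrier R"
    and gen: "generate_field R (frob_field K 1 \<union> set ys) = carrier R"
  shows "\<exists>ys'. length ys' = length ys \<and> set ys' \<subseteq> carrier R \<and>
    generate_field R (frob_field K 1 \<union> set ys') = carrier R \<and>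
    generate_field R (K \<union> (\<lambda>y. y [^] p) ` set ys') = frob_field K 1"
proof -
  let ?M = "frob_field K 1"
  note FP = frob_field_props[OF K fin]
  have Mc: "?M \<subseteq> carrier R" using subfieldE(3)[OF FP(1)] .
  obtain y ys0 where y: "ys = y # ys0" using ys(1) by (cases ys) auto
  have yc: "y \<in> carrier R" "set ys0 \<subseteq> carrier R" using ys y by auto
  obtain N0 where N0: "frob_field K (Suc N0) = frob_field K N0" using frob_field_stable[OF K fin] by blast
  \<comment> \<open>Taking a successor ensures \<open>N \<ge> 1\<close>, so that (y + z)^(p^N) is a
    power of the p-th power of the new generator.\<close>
  define N where "N = Suc N0"
  have st: "frob_field K (Suc N) = frob_field K N" unfolding N_def by (rule frob_field_stable_Suc[OF K fin N0])
  obtain z where z: "z \<in> ?M" "frob_field K N \<subseteq> simple_extension K ((y \<oplus> z) [^] (p ^ N))"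
    using exists_primitive_shift[OF K fin st inf yc(1)] by blast
  have zc: "z \<in> carrier R" using z(1) Mc by auto
  define ys' where "ys' = (y \<oplus> z) # ys0"
  have ys'c: "set ys' \<subseteq> carrier R" using yc zc by (simp add: ys'_def)
  let ?L = "generate_field R (?M \<union> set ys')"
  have Lc: "?M \<union> set ys' \<subseteq> carrier R" using Mc ys'c by auto
  have Ls: "subfield ?L R" by (rule generate_field_is_subfield[OF Lc])
  note Lr = subringE[OF subfieldE(1)[OF Ls]]
  have "y \<oplus> z \<in> ?L" "\<ominus> z \<in> ?L" using z(1) Lr(5) by (auto simp: ys'_def intro: generate_field.incl)
  then have "(y \<oplus> z) \<oplus> \<ominus> z \<in> ?L" using Lr(7) by blast
  then have "y \<in> ?L" using yc zc by (simp add: a_assoc r_neg)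
  then have "?M \<union> set ys \<subseteq> ?L" unfolding y by (auto simp: ys'_def intro: generate_field.incl)
  then have "carrier R \<subseteq> ?L" using generate_field_min_subfield1[OF _ Ls] Mc ys(2) gen by (metis Un_least)
  then have genL: "?L = carrier R" using generate_field_incl[OF Lc] by blast
  let ?G = "generate_field R (K \<union> (\<lambda>y. y [^] p) ` set ys')"
  have Gc: "K \<union> (\<lambda>y. y [^] p) ` set ys' \<subseteq> carrier R" using ys'c subfieldE(3)[OF K] by auto
  have Gs: "subfield ?G R" by (rule generate_field_is_subfield[OF Gc])
  have KG: "K \<subseteq> ?G" by (auto intro: generate_field.incl)
  have hG: "h [^] (p ^ n) \<in> ?G" if h: "h \<in> set ys'" and n: "n \<ge> 1" for h n
  proof -
    obtain m where m: "n = Suc m" using n by (cases n) auto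
    have "h [^] p \<in> ?G" using h by (auto intro: generate_field.incl)
    then have "(h [^] p) [^] (p ^ m) \<in> ?G" by (rule subring_nat_pow_closed[OF subfieldE(1)[OF Gs]])
    moreover have "h \<in> carrier R" using h ys'c by auto
    ultimately show ?thesis by (simp add: m nat_pow_pow)
  qed
  have N1: "1 \<le> N" by (simp add: N_def)
  \<comment> \<open>Induction from \<open>N\<close> down to 1. L is generated by M and
    \<open>ys'\<close>; the p^n-th powers of M lie in K(L^(p^(n+1))), and those of
    \<open>ys'\<close> are powers of p-th powers. So K(L^(p^n)) lies in \<open>?G\<close> as soon as
    K(L^(p^(n+1))) does.\<close>
  have "?M \<subseteq> ?G" using N1
  proof (induction rule: inc_induct)
    case base
    have "(y \<oplus> z) [^] (p ^ N) \<in> ?G" using hG[OF _ N1] by (simp add: ys'_def)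
    then show ?case using z(2) simple_extension_subring_incl[OF subfieldE(1)[OF Gs] KG] by blast
  next
    case (step n)
    show ?case
    proof (rule frob_field_least[OF K fin Gs KG])
      fix x assume "x \<in> carrier R"
      then have x: "x \<in> ?L" using genL by simp
      show "x [^] p ^ n \<in> ?G"
      proof (rule generate_field_frob[OF Lc Gs _ x])
        fix h assume "h \<in> ?M \<union> set ys'"
        then show "h [^] p ^ n \<in> ?G"
          using frob_field_pow[of h 1 n] step hG[of h n] by auto
      qed
    qed
  qed
  moreover have "?G \<subseteq> ?M"
  proof (rule generate_field_min_subfield1[OF Gc FP(1)])
    show "K \<union> (\<lambda>y. y [^] p) ` set ys' \<subseteq> ?M" using FP(2)[of 1] FP(3)[of _ 1] ys'c by auto
  qed
  ultimately show ?thesis using genL ys'c y by (intro exI[of _ ys']) (auto simp: ys'_def)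
qed

text \<open>A \<open>K0\<close>-basis of \<open>L0\<close> spans over \<open>K\<close> a field that
  contains \<open>L0\<close> and \<open>K\<close>, hence all of L. Generation thus yields one half
  of the degree equality in \<open>descends_to\<close>.\<close>

lemma dimension_le_of_compositum:
  assumes K0: "subfield K0 R" "K0 \<subseteq> K" and L0: "subfield L0 R" "K0 \<subseteq> L0"
    and gen: "generate_field R (L0 \<union> K) = carrier R"
    and d: "dimension d K (carrier R)" and e: "dimension e K0 L0"
  shows "d \<le> e"
proof -
  obtain Us where Us: "set Us \<subseteq> carrier R" "length Us = e" "Span K0 Us = L0"
    using exists_base[OF K0(1) e] by blast
  have sub: "L0 \<subseteq> Span K Us" using Span_mono_field[OF K0(1) K K0(2) Us(1)] Us(3) by simp
  note Lr = subringE[OF subfieldE(1)[OF L0(1)]]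
  have one: "\<one> \<in> Span K Us" using sub Lr(3) by auto
  have f: "subfield (Span K Us) R"
  proof (rule Span_is_subfield[OF K Us(1) one])
    fix u v assume "u \<in> set Us" "v \<in> set Us"
    then have "u \<in> L0" "v \<in> L0" using Span_base_incl[OF K0(1) Us(1)] Us(3) by auto
    then show "u \<otimes> v \<in> Span K Us" using Lr(6) sub by blast
  qed
  have "carrier R \<subseteq> Span K Us"
    unfolding gen[symmetric]
  proof (rule generate_field_min_subfield1[OF _ f])
    show "L0 \<union> K \<subseteq> carrier R" using subfieldE(3)[OF L0(1)] subfieldE(3)[OF K] by auto
    show "L0 \<union> K \<subseteq> Span K Us" using sub Span_contains_base_field[OF K Us(1) one] by auto
  qed
  then have "Span K Us = carrier R" using Span_in_carrier[OF subfieldE(3)[OF K] Us(1)] by auto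
  then show ?thesis using Span_dimension_le[OF K Us(1)] dimension_is_inj[OF K d] Us(2) by auto
qed

text \<open>The tower \<open>K0\<close>, \<open>M0\<close>, \<open>L0\<close> copies K, M, L:
  \<open>M0\<close> is spanned over \<open>K0\<close> by the list that spans M over
  \<open>K\<close>, and \<open>L0\<close> arises by adjoining the same p-th roots. Its degree is at
  most \<open>d * p ^ length ys\<close>, and the compositum forces equality.\<close>

theorem ess_dim_p_basis_le:
  assumes k: "subfield k R" "k \<subseteq> K" and inf: "infinite K" and ys: "ys \<noteq> []" "set ys \<subseteq> carrier R"
    and gen: "generate_field R (frob_field K 1 \<union> set ys) = carrier R"
    and dM: "dimension (p ^ length ys) (frob_field K 1) (carrier R)" and d: "dimension d K (frob_field K 1)"
  shows "ess_dim k K \<le> enat (length ys * d)"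
proof -
  let ?M = "frob_field K 1"
  note FP = frob_field_props[OF K fin]
  obtain ys' where ys': "length ys' = length ys" "set ys' \<subseteq> carrier R"
    "generate_field R (?M \<union> set ys') = carrier R" "generate_field R (K \<union> (\<lambda>y. y [^] p) ` set ys') = ?M"
    using exists_p_basis_with_generating_powers[OF inf ys gen] by (elim exE conjE)
  define bs where "bs = map (\<lambda>y. y [^] p) ys'"
  have bsc: "set bs \<subseteq> carrier R" and sbs: "set bs = (\<lambda>y. y [^] p) ` set ys'" using ys'(2) by (auto simp: bs_def)
  obtain C Bs where CB: "finite C" "C \<subseteq> K" "card C \<le> length bs * length Bs" "set Bs \<subseteq> carrier R"
    "Span K Bs = generate_field R (K \<union> set bs)" "dimension (length Bs) K (Span K Bs)"
    and desc: "\<forall>K0. subfield K0 R \<and> C \<subseteq> K0 \<and> K0 \<subseteq> K \<longrightarrow>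
       subfield (Span K0 Bs) R \<and> K0 \<subseteq> Span K0 Bs \<and> set bs \<subseteq> Span K0 Bs"
    using finitely_generated_field_descent[OF K fin bsc] by (elim exE conjE) (rule that; assumption)
  have "Span K Bs = ?M" using CB(5) ys'(4) sbs by simp
  then have lBs: "length Bs = d" using dimension_is_inj[OF K _ d] CB(6) by simp
  define K0 where "K0 = generate_field R (k \<union> C)"
  have kc: "k \<union> C \<subseteq> carrier R" using subfieldE(3)[OF k(1)] CB(2) subfieldE(3)[OF K] by auto
  have K0: "subfield K0 R" "k \<subseteq> K0" "C \<subseteq> K0" "K0 \<subseteq> K"
    using generate_field_is_subfield[OF kc] generate_field_min_subfield1[OF kc K] k(2) CB(2)
    by (auto simp: K0_def intro: generate_field.incl)
  define M0 where "M0 = Span K0 Bs"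
  have M0: "subfield M0 R" "K0 \<subseteq> M0" "set bs \<subseteq> M0" using desc K0 by (auto simp: M0_def)
  define L0 where "L0 = generate_field R (M0 \<union> set ys')"
  have L0c: "M0 \<union> set ys' \<subseteq> carrier R" using subfieldE(3)[OF M0(1)] ys'(2) by auto
  have L0: "subfield L0 R" "M0 \<subseteq> L0" "set ys' \<subseteq> L0"
    using generate_field_is_subfield[OF L0c] by (auto simp: L0_def intro: generate_field.incl)
  have genK: "generate_field R (L0 \<union> K) = carrier R"
  proof -
    let ?G = "generate_field R (L0 \<union> K)"
    have c: "L0 \<union> K \<subseteq> carrier R" using subfieldE(3)[OF L0(1)] subfieldE(3)[OF K] by auto
    have G: "subfield ?G R" by (rule generate_field_is_subfield[OF c])
    have LG: "L0 \<subseteq> ?G" "K \<subseteq> ?G" by (auto intro: generate_field.incl)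
    have "?M \<subseteq> ?G"
      unfolding ys'(4)[symmetric] sbs[symmetric]
      using M0(3) L0(2) LG bsc subfieldE(3)[OF K] by (intro generate_field_min_subfield1[OF _ G]) auto
    then have "carrier R \<subseteq> ?G"
      unfolding ys'(3)[symmetric]
      using L0(3) LG ys'(2) subfieldE(3)[OF FP(1)] by (intro generate_field_min_subfield1[OF _ G]) auto
    then show ?thesis using generate_field_incl[OF c] by auto
  qed
  have dL: "dimension (d * p ^ length ys) K (carrier R)" by (rule telescopic_base[OF K FP(1) d dM])
  obtain e0 where e0: "e0 \<le> length Bs" "dimension e0 K0 M0"
    using Span_dimension_le[OF K0(1) CB(4)] by (auto simp: M0_def)
  have "x [^] p \<in> M0" if "x \<in> set ys'" for x using that M0(3) sbs by auto
  then obtain e1 where e1: "e1 \<le> p ^ length ys'" "dimension e1 M0 L0"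
    using generate_p_th_roots_dimension_le[OF M0(1) ys'(2)] by (auto simp: L0_def)
  have e: "dimension (e0 * e1) K0 L0" by (rule telescopic_base[OF K0(1) M0(1) e0(2) e1(2)])
  have "d * p ^ length ys \<le> e0 * e1"
    by (rule dimension_le_of_compositum[OF K0(1,4) L0(1) _ genK dL e]) (use M0(2) L0(2) in auto)
  moreover have "e0 * e1 \<le> d * p ^ length ys" using e0(1) e1(1) lBs ys'(1) by (simp add: mult_le_mono)
  ultimately have "dimension (d * p ^ length ys) K0 L0" using e by simp
  then have "descends_to K K0"
    unfolding descends_to_def using L0(1) M0(2) L0(2) genK dL by blast
  then have "ess_dim k K \<le> trdeg k K0"
    unfolding ess_dim_def using K0 by (intro Inf_lower) blast
  also have "\<dots> \<le> enat (card C)"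
    unfolding K0_def using CB(1,2) subfieldE(3)[OF K] by (intro trdeg_generate_field_le[OF k(1)]) auto
  also have "\<dots> \<le> enat (length ys * d)" using CB(3) lBs ys'(1) by (simp add: bs_def)
  finally show ?thesis .
qed

text \<open>L is finite as well, so the injective Frobenius is onto. Contrapositively, M \<noteq> L
  supplies the infinite \<open>K\<close> that the shift requires.\<close>

lemma finite_base_frob_surjective:
  assumes "finite K"
  shows "frob_field K 1 = carrier R"
proof -
  obtain n where n: "dimension n K (carrier R)" using fin by auto
  obtain Us where Us: "set Us \<subseteq> carrier R" "Span K Us = carrier R" using exists_base[OF K n] by blast
  have "finite (Span K us)" for us
  proof (induction us)
    case (Cons u us)
    have "Span K (u # us) \<subseteq> (\<lambda>(k, v). k \<otimes> u \<oplus> v) ` (K \<times> Span K us)"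
      by (auto simp: line_extension_mem_iff)
    then show ?case using Cons assms finite_subset by blast
  qed simp
  then have f: "finite (carrier R)" using Us(2) by metis
  have "(\<lambda>x. x [^] p) ` carrier R = carrier R"
    by (rule endo_inj_surj[OF f]) (use frob_inj[of _ _ 1] in \<open>auto intro!: inj_onI\<close>)
  then have "carrier R \<subseteq> frob_field K 1"
    using frob_field_props(3)[OF K fin, of _ 1] by force
  then show ?thesis using subfieldE(3)[OF frob_field_props(1)[OF K fin]] by blast
qed

theorem ess_dim_bound:
  assumes k: "subfield k R" "k \<subseteq> K" and M: "frob_field K 1 \<noteq> carrier R"
  obtains s d where "s \<ge> 1" "dimension (d * p ^ s) K (carrier R)" "ess_dim k K \<le> enat (s * d)"
    "\<And>xs. p_independent_seq (frob_field K 1) xs \<Longrightarrow> length xs \<le> s"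
proof -
  let ?M = "frob_field K 1"
  note FP = frob_field_props[OF K fin]
  have xp: "x [^] p \<in> ?M" if "x \<in> carrier R" for x using FP(3)[OF that, of 1] by simp
  have finM: "finite_dimension ?M (carrier R)"
    by (rule finite_dimension_superfield[OF K FP(1,2) fin])
  obtain ys where ys: "set ys \<subseteq> carrier R" "generate_field R (?M \<union> set ys) = carrier R"
    "dimension (p ^ length ys) ?M (carrier R)"
    using exists_p_basis[OF FP(1) xp finM] by blast
  have ne: "ys \<noteq> []" using ys(2) generate_field_self[OF FP(1)] M by auto
  have inf: "infinite K" using finite_base_frob_surjective M by blast
  obtain d where d: "dimension d K ?M" using dimension_subfield[OF K fin FP(1,2)] by blast
  show thesis
  proof (rule that)
    show "length ys \<ge> 1" using ne by (simp add: Suc_le_eq)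
    show "dimension (d * p ^ length ys) K (carrier R)" by (rule telescopic_base[OF K FP(1) d ys(3)])
    show "ess_dim k K \<le> enat (length ys * d)"
      by (rule ess_dim_p_basis_le[OF k inf ne ys d])
    fix xs assume xs: "p_independent_seq ?M xs"
    have "p ^ length xs \<le> p ^ length ys"
      by (rule p_independent_seq_length_le[OF FP(1) _ xs ys(3)]) (rule xp)
    then show "length xs \<le> length ys" using p_gt_1 by simp
  qed
qed

end

end

section \<open>Characteristic, normal generating sequences and the final estimate\<close>

lemma (in field) subfield_characteristic:
  assumes k: "subfield k R" and ch: "ring.characteristic (R\<lparr>carrier := k\<rparr>) = p" and p: "p > 0"
  shows "field_prime_char R p" "characteristic = p"
proof -
  let ?k = "R\<lparr>carrier := k\<rparr>"
  interpret k: ring ?k using subring_is_ring[OF subfieldE(1)[OF k]] .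
  have "[n] \<cdot>\<^bsub>?k\<^esub> \<one>\<^bsub>?k\<^esub> = [n] \<cdot> \<one>" for n :: nat
    by (induction n) auto
  then have dvd: "[n] \<cdot> \<one> = \<zero> \<longleftrightarrow> p dvd n" for n :: nat
    using k.add.pow_eq_id[OF k.one_closed, of n] ch by (simp add: k.characteristic_def)
  have "p \<noteq> 1" using dvd[of 1] by auto
  have "Factorial_Ring.prime p"
    unfolding prime_nat_iff
  proof (intro conjI allI impI)
    show "1 < p" using p \<open>p \<noteq> 1\<close> by simp
    fix m assume "m dvd p"
    then obtain n where n: "p = m * n" by auto
    have "([m] \<cdot> \<one>) \<otimes> ([n] \<cdot> \<one>) = [m] \<cdot> ([n] \<cdot> \<one>)" by (simp add: add_pow_ldistr)
    also have "\<dots> = [p] \<cdot> \<one>" by (simp add: n add.nat_pow_pow mult.commute)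
    also have "\<dots> = \<zero>" using dvd by simp
    finally have "[m] \<cdot> \<one> = \<zero> \<or> [n] \<cdot> \<one> = \<zero>" using integral by simp
    then have "p dvd m \<or> p dvd n" using dvd by simp
    then show "m = 1 \<or> m = p"
    proof
      assume "p dvd m" then show ?thesis using \<open>m dvd p\<close> dvd_antisym by blast
    next
      assume "p dvd n"
      moreover have "n dvd p" unfolding n by (rule dvd_triv_right)
      ultimately have "n = p" by (rule dvd_antisym[symmetric])
      have "m * n = 1 * n" using trans[OF n[symmetric] \<open>n = p\<close>[symmetric]] by (simp only: mult_1)
      then have "m = 1 \<or> n = 0" by (simp only: mult_cancel2)
      then show ?thesis using p \<open>n = p\<close> by blast
    qed
  qed
  then show "field_prime_char R p"
    using dvd[of p] field_axioms by (simp add: field_prime_char_def field_prime_char_axioms_def)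
  have iff: "characteristic dvd n \<longleftrightarrow> p dvd n" for n
    using add.pow_eq_id[OF one_closed, of n] dvd[of n] by (simp add: characteristic_def)
  show "characteristic = p"
    by (rule dvd_antisym) (use iff[of p] iff[of characteristic] in simp_all)
qed

text \<open>Let A be generated by \<open>S\<close> and the earlier terms, and let e be the exponent
  of x_i over A, positive because x_i is not in A. Normality puts all p^e-th powers into A, so the
  elements whose p^(e-1)-th power lies in A form a field containing \<open>K\<close>, all p-th
  powers and the earlier terms, but not x_i.\<close>

lemma (in field_prime_char) normal_generating_seq_p_independent:
  assumes K: "subfield K R" and fin: "finite_dimension K (carrier R)"
    and ch: "characteristic = p" and S: "S \<subseteq> carrier R" "dimension n K S"
    and pis: "purely_inseparable S" and xs: "set xs \<subseteq> carrier R" "normal_generating_seq S xs"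
  shows "p_independent_seq (frob_field K 1) xs"
  unfolding p_independent_seq_def
proof (intro conjI allI impI)
  fix i assume i: "i < length xs"
  let ?A = "adjoin S (take i xs)" and ?x = "xs ! i"
  have tc: "set (take i xs) \<subseteq> carrier R" using xs(1) set_take_subset[of i xs] by auto
  have c: "S \<union> set (take i xs) \<subseteq> carrier R" using S tc by auto
  have A: "subfield ?A R" unfolding adjoin_def by (rule generate_field_is_subfield[OF c])
  have SA: "S \<union> set (take i xs) \<subseteq> ?A" unfolding adjoin_def by (auto intro: generate_field.incl)
  \<comment> \<open>\<open>S\<close> enters as a \<open>K\<close>-space; pure inseparability at the
    element one gives \<open>\<one> \<in> S\<close>, and hence
    \<open>K \<subseteq> S\<close>.\<close>
  have "\<exists>e::nat. \<one> [^] (characteristic ^ e) \<in> S" using pis one_closed unfolding purely_inseparable_def by blast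
  then have "\<one> \<in> S" by simp
  then have "K \<subseteq> S" using space_subgroup_props(5)[OF K S(2)] subfieldE(3)[OF K] by fastforce
  then have KA: "K \<subseteq> ?A" using SA by auto
  have x: "?x \<in> carrier R" "?x \<notin> ?A" "normal_elem ?A ?x"
    using xs i by (auto simp: normal_generating_seq_def)
  define e where "e = insep_exponent ?x ?A"
  have le: "insep_exponent y ?A \<le> e" if "y \<in> carrier R" for y
    using x(3) that by (simp add: normal_elem_def e_def)
  have pow: "y [^] (p ^ e) \<in> ?A" if y: "y \<in> carrier R" for y
  proof -
    let ?f = "insep_exponent y ?A"
    \<comment> \<open>Some power lies in \<open>S\<close>, so the least exponent \<open>?f\<close>
      is attained; raising further reaches the common exponent \<open>e\<close>.\<close>
    obtain f :: nat where "y [^] (p ^ f) \<in> S" using pis ch y unfolding purely_inseparable_def by auto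
    then have "y [^] (characteristic ^ f) \<in> ?A" using SA ch by auto
    then have "y [^] (characteristic ^ ?f) \<in> ?A" unfolding insep_exponent_def by (rule LeastI)
    then have "(y [^] (p ^ ?f)) [^] (p ^ (e - ?f)) \<in> ?A"
      unfolding ch by (rule subring_nat_pow_closed[OF subfieldE(1)[OF A]])
    moreover have "p ^ ?f * p ^ (e - ?f) = p ^ e" using le[OF y] by (simp add: power_add[symmetric])
    ultimately show ?thesis using y by (simp add: nat_pow_pow)
  qed
  have "e \<noteq> 0"
  proof
    assume "e = 0"
    then show False using pow[OF x(1)] x(1,2) by simp
  qed
  then obtain f where f: "e = Suc f" by (cases e) auto
  have nx: "?x [^] (p ^ f) \<notin> ?A"
    using not_less_Least[of f "\<lambda>e. ?x [^] (characteristic ^ e) \<in> ?A"] f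
    by (auto simp: e_def insep_exponent_def ch)
  let ?G = "{x \<in> carrier R. x [^] (p ^ f) \<in> ?A}"
  have G: "subfield ?G R" by (rule frob_preimage_subfield[OF A])
  have "K \<subseteq> ?G" using KA subfieldE(3)[OF K] subring_nat_pow_closed[OF subfieldE(1)[OF A]] by auto
  moreover have "y [^] p ^ 1 \<in> ?G" if y: "y \<in> carrier R" for y
    using pow[OF y] y by (simp add: nat_pow_pow f)
  ultimately have "frob_field K 1 \<subseteq> ?G" by (rule frob_field_least[OF K fin G])
  moreover have "set (take i xs) \<subseteq> ?G"
    using SA tc subring_nat_pow_closed[OF subfieldE(1)[OF A]] by auto
  ultimately have "generate_field R (frob_field K 1 \<union> set (take i xs)) \<subseteq> ?G"
    using tc subfieldE(3)[OF frob_field_props(1)[OF K fin]] by (intro generate_field_min_subfield1[OF _ G]) auto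
  then show "?x \<notin> generate_field R (frob_field K 1 \<union> set (take i xs))" using nx by auto
qed (use xs in auto)

text \<open>Passing from n to n + 1 multiplies the quotient by (n+1)/(p n), which is at most 1 for n
  \<ge> 1 and p \<ge> 2. Starting at 1 matters, as the quotient vanishes at 0.\<close>

lemma div_power_antimono:
  assumes "(p::nat) \<ge> 2" "1 \<le> r" "r \<le> s"
  shows "real s / real p ^ s \<le> real r / real p ^ r"
  using assms(3)
proof (induction s rule: dec_induct)
  case base
  show ?case by simp
next
  case (step n)
  have "n \<ge> 1" using step.hyps assms(2) by simp
  then have "real (Suc n) \<le> 2 * real n" by simp
  also have "\<dots> \<le> real p * real n" using assms(1) by (intro mult_right_mono) auto
  finally have "real (Suc n) / real p ^ Suc n \<le> (real p * real n) / real p ^ Suc n"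
    by (rule divide_right_mono) simp
  also have "\<dots> = real n / real p ^ n" using assms(1) by simp
  finally show ?case using step.IH by linarith
qed

theorem mainTheorem5:
  fixes L :: "('a, 'b) ring_scheme" (structure)
    and k K :: "'a set" and p :: nat
  assumes "field L"
    and "subfield k L" and "subfield K L" and "k \<subseteq> K"
    and "ring.characteristic (L\<lparr>carrier := k\<rparr>) = p" and "p > 0"
  shows
    "(\<forall>n es r. ring.of_type L K n es \<and> n \<ge> 1 \<and> r = length es \<and> r \<ge> 1 \<and>
        sorted_wrt (\<ge>) es \<and> (\<forall>e \<in> set es. e \<ge> 1) \<longrightarrow>
        ereal_of_enat (ring.ess_dim L k K) / ereal (real (ring.dim L K (carrier L)))
          \<le> ereal (real r / real p ^ r) \<and>
        real r / real p ^ r \<le> 1 / real p)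
     \<and>
     (ring.finite_dimension L K (carrier L) \<and> ring.inseparable L K \<longrightarrow>
        ereal_of_enat (ring.ess_dim L k K)
          \<le> ereal (1 / 2 * real (ring.dim L K (carrier L))))"
proof -
  interpret field L by fact
  interpret field_prime_char L p by (rule subfield_characteristic(1)[OF assms(2,5,6)])
  have ch: "characteristic = p" by (rule subfield_characteristic(2)[OF assms(2,5,6)])
  note K = assms(3)
  have p2: "p \<ge> 2" using p_gt_1 by simp
  have bound: "\<exists>s d. s \<ge> 1 \<and> d \<ge> 1 \<and> dim K (carrier L) = d * p ^ s \<and>
       ereal_of_enat (ess_dim k K) \<le> ereal (real (s * d)) \<and>
       (\<forall>xs. p_independent_seq (frob_field K 1) xs \<longrightarrow> length xs \<le> s)"
    if fin: "finite_dimension K (carrier L)" and M: "frob_field K 1 \<noteq> carrier L"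
  proof -
    obtain s d where s: "s \<ge> 1" and d: "dimension (d * p ^ s) K (carrier L)" and e: "ess_dim k K \<le> enat (s * d)"
      and xs: "\<And>xs. p_independent_seq (frob_field K 1) xs \<Longrightarrow> length xs \<le> s"
      using ess_dim_bound[OF K fin assms(2,4) M] by blast
    \<comment> \<open>\<open>d\<close> is cancelled in the quotient by [L:K]; the value 0 would make
      the field trivial.\<close>
    have "d \<noteq> 0"
    proof
      assume "d = 0"
      then have "carrier L = {\<zero>}" using dimension_zero[OF K] d by simp
      then show False using one_closed by auto
    qed
    moreover have "dim K (carrier L) = d * p ^ s" using dimI[OF K d] by (simp add: over_def)
    moreover have "ereal_of_enat (ess_dim k K) \<le> ereal_of_enat (enat (s * d))"
      using e by (simp only: ereal_of_enat_le_iff)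
    ultimately show ?thesis using s xs by (intro exI[of _ s] exI[of _ d]) auto
  qed
  have quot: "ereal (real (s * d)) / ereal (real (d * p ^ s)) = ereal (real s / real p ^ s)" if "d \<ge> 1" for s d
    using that p_pos by (simp add: field_simps)
  show ?thesis
  proof (intro conjI allI impI)
    fix n es r
    assume A: "of_type K n es \<and> n \<ge> 1 \<and> r = length es \<and> r \<ge> 1 \<and> sorted_wrt (\<ge>) es \<and> (\<forall>e \<in> set es. e \<ge> 1)"
    show "real r / real p ^ r \<le> 1 / real p" using div_power_antimono[OF p2, of 1 r] A by simp
    let ?S = "separable_closure K"
    have fin: "finite_dimension K (carrier L)" and S: "dimension n K ?S" and pi: "purely_insep_of_type ?S es"
      using A by (auto simp: of_type_def)
    obtain xs where xs: "set xs \<subseteq> carrier L" "normal_generating_seq ?S xs" "seq_type ?S xs = es"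
      and pis: "purely_inseparable ?S" using pi by (auto simp: purely_insep_of_type_def)
    have ind: "p_independent_seq (frob_field K 1) xs"
      by (rule normal_generating_seq_p_independent[OF K fin ch _ S pis xs(1,2)]) (auto simp: separable_closure_def)
    have r: "length xs = r" "r \<ge> 1" using A xs(3) by (auto simp: seq_type_def)
    \<comment> \<open>The first term of the sequence, present because r \<ge> 1, lies outside
      M.\<close>
    have "frob_field K 1 \<noteq> carrier L"
    proof
      assume M: "frob_field K 1 = carrier L"
      have "xs ! 0 \<notin> generate_field L (frob_field K 1 \<union> set (take 0 xs))"
        using ind r unfolding p_independent_seq_def by (metis Suc_le_eq One_nat_def)
      then show False using generate_field_self[OF carrier_is_subfield] M xs(1) r by (auto simp: subset_iff)
    qed
    from bound[OF fin this] obtain s d where sd: "d \<ge> 1" "dim K (carrier L) = d * p ^ s"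
       "ereal_of_enat (ess_dim k K) \<le> ereal (real (s * d))" "length xs \<le> s" using ind by blast
    have "ereal_of_enat (ess_dim k K) / ereal (real (dim K (carrier L))) \<le> ereal (real (s * d)) / ereal (real (d * p ^ s))"
      unfolding sd(2) by (rule ereal_divide_right_mono[OF sd(3)]) (use sd(1) p_pos in simp)
    also have "\<dots> = ereal (real s / real p ^ s)" by (rule quot[OF sd(1)])
    also have "\<dots> \<le> ereal (real r / real p ^ r)" using div_power_antimono[OF p2, of r s] r sd(4) by simp
    finally show "ereal_of_enat (ess_dim k K) / ereal (real (dim K (carrier L))) \<le> ereal (real r / real p ^ r)" .
  next
    assume A: "finite_dimension K (carrier L) \<and> inseparable K"
    then have fin: "finite_dimension K (carrier L)" by simp
    have "frob_field K 1 \<noteq> carrier L"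
      using separable_elem_if_frob_surjective[OF K fin] A by (auto simp: inseparable_def)
    from bound[OF fin this] obtain s d where sd: "s \<ge> 1" "d \<ge> 1" "dim K (carrier L) = d * p ^ s"
       "ereal_of_enat (ess_dim k K) \<le> ereal (real (s * d))" by blast
    \<comment> \<open>The half bound is read off from s \<ge> 1 directly, independently of the
      type.\<close>
    have "real s / real p ^ s \<le> 1 / real p" using div_power_antimono[OF p2, of 1 s] sd(1) by simp
    also have "\<dots> \<le> 1 / 2" using p2 by (simp add: field_simps)
    finally have "real s \<le> 1 / 2 * real p ^ s" using p_pos by (simp add: field_simps)
    then have "real s * real d \<le> 1 / 2 * real p ^ s * real d" by (rule mult_right_mono) simp
    then have "ereal (real (s * d)) \<le> ereal (1 / 2 * real (dim K (carrier L)))"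
      unfolding sd(3) by (simp add: mult_ac)
    then show "ereal_of_enat (ess_dim k K) \<le> ereal (1 / 2 * real (dim K (carrier L)))"
      using sd(4) order_trans by blast
  qed
qed

end
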